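(* Let $X$ be a finite ordered set, let $\rho$ be a non-crossing partition of a finite ordered set, and let $n\ge1$ be an integer. Then, in $\mathbb{C}(\widetilde{S}_\infty)$, $$\Sigma(M^{\mathrm P}_X)=M^{\mathrm{JM}}_{|X|},\qquad \Sigma(M^{\mathrm P}_\rho)=M^{\mathrm{JM}}_\rho,\qquad \Sigma(R^{\mathrm P}_n)=R^{\mathrm{JM}}_n.$$
   Context: Partial permutations: for a finite set $A$, a partial permutation of $A$ is a pair $(d,w)$ with $d\subseteq A$ (the support) and $w:A\to A$ a bijection with $w(x)=x$ for $x\in A\setminus d$. They form a semigroup $\widetilde{S}_A$ under $(d_1,w_1)(d_2,w_2)=(d_1\cup d_2,w_1w_2)$; $\mathbb{C}(\widetilde{S}_A)$ is its semigroup algebra. For $A\subseteq B$ there is a homomorphism $\theta^B_A:\mathbb{C}(\widetilde{S}_B)\to\mathbb{C}(\widetilde{S}_A)$ sending $(d,w)$ to $(d,w|_A)$ if $d\subseteq A$ and to $0$ otherwise. $\mathbb{C}(\widetilde{S}_\infty)$ is the projective limit of the algebras $\mathbb{C}(\widetilde{S}_{\{1,\dots,q\}})$, $q\to\infty$, along these maps. Normalized conjugacy class indicators: for integers $k_1,\dots,k_m\ge1$, in $\mathbb{C}(\widetilde{S}_A)$ put $\Sigma_{k_1,\dots,k_m}=\sum_a (a_{1,1},\dots,a_{1,k_1})\cdots(a_{m,1},\dots,a_{m,k_m})$, the sum over all injective families $a=(a_{r,s})_{1\le r\le m,1\le s\le k_r}$ of elements of $A$; each summand is a product of disjoint cycles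 regarded as a partial permutation with support $\{a_{r,s}\}$. If some $k_i=0$ then $\Sigma_{k_1,\dots,k_m}=0$. These are compatible with the maps $\theta^B_A$ and define $\Sigma_{k_1,\dots,k_m}\in\mathbb{C}(\widetilde{S}_\infty)$. Partition-indexed indicators: let $\pi$ be a partition of $\{1,\dots,n\}$, $n\ge1$. For a block with elements $x_1<\dots<x_l$ put $\pi_{\mathrm{fat}}(x_t')=x_{t+1}$ (with $x_{l+1}=x_1$); this defines a bijection $\pi_{\mathrm{fat}}:\{1',\dots,n'\}\to\{1,\dots,n\}$. Let $c(k)=(k-1)'$ for $k\ge2$, $c(1)=n'$. Decompose the permutation $\pi_{\mathrm{fat}}\circ c$ of $\{1,\dots,n\}$ into disjoint cycles $b_1,\dots,b_t$ (fixed points included), $b_s=(b_{s,1},\dots,b_{s,j_s})$ where $b_{s,i}\mapsto b_{s,i+1}$ and $b_{s,j_s+1}=b_{s,1}$. Put $k_s=j_s-\#\{1\le i\le j_s: b_{s,i}\le b_{s,i+1}\}$ and $\Sigma(\pi)=\Sigma_\pi:=\Sigma_{k_1,\dots,k_t}$. For partitions of other (nonempty) finite ordered sets relabel by the order-preserving bijection; extend $\Sigma$ linearly to formal linear combinations of partitions. Order: $\pi\le\sigma$ iff every block of $\pi$ is contained in a block of $\sigma$. Kreweras complement: for a non-crossing partition $\tau$ of $\{1,\dots,n\}$, $\tau_{\mathrm{comp}}$ is the largest non-crossing partition of $\{1',\dots,n'\}$ such that $\tau\cup\tau_{\mathrm{comp}}$ is a non-crossing partition of $1<1'<2<2'<\dots<n<n'$,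 viewed as a partition of $\{1,\dots,n\}$; $\rho_{\mathrm{comp}^{-1}}$ is the $\tau$ with $\tau_{\mathrm{comp}}=\rho$. $\rho$-ordered product: for a non-crossing partition $\rho=\{\rho_1,\dots,\rho_r\}$ of $X$ and partitions $\pi^s$ of $\rho_s$, $\prod_s\pi^s:=\sum_\sigma\sigma$ (formal sum) over all partitions $\sigma$ of $X$ such that for every $s$ and $a,b\in\rho_s$, $a,b$ are connected by $\sigma$ iff they are connected by $\pi^s$, and $\sigma\ge\rho_{\mathrm{comp}^{-1}}$; extended multilinearly. Partition moments and cumulants: $M^{\mathrm P}_X=\sum_\sigma\sigma$ over all partitions $\sigma$ of $X$; $M^{\mathrm P}_\rho=\prod_sM^{\mathrm P}_{\rho_s}$ ($\rho$-ordered product); $R^{\mathrm P}_n=\sum_{\rho\in NC(1,\dots,n)}\mathrm{Moeb}_{\rho_{\mathrm{comp}}}M^{\mathrm P}_\rho$, where $NC(1,\dots,n)$ is the set of non-crossing partitions of $\{1,\dots,n\}$, $\mathrm{Moeb}_\sigma=\prod_{b\in\sigma}(-1)^{|b|-1}c_{|b|-1}$, $c_k=\frac{(2k)!}{(k+1)!\,k!}$. Jucys--Murphy moments and cumulants: fix $\ast\notin A$. For $k\ge1$, $M^{\mathrm{JM}}_k\in\mathbb{C}(\widetilde{S}_A)$ is the sum over all $(a_1,\dots,a_k)\in A^k$ such that $(a_1\,\ast)\cdots(a_k\,\ast)$ fixes $\ast$ of this permutation restricted to $A$, with support $\{a_1,\dots,a_k\}$; these define $M^{\mathrm{JM}}_k\in\mathbb{C}(\widetilde{S}_\infty)$.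 $M^{\mathrm{JM}}_\rho=\prod_{b\in\rho}M^{\mathrm{JM}}_{|b|}$ and $R^{\mathrm{JM}}_n=\sum_{\rho\in NC(1,\dots,n)}\mathrm{Moeb}_{\rho_{\mathrm{comp}}}M^{\mathrm{JM}}_\rho$. *)

theory Defs
  imports Complex_Main "HOL-Library.Poly_Mapping" "HOL-Library.Disjoint_Sets" "HOL-Library.FuncSet"
    "HOL-Combinatorics.Cycles" "HOL-Combinatorics.Orbits"
begin

section \<open>Partial permutations and their semigroup algebras\<close>

text \<open>A partial permutation of a finite set of naturals is stored with its bijection extended by
  the identity to all of \<^typ>\<open>nat\<close>. So the partial permutations of \<open>A\<close> are exactly the elements
  whose support is contained in \<open>A\<close>, and \<open>(d, w)\<close>, \<open>(d, w|\<^sub>A)\<close> are the same object when \<open>d \<subseteq> A\<close>.\<close>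

typedef pperm = "{(d :: nat set, w :: nat \<Rightarrow> nat). finite d \<and> w permutes d}"
  morphisms pperm_pair Abs_pperm
  by (rule exI[of _ "({}, id)"]) (simp add: permutes_id)

setup_lifting type_definition_pperm

lift_definition psupp :: "pperm \<Rightarrow> nat set" is fst .

text \<open>Only meaningful if \<open>d\<close> is finite and \<open>w permutes d\<close>.\<close>

definition mk_pperm :: "nat set \<Rightarrow> (nat \<Rightarrow> nat) \<Rightarrow> pperm"
  where "mk_pperm d w = Abs_pperm (d, w)"

text \<open>The semigroup product is written \<open>+\<close> (it is not commutative) because the convolution product
  of \<open>'a \<Rightarrow>\<^sub>0 'b\<close> is available for additively written monoids. Thus \<open>pperm \<Rightarrow>\<^sub>0 complex\<close> with its
  library ring structure is the semigroup algebra of all finite partial permutations of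
  \<^typ>\<open>nat\<close>.\<close>

instantiation pperm :: monoid_add
begin

lift_definition zero_pperm :: pperm is "({}, id)"
  by (simp add: permutes_id)

lift_definition plus_pperm :: "pperm \<Rightarrow> pperm \<Rightarrow> pperm"
  is "\<lambda>(d1, w1) (d2, w2). (d1 \<union> d2, w1 \<circ> w2)"
  by (auto intro!: permutes_compose intro: permutes_subset)

instance
  by standard (transfer; auto simp: Un_assoc comp_assoc)+

end

type_synonym palg = "pperm \<Rightarrow>\<^sub>0 complex"

definition pperm_algebra :: "nat set \<Rightarrow> palg set"
  where "pperm_algebra A = {f. \<forall>p \<in> Poly_Mapping.keys f. psupp p \<subseteq> A}"

text \<open>\<open>theta A\<close> restricted to \<open>pperm_algebra B\<close>, \<open>A \<subseteq> B\<close>, is the projection from \<open>B\<close> to \<open>A\<close>.\<close>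

lift_definition theta :: "nat set \<Rightarrow> palg \<Rightarrow> palg"
  is "\<lambda>A f p. if psupp p \<subseteq> A then f p else 0"
  by (erule finite_subset[rotated]) auto

lemma psupp_zero [simp]: "psupp 0 = {}"
  by transfer simp

lemma psupp_plus [simp]: "psupp (p + q) = psupp p \<union> psupp q"
  by transfer auto

lemma psupp_mk_pperm [simp]: "finite d \<Longrightarrow> w permutes d \<Longrightarrow> psupp (mk_pperm d w) = d"
  by (simp add: mk_pperm_def psupp.rep_eq Abs_pperm_inverse)

lemma mem_pperm_algebra_iff:
  "f \<in> pperm_algebra A \<longleftrightarrow> (\<forall>p. \<not> psupp p \<subseteq> A \<longrightarrow> Poly_Mapping.lookup f p = 0)"
  by (auto simp: pperm_algebra_def in_keys_iff)

lemma lookup_theta: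
  "Poly_Mapping.lookup (theta A f) p = (if psupp p \<subseteq> A then Poly_Mapping.lookup f p else 0)"
  by transfer simp

lemma theta_zero [simp]: "theta A 0 = 0"
  by (rule poly_mapping_eqI) (simp add: lookup_theta)

lemma theta_add: "theta A (f + g) = theta A f + theta A g"
  by (rule poly_mapping_eqI) (simp add: lookup_theta lookup_add)

lemma theta_minus: "theta A (f - g) = theta A f - theta A g"
  by (rule poly_mapping_eqI) (simp add: lookup_theta lookup_minus)

lemma theta_uminus: "theta A (- f) = - theta A f"
  by (rule poly_mapping_eqI) (simp add: lookup_theta)

lemma theta_sum: "theta A (sum f I) = (\<Sum>i\<in>I. theta A (f i))"
  by (induction I rule: infinite_finite_induct) (auto simp: theta_add)

lemma theta_single:
  "theta A (Poly_Mapping.single p c) = (if psupp p \<subseteq> A then Poly_Mapping.single p c else 0)"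
  by (rule poly_mapping_eqI) (auto simp: lookup_theta lookup_single when_def)

lemma theta_one [simp]: "theta A 1 = 1"
  by (simp add: theta_single flip: single_one)

lemma theta_map: "theta A (Poly_Mapping.map ((*) c) f) = Poly_Mapping.map ((*) c) (theta A f)"
  by (rule poly_mapping_eqI) (auto simp: lookup_theta Poly_Mapping.map.rep_eq when_def)

lemma theta_mult: "theta A (f * g) = theta A f * theta A g"
proof -
  let ?s = Poly_Mapping.single
  let ?l = Poly_Mapping.lookup
  have dec: "(\<Sum>p\<in>Poly_Mapping.keys h. ?s p (?l h p)) = h" for h :: palg
    by (rule poly_mapping_eqI)
      (simp add: Poly_Mapping.lookup_sum lookup_single when_def in_keys_iff sum.delta)
  have s: "theta A (?s p a * ?s q b) = theta A (?s p a) * theta A (?s q b)" for p q a b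
    by (auto simp: mult_single theta_single)
  have "theta A (f * g) = theta A ((\<Sum>p\<in>Poly_Mapping.keys f. ?s p (?l f p)) *
      (\<Sum>q\<in>Poly_Mapping.keys g. ?s q (?l g q)))"
    by (simp only: dec)
  also have "\<dots> = theta A (\<Sum>p\<in>Poly_Mapping.keys f. ?s p (?l f p)) *
      theta A (\<Sum>q\<in>Poly_Mapping.keys g. ?s q (?l g q))"
    by (simp only: sum_product theta_sum s)
  finally show ?thesis by (simp only: dec)
qed

lemma pperm_algebra_iff_theta: "f \<in> pperm_algebra A \<longleftrightarrow> theta A f = f"
  by (auto simp: mem_pperm_algebra_iff poly_mapping_eq_iff fun_eq_iff lookup_theta)

subsection \<open>The projective limit\<close>

definition compatible :: "(nat \<Rightarrow> palg) \<Rightarrow> bool"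
  where "compatible f \<longleftrightarrow>
    (\<forall>q. f q \<in> pperm_algebra {1..q}) \<and> (\<forall>q q'. q \<le> q' \<longrightarrow> theta {1..q} (f q') = f q)"

lemma compatible_iff: "compatible f \<longleftrightarrow> (\<forall>q q'. q \<le> q' \<longrightarrow> theta {1..q} (f q') = f q)"
  by (auto simp: compatible_def pperm_algebra_iff_theta)

typedef palg_inf = "{f. compatible f}"
  morphisms component Abs_palg_inf
  by (rule exI[of _ "\<lambda>_. 0"]) (simp add: compatible_iff)

setup_lifting type_definition_palg_inf

instantiation palg_inf :: ring_1
begin

lift_definition zero_palg_inf :: palg_inf is "\<lambda>_. 0"
  by (simp add: compatible_iff)

lift_definition one_palg_inf :: palg_inf is "\<lambda>_. 1"
  by (simp add: compatible_iff)

lift_definition plus_palg_inf :: "palg_inf \<Rightarrow> palg_inf \<Rightarrow> palg_inf" is "\<lambda>f g q. f q + g q"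
  by (simp add: compatible_iff theta_add)

lift_definition minus_palg_inf :: "palg_inf \<Rightarrow> palg_inf \<Rightarrow> palg_inf" is "\<lambda>f g q. f q - g q"
  by (simp add: compatible_iff theta_minus)

lift_definition uminus_palg_inf :: "palg_inf \<Rightarrow> palg_inf" is "\<lambda>f q. - f q"
  by (simp add: compatible_iff theta_uminus)

lift_definition times_palg_inf :: "palg_inf \<Rightarrow> palg_inf \<Rightarrow> palg_inf" is "\<lambda>f g q. f q * g q"
  by (simp add: compatible_iff theta_mult)

instance
  by standard (transfer; simp add: fun_eq_iff algebra_simps)+

end

lift_definition scale_inf :: "complex \<Rightarrow> palg_inf \<Rightarrow> palg_inf"
  is "\<lambda>c f q. Poly_Mapping.map ((*) c) (f q)"
  by (simp add: compatible_iff theta_map)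

subsection \<open>Normalized conjugacy class indicators\<close>

definition pcycle :: "nat list \<Rightarrow> pperm"
  where "pcycle cs = mk_pperm (set cs) (cycle_of_list cs)"

text \<open>An injective family \<open>(a\<^sub>r\<^sub>,\<^sub>s)\<close> is a list of lists \<open>as\<close> with \<open>as ! (r-1) ! (s-1) = a\<^sub>r\<^sub>,\<^sub>s\<close>. The
  \<^const>\<open>sum_list\<close> is the product of the cycles in the semigroup.\<close>

definition class_ind_on :: "nat set \<Rightarrow> nat list \<Rightarrow> palg"
  where "class_ind_on A ks = (if 0 \<in> set ks then 0 else
    (\<Sum>as | map length as = ks \<and> distinct (concat as) \<and> set (concat as) \<subseteq> A.
      Poly_Mapping.single (sum_list (map pcycle as)) 1))"

lemma psupp_pcycle [simp]: "psupp (pcycle cs) = set cs"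
  by (simp add: pcycle_def cycle_permutes)

lemma psupp_cycles: "psupp (sum_list (map pcycle as)) = set (concat as)"
  by (induction as) auto

lemma theta_sum_supp:
  assumes "finite {t. P t \<and> s t \<subseteq> B}" and "A \<subseteq> B" and "\<And>t. P t \<Longrightarrow> s t \<subseteq> B \<Longrightarrow> psupp (g t) = s t"
  shows "theta A (\<Sum>t | P t \<and> s t \<subseteq> B. Poly_Mapping.single (g t) 1) =
    (\<Sum>t | P t \<and> s t \<subseteq> A. Poly_Mapping.single (g t) 1)"
proof -
  have "theta A (\<Sum>t | P t \<and> s t \<subseteq> B. Poly_Mapping.single (g t) 1) =
      (\<Sum>t | P t \<and> s t \<subseteq> B. if s t \<subseteq> A then Poly_Mapping.single (g t) 1 else 0)"
    unfolding theta_sum by (rule sum.cong) (auto simp: theta_single assms(3))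
  also have "\<dots> = (\<Sum>t \<in> {t \<in> {t. P t \<and> s t \<subseteq> B}. s t \<subseteq> A}. Poly_Mapping.single (g t) 1)"
    using assms(1) by (rule sum.inter_filter[symmetric])
  also have "{t \<in> {t. P t \<and> s t \<subseteq> B}. s t \<subseteq> A} = {t. P t \<and> s t \<subseteq> A}"
    using assms(2) by auto
  finally show ?thesis .
qed

lemma finite_families:
  assumes "finite B"
  shows "finite {as. (map length as = ks \<and> distinct (concat as)) \<and> set (concat as) \<subseteq> B}"
proof (rule finite_subset)
  let ?L = "{l. set l \<subseteq> B \<and> length l \<le> sum_list ks}"
  show "finite {as. set as \<subseteq> ?L \<and> length as = length ks}"
    by (intro finite_lists_length_eq finite_lists_length_le assms)
  show "{as. (map length as = ks \<and> distinct (concat as)) \<and> set (concat as) \<subseteq> B} \<subseteq>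
      {as. set as \<subseteq> ?L \<and> length as = length ks}"
    by (auto intro: member_le_sum_list)
qed

lift_definition class_ind :: "nat list \<Rightarrow> palg_inf" is "\<lambda>ks q. class_ind_on {1..q} ks"
proof -
  fix ks
  have "theta {1..q} (class_ind_on {1..q'} ks) = class_ind_on {1..q} ks" if "q \<le> q'" for q q'
    using theta_sum_supp[where s = "\<lambda>as. set (concat as)" and A = "{1..q}" and B = "{1..q'}"
        and P = "\<lambda>as. map length as = ks \<and> distinct (concat as)"
        and g = "\<lambda>as. sum_list (map pcycle as)", OF finite_families] that
    by (simp add: class_ind_on_def psupp_cycles conj_assoc)
  then show "compatible (\<lambda>q. class_ind_on {1..q} ks)"
    by (simp add: compatible_iff)
qed

section \<open>Partitions of finite ordered sets\<close>

definition noncrossing :: "'a::linorder set set \<Rightarrow> bool"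
  where "noncrossing P \<longleftrightarrow> (\<forall>A\<in>P. \<forall>B\<in>P. \<forall>a b c d.
    a < b \<and> b < c \<and> c < d \<and> a \<in> A \<and> c \<in> A \<and> b \<in> B \<and> d \<in> B \<longrightarrow> A = B)"

definition NC :: "'a::linorder set \<Rightarrow> 'a set set set"
  where "NC X = {P. partition_on X P \<and> noncrossing P}"

definition connected_by :: "'a set set \<Rightarrow> 'a \<Rightarrow> 'a \<Rightarrow> bool"
  where "connected_by P a b \<longleftrightarrow> (\<exists>B\<in>P. a \<in> B \<and> b \<in> B)"

text \<open>For finite \<open>X\<close> the map \<open>rank_in X\<close> is the order-preserving bijection
  \<open>X \<rightarrow> {1..card X}\<close>.\<close>

definition rank_in :: "'a::linorder set \<Rightarrow> 'a \<Rightarrow> nat"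
  where "rank_in X x = card {y\<in>X. y \<le> x}"

definition relabel :: "'a::linorder set \<Rightarrow> 'a set set \<Rightarrow> nat set set"
  where "relabel X P = (\<lambda>B. rank_in X ` B) ` P"

subsection \<open>Kreweras complement\<close>

text \<open>The linear order \<open>1 < 1' < 2 < 2' < \<dots> < n < n'\<close> is realised by putting \<open>i\<close> at \<open>2 * i\<close> and
  \<open>i'\<close> at \<open>2 * i + 1\<close>.\<close>

definition interleave :: "nat set set \<Rightarrow> nat set set \<Rightarrow> nat set set"
  where "interleave P Q = (\<lambda>B. (\<lambda>i. 2 * i) ` B) ` P \<union> (\<lambda>B. (\<lambda>i. 2 * i + 1) ` B) ` Q"

definition kreweras :: "nat \<Rightarrow> nat set set \<Rightarrow> nat set set"
  where "kreweras n P = (THE Q. Q \<in> NC {1..n} \<and> noncrossing (interleave P Q) \<and>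
    (\<forall>Q' \<in> NC {1..n}. noncrossing (interleave P Q') \<longrightarrow> refines {1..n} Q' Q))"

definition kreweras_inv :: "'a::linorder set \<Rightarrow> 'a set set \<Rightarrow> 'a set set"
  where "kreweras_inv X R =
    (THE P. P \<in> NC X \<and> kreweras (card X) (relabel X P) = relabel X R)"

definition catalan :: "nat \<Rightarrow> complex"
  where "catalan k = fact (2 * k) / (fact (k + 1) * fact k)"

definition Moeb :: "'a set set \<Rightarrow> complex"
  where "Moeb P = (\<Prod>b\<in>P. (-1) ^ (card b - 1) * catalan (card b - 1))"

subsection \<open>The indicator of a partition\<close>

text \<open>The primed elements \<open>k'\<close> are represented by \<open>k\<close>.\<close>

definition fat :: "nat set set \<Rightarrow> nat \<Rightarrow> nat"
  where "fat P x = (let B = (THE B. B \<in> P \<and> x \<in> B)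
    in if \<exists>y\<in>B. x < y then Min {y\<in>B. x < y} else Min B)"

definition shift :: "nat \<Rightarrow> nat \<Rightarrow> nat"
  where "shift n k = (if k = 1 then n else k - 1)"

definition ascent_defect :: "(nat \<Rightarrow> nat) \<Rightarrow> nat set \<Rightarrow> nat"
  where "ascent_defect f C = card C - card {x\<in>C. x \<le> f x}"

text \<open>The cycles are enumerated by their least elements.\<close>

definition cycle_type :: "nat \<Rightarrow> nat set set \<Rightarrow> nat list"
  where "cycle_type n P = (let f = fat P \<circ> shift n in
    map (\<lambda>x. ascent_defect f (orbit f x)) (filter (\<lambda>x. x = Min (orbit f x)) [1..<n+1]))"

definition Sigma_partition :: "'a::linorder set set \<Rightarrow> palg_inf"
  where "Sigma_partition P = class_ind (cycle_type (card (\<Union>P)) (relabel (\<Union>P) P))"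

subsection \<open>Formal linear combinations of partitions\<close>

type_synonym 'a pcomb = "'a set set \<Rightarrow>\<^sub>0 complex"

definition Sigma_lin :: "'a::linorder pcomb \<Rightarrow> palg_inf"
  where "Sigma_lin f =
    (\<Sum>P\<in>Poly_Mapping.keys f. scale_inf (Poly_Mapping.lookup f P) (Sigma_partition P))"

text \<open>The family \<open>(\<pi>\<^sup>s)\<close> is indexed by the blocks of \<open>R\<close> themselves.\<close>

definition ordered_prod_partitions ::
    "'a::linorder set set \<Rightarrow> ('a set \<Rightarrow> 'a set set) \<Rightarrow> 'a pcomb"
  where "ordered_prod_partitions R p =
    (\<Sum>S | partition_on (\<Union>R) S \<and>
        (\<forall>b\<in>R. \<forall>x\<in>b. \<forall>y\<in>b. connected_by S x y \<longleftrightarrow> connected_by (p b) x y) \<and>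
        refines (\<Union>R) (kreweras_inv (\<Union>R) R) S.
      Poly_Mapping.single S 1)"

definition ordered_prod :: "'a::linorder set set \<Rightarrow> ('a set \<Rightarrow> 'a pcomb) \<Rightarrow> 'a pcomb"
  where "ordered_prod R f =
    (\<Sum>p \<in> PiE R (\<lambda>b. Poly_Mapping.keys (f b)).
      Poly_Mapping.map ((*) (\<Prod>b\<in>R. Poly_Mapping.lookup (f b) (p b))) (ordered_prod_partitions R p))"

definition M_P :: "'a set \<Rightarrow> 'a pcomb"
  where "M_P X = (\<Sum>S | partition_on X S. Poly_Mapping.single S 1)"

definition M_P_NC :: "'a::linorder set set \<Rightarrow> 'a pcomb"
  where "M_P_NC R = ordered_prod R M_P"

definition R_P :: "nat \<Rightarrow> nat pcomb"
  where "R_P n = (\<Sum>R\<in>NC {1..n}. Poly_Mapping.map ((*) (Moeb (kreweras n R))) (M_P_NC R))"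

section \<open>Jucys--Murphy moments and cumulants\<close>

definition star_word :: "nat \<Rightarrow> nat list \<Rightarrow> nat \<Rightarrow> nat"
  where "star_word star as = foldr (\<lambda>a w. Transposition.transpose a star \<circ> w) as id"

text \<open>Here \<open>star \<notin> A\<close> is assumed. A word fixing \<open>star\<close> permutes its set of letters, so it is already
  equal to the identity extension of its restriction to \<open>A\<close>.\<close>

definition M_JM_on :: "nat \<Rightarrow> nat set \<Rightarrow> nat \<Rightarrow> palg"
  where "M_JM_on star A k =
    (\<Sum>as | length as = k \<and> star_word star as star = star \<and> set as \<subseteq> A.
      Poly_Mapping.single (mk_pperm (set as) (star_word star as)) 1)"

lemma star_word_permutes: "star_word star as permutes insert star (set as)"
proof (induction as)
  case Nil
  then show ?case by (simp add: star_word_def permutes_def)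
next
  case (Cons a as)
  have "star_word star as permutes insert star (set (a # as))"
    using Cons by (rule permutes_subset) auto
  moreover have "Transposition.transpose a star permutes insert star (set (a # as))"
    by (rule permutes_swap_id) auto
  ultimately have "Transposition.transpose a star \<circ> star_word star as permutes insert star (set (a # as))"
    by (rule permutes_compose)
  then show ?case
    by (simp add: star_word_def comp_def)
qed

lemma star_word_permutes':
  assumes "star_word star as star = star" and "star \<notin> set as"
  shows "star_word star as permutes set as"
  using star_word_permutes[of star as] assms by (auto simp: permutes_def)

text \<open>On \<open>A = {1..q}\<close> the extra point is taken to be \<open>0\<close>.\<close>

lift_definition M_JM :: "nat \<Rightarrow> palg_inf" is "\<lambda>k q. M_JM_on 0 {1..q} k"
proof -
  fix k
  have "theta {1..q} (M_JM_on 0 {1..q'} k) = M_JM_on 0 {1..q} k" if "q \<le> q'" for q q'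
  proof -
    have "finite {as. set as \<subseteq> {1..q'} \<and> length as = k}"
      by (rule finite_lists_length_eq) simp
    then have fin: "finite {as. (length as = k \<and> star_word 0 as 0 = 0) \<and> set as \<subseteq> {1..q'}}"
      by (rule finite_subset[rotated]) auto
    have "psupp (mk_pperm (set as) (star_word 0 as)) = set as"
      if "length as = k \<and> star_word 0 as 0 = 0" "set as \<subseteq> {1..q'}" for as
      using that by (intro psupp_mk_pperm star_word_permutes') auto
    from theta_sum_supp[where s = set and A = "{1..q}"
        and g = "\<lambda>as. mk_pperm (set as) (star_word 0 as)", OF fin _ this] that
    show ?thesis by (simp add: M_JM_on_def conj_assoc)
  qed
  then show "compatible (\<lambda>q. M_JM_on 0 {1..q} k)"
    by (simp add: compatible_iff)
qed

text \<open>The Jucys--Murphy moments commute, so the order of the factors is immaterial. They are listed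
  by increasing least elements of the blocks.\<close>

definition M_JM_NC :: "'a::linorder set set \<Rightarrow> palg_inf"
  where "M_JM_NC R =
    prod_list (map (\<lambda>x. M_JM (card (THE b. b \<in> R \<and> x \<in> b))) (sorted_list_of_set (Min ` R)))"

definition R_JM :: "nat \<Rightarrow> palg_inf"
  where "R_JM n = (\<Sum>R\<in>NC {1..n}. scale_inf (Moeb (kreweras n R)) (M_JM_NC R))"

end

theory Submission
  imports Defs
begin

text \<open>
  Reading a word \<open>(a\<^sub>1 *) \<dots> (a\<^sub>n *)\<close> from the left, the images \<open>p\<^sub>1 = *, p\<^sub>2, \<dots>, p\<^sub>n\<^sub>+\<^sub>1\<close> of \<open>*\<close> under
  its prefixes form a walk, and the word is the product of the transpositions
  \<open>(p\<^sub>n\<^sub>+\<^sub>1 p\<^sub>n) \<dots> (p\<^sub>2 p\<^sub>1)\<close>. Words that fix \<open>*\<close> thus correspond to closed walks that move in every step.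
  Following a single point through these transpositions shows that, when the walk has kernel \<open>\<pi>\<close>, the
  word acts on the visited points other than \<open>*\<close> as the first return map of \<open>\<pi>\<^sub>f\<^sub>a\<^sub>t \<circ> c\<close> to the set of
  minima of blocks not containing 1, and in each cycle of \<open>\<pi>\<^sub>f\<^sub>a\<^sub>t \<circ> c\<close> there are as many such minima as
  descents. Hence \<open>\<Sigma>\<^sub>\<pi>\<close> is the sum of all words with kernel \<open>\<pi>\<close>, and \<open>\<Sigma>(M\<^sup>P\<^sub>\<rho>)\<close> is the sum of the words
  whose walk is constant on the blocks of the inverse Kreweras complement of \<open>\<rho>\<close>, which means that
  every factor spanned by an interval that is a union of blocks of \<open>\<rho>\<close> fixes \<open>*\<close>. The block of \<open>\<rho>\<close>
  with the largest minimum is an interval; conjugating the letters to its right by the word it spans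
  splits off one Jucys--Murphy moment as the last factor.
\<close>

subsection \<open>Words in star transpositions and their walks\<close>

text \<open>The transposition at a step of the walk exchanges the place being entered with the place
  being left. So the point met on entering is put down where the walk has just been, and it rests
  there until the walk comes back. Put down at the place of time x - 1, it is met again at the next
  element of the block of x - 1, which is \<open>step x\<close>: iterating \<open>step\<close>
  follows one point through the word. If the block has no later element, \<open>step\<close> wraps
  around to its minimum and the point has reached its final place, labelled by that minimum. The
  block of 1 is the exception: its place is *, from where the last transposition still moves the
  point, so only the other minima count. A letter * would be a pause of the walk. It puts cyclically
  adjacent times into one block, which happens exactly when \<open>step\<close> has a fixed point,
  that is, when \<open>cycle_type\<close> contains 0. So the convention that such indicators vanish
  matches the fact that words without the letter * have no such kernel.\<close>

lemma star_word_Nil [simp]: "star_word s [] = id"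
  by (simp add: star_word_def)

lemma star_word_Cons: "star_word s (a # as) = Transposition.transpose a s \<circ> star_word s as"
  by (simp add: star_word_def)

lemma star_word_append: "star_word s (as @ bs) = star_word s as \<circ> star_word s bs"
  by (induction as) (auto simp: star_word_Cons comp_assoc)

lemma star_word_snoc_star [simp]: "star_word s (as @ [x]) s = star_word s as x"
  by (simp add: star_word_append star_word_Cons)

lemma bij_star_word: "bij (star_word s as)"
  using permutes_bij star_word_permutes by blast

text \<open>Since w fixes s, conjugation by w turns the transposition of a and s into that of w a
  and s, so it acts letter by letter.\<close>

lemma star_word_conj:
  assumes "bij w" and "w s = s"
  shows "star_word s (map w as) = w \<circ> star_word s as \<circ> inv w"
proof (induction as)
  case Nil
  then show ?case using assms by (simp add: fun_eq_iff bij_is_surj surj_f_inv_f)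
next
  case (Cons a as)
  have "Transposition.transpose (w a) s \<circ> w = w \<circ> Transposition.transpose a s"
  proof
    have inj: "w x = w y \<longleftrightarrow> x = y" for x y
      using assms(1) by (meson bij_is_inj inj_eq)
    have "w x = s \<longleftrightarrow> x = s" for x
      using inj[of x s] assms(2) by simp
    then show "(Transposition.transpose (w a) s \<circ> w) x = (w \<circ> Transposition.transpose a s) x" for x
      using inj by (auto simp: Transposition.transpose_def assms(2))
  qed
  then show ?case
    using Cons by (simp add: star_word_Cons fun_eq_iff)
qed

definition walk :: "nat \<Rightarrow> nat list \<Rightarrow> nat \<Rightarrow> nat"
  where "walk s as i = star_word s (take i as) s"

lemma walk_0 [simp]: "walk s as 0 = s"
  by (simp add: walk_def)

lemma walk_length: "walk s as (length as) = star_word s as s"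
  by (simp add: walk_def)

lemma walk_append [simp]: "i \<le> length as \<Longrightarrow> walk s (as @ bs) i = walk s as i"
  by (simp add: walk_def)

lemma walk_Suc: "i < length as \<Longrightarrow> walk s as (Suc i) = star_word s (take i as) (as ! i)"
  by (simp add: walk_def take_Suc_conv_app_nth)

text \<open>A new letter acts before the prefix. Moving it across the prefix conjugates it into the
  transposition of two successive places of the walk, which acts last; so a point can be followed
  one prefix at a time.\<close>

lemma star_word_take_Suc:
  assumes "i < length as"
  shows "star_word s (take (Suc i) as) =
    Transposition.transpose (walk s as (Suc i)) (walk s as i) \<circ> star_word s (take i as)"
proof -
  let ?w = "star_word s (take i as)"
  have "bij ?w" by (rule bij_star_word)
  then have "?w \<circ> Transposition.transpose (as ! i) s = Transposition.transpose (?w (as ! i)) (?w s) \<circ> ?w"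
    by (auto simp: fun_eq_iff Transposition.transpose_def bij_is_inj inj_eq)
  then show ?thesis
    using assms by (simp add: walk_Suc take_Suc_conv_app_nth star_word_append star_word_Cons)
      (simp add: walk_def)
qed

lemma walk_Suc_neq_iff: "i < length as \<Longrightarrow> walk s as (Suc i) = walk s as i \<longleftrightarrow> as ! i = s"
  using bij_star_word[of s "take i as"] by (simp add: walk_Suc) (simp add: walk_def bij_is_inj inj_eq)

text \<open>The common prefix is a bijection and cancels. This is the bridge between kernels of
  walks and subwords that fix the star.\<close>

lemma walk_eq_iff:
  assumes "i \<le> j"
  shows "walk s as i = walk s as j \<longleftrightarrow> star_word s (take (j - i) (drop i as)) s = s"
proof -
  have "take j as = take i as @ take (j - i) (drop i as)"
    using assms by (metis le_add_diff_inverse take_add)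
  then have "walk s as j = star_word s (take i as) (star_word s (take (j - i) (drop i as)) s)"
    by (simp add: walk_def star_word_append)
  then show ?thesis
    using bij_star_word[of s "take i as"] by (auto simp: walk_def bij_is_inj inj_eq)
qed

text \<open>A letter that has not occurred before is fixed by the prefix, so the walk goes to that
  very letter; with an old letter it stays among the star and the old letters, which the prefix
  permutes.\<close>

lemma visited_walk: "insert s (set as) = walk s as ` {..length as}"
proof (induction as rule: rev_induct)
  case Nil
  then show ?case by simp
next
  case (snoc x as)
  have *: "walk s (as @ [x]) ` {..length as} = walk s as ` {..length as}"
    by (rule image_cong) auto
  have "walk s (as @ [x]) ` {..length (as @ [x])} =
      insert (star_word s as x) (walk s (as @ [x]) ` {..length as})"
    by (simp add: atMost_Suc walk_Suc)
  also have "\<dots> = insert (star_word s as x) (insert s (set as))"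
    by (simp only: * snoc)
  also have "\<dots> = insert s (set (as @ [x]))"
  proof (cases "x \<in> insert s (set as)")
    case True
    then have "star_word s as x \<in> insert s (set as)"
      using star_word_permutes[of s as] by (simp only: permutes_in_image)
    then show ?thesis using True by auto
  next
    case False
    then have "star_word s as x = x"
      using star_word_permutes[of s as] by (meson permutes_not_in)
    then show ?thesis by auto
  qed
  finally show ?case by simp
qed

lemma walk_inj:
  assumes "length as = length bs" and "\<And>i. i \<le> length as \<Longrightarrow> walk s as i = walk s bs i"
  shows "as = bs"
  using assms
proof (induction as arbitrary: bs rule: rev_induct)
  case Nil
  then show ?case by simp
next
  case (snoc x as)
  then obtain y cs where bs: "bs = cs @ [y]" and len: "length cs = length as"
    by (metis append_butlast_last_id butlast_snoc length_butlast length_0_conv snoc_eq_iff_butlast)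
  have "as = cs"
  proof (rule snoc.IH)
    show "walk s as i = walk s cs i" if "i \<le> length as" for i
      using snoc.prems(2)[of i] that len by (simp add: bs)
  qed (simp add: len)
  moreover have "x = y"
  proof -
    have "star_word s cs x = star_word s cs y"
      using snoc.prems(2)[of "Suc (length cs)"] by (simp add: bs walk_Suc \<open>as = cs\<close>)
    then show ?thesis
      using bij_star_word[of s cs] by (meson bij_is_inj inj_eq)
  qed
  ultimately show ?case by (simp add: bs)
qed

text \<open>Each letter is the next place pulled back through the prefix; where q pauses, the letter
  is s. With \<open>walk_inj\<close>, words of length n correspond to walks of n steps from
  s.\<close>

lemma ex_walk:
  assumes "q 0 = s"
  shows "\<exists>as. length as = n \<and> (\<forall>i\<le>n. walk s as i = q i)"
proof (induction n)
  case 0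
  then show ?case using assms by simp
next
  case (Suc n)
  then obtain as where as: "length as = n" "\<forall>i\<le>n. walk s as i = q i" by auto
  let ?x = "inv (star_word s as) (q (Suc n))"
  have "star_word s as ?x = q (Suc n)"
    using bij_star_word[of s as] by (simp add: bij_is_surj surj_f_inv_f)
  then have "\<forall>i\<le>Suc n. walk s (as @ [?x]) i = q i"
    using as by (auto simp: le_Suc_eq walk_Suc)
  then show ?case using as by (intro exI[of _ "as @ [?x]"]) auto
qed

subsection \<open>The cyclic successor in a partition of an interval\<close>

locale interval_partition =
  fixes n :: nat and P :: "nat set set"
  assumes part: "partition_on {1..n} P" and n_pos: "1 \<le> n"
begin

definition blk :: "nat \<Rightarrow> nat set"
  where "blk x = (THE B. B \<in> P \<and> x \<in> B)"

text \<open>The permutation whose cycles are counted in \<open>cycle_type\<close>. If blocks collect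
  the times at which a walk is at one place, this is the time, cyclically next after x - 1, at which
  the walk is where it was at time x - 1.\<close>

definition step :: "nat \<Rightarrow> nat"
  where "step = fat P \<circ> shift n"

text \<open>The block of 1 is left out because it stands for the visits of \<open>*\<close>.\<close>

definition mins :: "nat set"
  where "mins = Min ` P - {1}"

lemma blk_eq: "B \<in> P \<Longrightarrow> x \<in> B \<Longrightarrow> blk x = B"
  unfolding blk_def using partition_onD2[OF part] by (intro the_equality) (auto dest: disjointD)

lemma blk:
  assumes "x \<in> {1..n}"
  shows "blk x \<in> P" and "x \<in> blk x"
proof -
  obtain B where "B \<in> P" "x \<in> B"
    using partition_onD1[OF part] assms by blast
  then show "blk x \<in> P" and "x \<in> blk x" using blk_eq by auto
qed

lemma block_subset: "B \<in> P \<Longrightarrow> B \<subseteq> {1..n}"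
  using partition_onD1[OF part] by blast

lemma finite_block: "B \<in> P \<Longrightarrow> finite B"
  using block_subset finite_subset by blast

lemma block_nonempty: "B \<in> P \<Longrightarrow> B \<noteq> {}"
  using partition_onD3[OF part] by blast

lemma blk_subset: "x \<in> {1..n} \<Longrightarrow> blk x \<subseteq> {1..n}"
  using blk block_subset by blast

lemma finite_blk: "x \<in> {1..n} \<Longrightarrow> finite (blk x)"
  using blk finite_block by blast

lemma mem_blk: "x \<in> {1..n} \<Longrightarrow> y \<in> blk x \<Longrightarrow> y \<in> {1..n} \<and> blk y = blk x"
  using blk blk_eq blk_subset by blast

lemma mem_blk_iff: "x \<in> {1..n} \<Longrightarrow> y \<in> {1..n} \<Longrightarrow> y \<in> blk x \<longleftrightarrow> blk y = blk x"
  using mem_blk blk by blast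

lemma fat_cases:
  assumes "x \<in> {1..n}"
  obtains "x < fat P x" and "fat P x \<in> blk x" and "\<And>y. y \<in> blk x \<Longrightarrow> x < y \<Longrightarrow> fat P x \<le> y"
  | "fat P x = Min (blk x)" and "fat P x \<in> blk x" and "\<And>y. y \<in> blk x \<Longrightarrow> y \<le> x"
proof (cases "\<exists>y\<in>blk x. x < y")
  case True
  have fin: "finite {y \<in> blk x. x < y}" using finite_blk[OF assms] by simp
  have eq: "fat P x = Min {y \<in> blk x. x < y}"
    using True by (simp add: fat_def blk_def Let_def)
  have "Min {y \<in> blk x. x < y} \<in> {y \<in> blk x. x < y}"
    using True fin by (intro Min_in) auto
  moreover have "Min {y \<in> blk x. x < y} \<le> y" if "y \<in> blk x" "x < y" for y
    using that fin by (intro Min_le) auto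
  ultimately show ?thesis using that(1) eq by auto
next
  case False
  then have eq: "fat P x = Min (blk x)"
    by (auto simp add: fat_def blk_def Let_def)
  have "Min (blk x) \<in> blk x"
    using finite_blk[OF assms] blk[OF assms] by (intro Min_in) auto
  then show ?thesis using that(2) eq False by (metis leI)
qed

lemma fat_in_blk: "x \<in> {1..n} \<Longrightarrow> fat P x \<in> blk x"
  using fat_cases[of x] by metis

lemma blk_fat: "x \<in> {1..n} \<Longrightarrow> blk (fat P x) = blk x"
  using fat_in_blk mem_blk by blast

lemma fat_in: "x \<in> {1..n} \<Longrightarrow> fat P x \<in> {1..n}"
  using fat_in_blk mem_blk by blast

lemma Min_blk_le: "x \<in> {1..n} \<Longrightarrow> y \<in> blk x \<Longrightarrow> Min (blk x) \<le> y"
  using finite_blk by simp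

lemma inj_on_fat: "inj_on (fat P) {1..n}"
proof -
  have False if "x \<in> {1..n}" "y \<in> {1..n}" "fat P x = fat P y" "x < y" for x y
  proof -
    have b: "blk x = blk y" using blk_fat that by metis
    have yx: "y \<in> blk x" using b blk that by auto
    have xy: "x \<in> blk y" using b blk that by auto
    show False
    proof (rule fat_cases[OF that(1)])
      assume 1: "x < fat P x" "\<And>z. z \<in> blk x \<Longrightarrow> x < z \<Longrightarrow> fat P x \<le> z"
      then have "fat P y \<le> y" using yx that by auto
      then have "fat P y = Min (blk y)"
        using fat_cases[OF that(2)] by (metis leD)
      then show False using Min_blk_le[OF that(2) xy] 1 that by simp
    next
      assume "\<And>z. z \<in> blk x \<Longrightarrow> z \<le> x"
      then show False using yx that by fastforce
    qed
  qed
  then show ?thesis by (intro inj_onI) (metis nat_neq_iff)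
qed

lemma shift_in: "x \<in> {1..n} \<Longrightarrow> shift n x \<in> {1..n}"
  using n_pos by (auto simp: shift_def)

lemma inj_on_shift: "inj_on (shift n) {1..n}"
  by (auto simp: inj_on_def shift_def split: if_splits)

lemma step_in: "x \<in> {1..n} \<Longrightarrow> step x \<in> {1..n}"
  using fat_in shift_in by (simp add: step_def del: atLeastAtMost_iff)

lemma inj_on_step: "inj_on step {1..n}"
  unfolding step_def
  by (rule comp_inj_on[OF inj_on_shift]) (rule inj_on_subset[OF inj_on_fat], use shift_in in blast)

lemma step_1: "step 1 = Min (blk n)"
proof -
  have n: "n \<in> {1..n}" using n_pos by simp
  have "fat P n = Min (blk n)"
    using fat_cases[OF n] fat_in[OF n] by (metis atLeastAtMost_iff leD)
  then show ?thesis by (simp add: step_def shift_def)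
qed

text \<open>The two cases are the weak ascents and the descents of \<open>step\<close>; a descent is
  a wrap-around in the block of x - 1.\<close>

lemma step_cases:
  assumes "x \<in> {2..n}"
  obtains "x \<le> step x" and "step x \<in> blk (x - 1)" and "\<And>y. y \<in> blk (x - 1) \<Longrightarrow> x \<le> y \<Longrightarrow> step x \<le> y"
  | "step x = Min (blk (x - 1))" and "step x < x" and "step x \<in> blk (x - 1)"
    and "\<And>y. y \<in> blk (x - 1) \<Longrightarrow> y < x"
proof -
  have x: "x - 1 \<in> {1..n}" and eq: "step x = fat P (x - 1)"
    using assms by (auto simp: step_def shift_def)
  show ?thesis
  proof (rule fat_cases[OF x])
    assume *: "x - 1 < fat P (x - 1)" "fat P (x - 1) \<in> blk (x - 1)"
      "\<And>y. y \<in> blk (x - 1) \<Longrightarrow> x - 1 < y \<Longrightarrow> fat P (x - 1) \<le> y"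
    show ?thesis
      by (rule that(1)) (use * assms in \<open>auto simp: eq\<close>)
  next
    assume *: "fat P (x - 1) = Min (blk (x - 1))" "fat P (x - 1) \<in> blk (x - 1)"
      "\<And>y. y \<in> blk (x - 1) \<Longrightarrow> y \<le> x - 1"
    have "y < x" if "y \<in> blk (x - 1)" for y
      using *(3)[OF that] assms by auto
    then show ?thesis using that(2) * by (auto simp: eq)
  qed
qed

lemma blk_Min: "x \<in> {1..n} \<Longrightarrow> Min (blk x) \<in> {1..n} \<and> blk (Min (blk x)) = blk x"
  using mem_blk Min_in finite_blk blk by (metis empty_iff)

lemma blk_MinB: "B \<in> P \<Longrightarrow> Min B \<in> {1..n} \<and> blk (Min B) = B"
  by (metis Min_in block_nonempty block_subset blk_eq finite_block subset_iff)

lemma mem_mins_iff: "x \<in> mins \<longleftrightarrow> x \<in> {2..n} \<and> Min (blk x) = x"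
proof
  assume "x \<in> mins"
  then show "x \<in> {2..n} \<and> Min (blk x) = x"
    unfolding mins_def using blk_MinB by force
next
  assume "x \<in> {2..n} \<and> Min (blk x) = x"
  moreover from this have "blk x \<in> P" by (intro blk) auto
  ultimately show "x \<in> mins" unfolding mins_def by force
qed

lemma mins_subset: "mins \<subseteq> {1..n}"
  using mem_mins_iff by auto

lemma Min_1: "Min (blk 1) = 1"
  using Min_blk_le[of 1 1] blk[of 1] blk_Min[of 1] n_pos by fastforce

text \<open>A descent is a wrap-around, so it ends in a block minimum. Conversely every block
  minimum is reached by a wrap-around, but the one from 1 is no descent, as nothing lies below 1.
  Hence \<open>step\<close> maps the descents in C onto the block minima in C other than
  \<open>step 1\<close>. Since C contains 1 iff it contains \<open>step 1\<close>, and both are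
  block minima, leaving out 1 instead gives the same number.\<close>

lemma ascent_defect_step:
  assumes "C \<subseteq> {1..n}" and "step ` C = C"
  shows "ascent_defect step C = card (C \<inter> mins)"
proof -
  let ?M = "{x \<in> {1..n}. Min (blk x) = x}"
  have fin: "finite C" using assms(1) finite_subset by blast
  have M: "mins = ?M - {1}" by (auto simp: mem_mins_iff)
  have n: "n \<in> {1..n}" and one: "1 \<in> {1..n}" using n_pos by auto
  have M1: "1 \<in> ?M" using one Min_1 by simp
  have Mn: "step 1 \<in> ?M" using step_1 blk_Min[OF n] by simp
  have desc: "step x < x \<longleftrightarrow> step x \<in> ?M - {step 1}" if x: "x \<in> {1..n}" for x
  proof (cases "x = 1")
    case True
    then show ?thesis using step_in[OF one] by auto
  next
    case False
    then have x2: "x \<in> {2..n}" using x by auto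
    then have x1: "x - 1 \<in> {1..n}" by auto
    have ne: "step x \<noteq> step 1" using inj_on_step x one False by (auto dest: inj_onD)
    show ?thesis
    proof (rule step_cases[OF x2])
      assume *: "x \<le> step x" "step x \<in> blk (x - 1)"
      have "Min (blk (x - 1)) \<le> x - 1" by (rule Min_blk_le) (use x1 blk in auto)
      moreover have "blk (step x) = blk (x - 1)" using mem_blk[OF x1] * by blast
      ultimately have "Min (blk (step x)) \<noteq> step x" using * x2 by auto
      then show ?thesis using * by auto
    next
      assume *: "step x = Min (blk (x - 1))" "step x < x"
      then have "step x \<in> ?M" using blk_Min[OF x1] by auto
      then show ?thesis using * ne by auto
    qed
  qed
  have inj: "inj_on step C" using inj_on_step assms(1) inj_on_subset by blast
  have "card C - card {x \<in> C. x \<le> step x} = card (C - {x \<in> C. x \<le> step x})"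
    using fin by (subst card_Diff_subset) auto
  also have "C - {x \<in> C. x \<le> step x} = {x \<in> C. step x < x}" by auto
  also have "card \<dots> = card (step ` {x \<in> C. step x < x})"
    using inj by (intro card_image[symmetric]) (auto intro: inj_on_subset)
  also have "step ` {x \<in> C. step x < x} = C \<inter> ?M - {step 1}"
  proof -
    have "{x \<in> C. step x < x} = {x \<in> C. step x \<in> ?M - {step 1}}"
      using desc assms(1) by blast
    then have "step ` {x \<in> C. step x < x} = step ` C \<inter> (?M - {step 1})"
      by auto
    then show ?thesis using assms(2) by auto
  qed
  also have "card \<dots> = card (C \<inter> ?M - {1})"
  proof (cases "1 \<in> C")
    case True
    then have "step 1 \<in> C" using assms(2) by blast
    then show ?thesis using True M1 Mn fin by (simp add: card_Diff_singleton)
  next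
    case False
    have "step 1 \<notin> C"
    proof
      assume "step 1 \<in> C"
      then obtain y where "y \<in> C" "step y = step 1" using assms(2) by (metis imageE)
      then show False using inj_on_step assms(1) one False by (metis inj_onD subsetD)
    qed
    then show ?thesis using False by simp
  qed
  also have "C \<inter> ?M - {1} = C \<inter> mins" using M by auto
  finally show ?thesis by (simp add: ascent_defect_def)
qed

end

section \<open>Following a point through a word with a given kernel\<close>

lemma star_word_take_stationary:
  assumes "star_word s (take i as) v = u" and "i \<le> j" and "j \<le> length as"
    and "\<And>k. i \<le> k \<Longrightarrow> k \<le> j \<Longrightarrow> walk s as k \<noteq> u"
  shows "star_word s (take j as) v = u"
  using assms(2,3,4)
proof (induction j rule: dec_induct)
  case base
  then show ?case using assms(1) by simp
next
  case (step j)
  \<comment> \<open>The next transposition exchanges the places of the walk at indices j and j + 1,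
    and u is neither of them.\<close>
  have "walk s as j \<noteq> u" "walk s as (Suc j) \<noteq> u" using step.prems(2) step.hyps by auto
  moreover have "star_word s (take j as) v = u" using step by auto
  ultimately show ?case
    using step.prems(1) by (simp add: star_word_take_Suc Transposition.transpose_def)
qed

text \<open>F is constant along entries that fail Q, so these can be skipped. With F =
  \<open>final\<close> and membership in \<open>mins\<close> for Q, this is where the first return
  map arises.\<close>

lemma successively_filter:
  assumes "successively (\<lambda>x y. F x = (if Q y then p y else F y)) (x # xs)"
  shows "successively (\<lambda>x y. F x = p y) (x # filter Q xs)"
  using assms
proof (induction xs arbitrary: x)
  case Nil
  then show ?case by simp
next
  case (Cons y ys)
  then have "successively (\<lambda>x y. F x = p y) (y # filter Q ys)" by simp
  then show ?case using Cons.prems by (cases "filter Q ys") auto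
qed

text \<open>Repeating c at the end of the list makes the relation cover the closing arrow of the
  cycle as well.\<close>

lemma cycle_of_list_successively:
  assumes "successively (\<lambda>x y. F x = p y) (c # cs @ [c])" and "distinct (map p (c # cs))"
    and "x \<in> set (c # cs)"
  shows "cycle_of_list (map p (c # cs)) (p x) = F x"
proof -
  let ?ls = "c # cs"
  have "map (cycle_of_list (map p ?ls)) (map p ?ls) = map p (cs @ [c])"
    using cyclic_rotation[OF assms(2), of 1] by simp
  moreover have "map F ?ls = map p (cs @ [c])"
  proof (rule nth_equalityI)
    fix i assume "i < length (map F ?ls)"
    then have i: "i < length ?ls" by simp
    then have "F ((?ls @ [c]) ! i) = p ((?ls @ [c]) ! Suc i)"
      using assms(1) by (simp add: successively_conv_nth)
    then show "map F ?ls ! i = map p (cs @ [c]) ! i"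
      using i by (simp only: nth_append nth_map) (simp add: nth_append)
  qed simp
  ultimately have "map (\<lambda>x. cycle_of_list (map p ?ls) (p x)) ?ls = map F ?ls"
    by (simp add: comp_def)
  then show ?thesis using assms(3) by (metis map_eq_conv)
qed

text \<open>Times are counted from 1 to match the ground set of the partition: \<open>p x\<close> is
  the walk at index x - 1, and \<open>p (Suc n)\<close> is the return to s.\<close>

locale kernel_word = interval_partition +
  fixes s :: nat and as :: "nat list" and p :: "nat \<Rightarrow> nat"
  assumes len: "length as = n" and closed: "star_word s as s = s" and star: "s \<notin> set as"
    and p: "\<And>x. p x = walk s as (x - 1)"
    and ker: "\<And>x y. x \<in> {1..n} \<Longrightarrow> y \<in> {1..n} \<Longrightarrow> p x = p y \<longleftrightarrow> blk x = blk y"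
begin

text \<open>The final place of the point that is located at \<open>p x\<close> just before the walk enters \<open>p x\<close> at
  time \<open>x\<close>. Time 1 has to be read as \<open>n + 1\<close>: the last transposition moves this point to \<open>p n\<close>.\<close>

definition final :: "nat \<Rightarrow> nat"
  where "final x = (if x = 1 then p n
    else star_word s as (inv (star_word s (take (x - 2) as)) (p x)))"

lemma p_1 [simp]: "p 1 = s" "p (Suc 0) = s"
  by (auto simp: p)

lemma p_end [simp]: "p (Suc n) = s"
  using closed walk_length[of s as] by (simp add: p len)

lemma p_Suc_neq:
  assumes "x \<in> {1..n}"
  shows "p (Suc x) \<noteq> p x"
proof -
  have x: "x - 1 < length as" "Suc (x - 1) = x" using assms len by auto
  then have "as ! (x - 1) \<noteq> s" using star nth_mem by metis
  then show ?thesis using walk_Suc_neq_iff[OF x(1), of s] x(2) by (simp add: p)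
qed

lemma blk_Suc_neq: "x \<in> {1..<n} \<Longrightarrow> blk (Suc x) \<noteq> blk x"
  using p_Suc_neq[of x] ker[of "Suc x" x] by auto

lemma blk_n_neq: "blk n \<noteq> blk 1"
  using p_Suc_neq[of n] ker[of n 1] n_pos by auto

lemma final_step:
  assumes "x \<in> {1..n}"
  shows "final x = (if step x \<in> mins then p (step x) else final (step x))"
proof (cases "x = 1")
  case True
  \<comment> \<open>The last step starts at p n, and \<open>step 1\<close> is the time of the first
    visit there. This place is not s, because the last step moves.\<close>
  have n: "n \<in> {1..n}" using n_pos by simp
  define m where "m = Min (blk n)"
  have m: "m \<in> {1..n}" "blk m = blk n" using blk_Min[OF n] by (simp_all only: m_def)
  then have "m \<noteq> 1" using blk_n_neq by metis
  then have "m \<in> mins" using m by (simp add: mem_mins_iff m_def)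
  moreover have "p n = p m" using ker[OF n m(1)] m(2) by simp
  moreover have "step 1 = m" by (simp only: step_1 m_def)
  ultimately show ?thesis using True by (simp add: final_def)
next
  case False
  then have x2: "x \<in> {2..n}" and x1: "x - 1 \<in> {1..n}" using assms by auto
  let ?v = "inv (star_word s (take (x - 2) as)) (p x)"
  let ?u = "p (x - 1)"
  have v: "star_word s (take (x - 2) as) ?v = p x"
    using bij_star_word by (simp add: bij_is_surj surj_f_inv_f)
  have x2': "x - 2 < length as" "Suc (x - 2) = x - 1" using x2 len by auto
  \<comment> \<open>The point waiting at p x is carried to \<open>?u\<close>, the place which the
    walk leaves at this moment.\<close>
  have w1: "star_word s (take (x - 1) as) ?v = ?u"
  proof -
    have "walk s as (x - 1) = p x" by (simp only: p)
    moreover have "walk s as (x - 2) = ?u" by (simp only: p diff_diff_left one_add_one)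
    ultimately have "star_word s (take (x - 1) as) =
        Transposition.transpose (p x) ?u \<circ> star_word s (take (x - 2) as)"
      using star_word_take_Suc[OF x2'(1), of s] by (simp only: x2'(2))
    then show ?thesis using v by simp
  qed
  have fin: "final x = star_word s as ?v" using False by (simp add: final_def)
  have neq: "p y \<noteq> ?u" if "y \<in> {1..n}" "y \<notin> blk (x - 1)" for y
    using ker[OF that(1) x1] mem_blk_iff[OF x1 that(1)] that(2) by simp
  show ?thesis
  proof (rule step_cases[OF x2])
    assume *: "x \<le> step x" "step x \<in> blk (x - 1)"
      and next_le: "\<And>y. y \<in> blk (x - 1) \<Longrightarrow> x \<le> y \<Longrightarrow> step x \<le> y"
    have sx: "step x \<in> {1..n}" "blk (step x) = blk (x - 1)" using mem_blk[OF x1 *(2)] by auto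
    have "x - 1 \<in> {1..<n}" "Suc (x - 1) = x" using x2 by auto
    then have "blk x \<noteq> blk (x - 1)" using blk_Suc_neq by metis
    then have "step x \<noteq> x" using sx(2) by metis
    then have gt: "x < step x" using * by simp
    \<comment> \<open>The prefix just before the entry at time \<open>step x\<close> has length
      \<open>step x - 2\<close>. The walk avoids \<open>?u\<close> until then, so it meets the same
      point again and the final places agree.\<close>
    have "star_word s (take (step x - 2) as) ?v = ?u"
    proof (rule star_word_take_stationary[OF w1])
      show "x - 1 \<le> step x - 2" using gt by simp
      show "step x - 2 \<le> length as" using sx len by auto
      fix k assume k: "x - 1 \<le> k" "k \<le> step x - 2"
      have *: "x \<le> Suc k" "Suc k < step x" using k gt x2 by auto
      then have "Suc k \<notin> blk (x - 1)" using next_le[of "Suc k"] by linarith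
      then have "p (Suc k) \<noteq> ?u" using * sx(1) by (intro neq) auto
      then show "walk s as k \<noteq> ?u" by (simp add: p)
    qed
    moreover have "p (step x) = ?u" using ker[OF sx(1) x1] sx(2) by simp
    ultimately have "inv (star_word s (take (step x - 2) as)) (p (step x)) = ?v"
      using bij_star_word by (metis bij_is_inj inv_f_f)
    moreover have "step x \<noteq> 1" using gt x2 by auto
    ultimately have "final (step x) = final x" using False by (simp add: final_def)
    moreover have "Min (blk (step x)) \<le> x - 1"
      using Min_blk_le[OF x1 blk(2)[OF x1]] sx(2) by simp
    then have "step x \<notin> mins" using gt by (auto simp: mem_mins_iff)
    ultimately show ?thesis by simp
  next
    assume *: "step x = Min (blk (x - 1))" "step x < x" "step x \<in> blk (x - 1)"
      and last: "\<And>y. y \<in> blk (x - 1) \<Longrightarrow> y < x"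
    have sx: "step x \<in> {1..n}" "blk (step x) = blk (x - 1)" using mem_blk[OF x1 *(3)] by auto
    have pu: "p (step x) = ?u" using ker[OF sx(1) x1] sx(2) by simp
    \<comment> \<open>There is no visit to \<open>?u\<close> at the times x to n, so only the last
      transposition, of s and p n, can still move the point.\<close>
    have away: "walk s as k \<noteq> ?u" if k: "x - 1 \<le> k" "k \<le> n - 1" for k
    proof -
      have *: "x \<le> Suc k" "Suc k \<le> n" using k x2 by auto
      then have "Suc k \<notin> blk (x - 1)" using last[of "Suc k"] by linarith
      then have "p (Suc k) \<noteq> ?u" using * x2 by (intro neq) auto
      then show ?thesis by (simp add: p)
    qed
    have w2: "star_word s (take (n - 1) as) ?v = ?u"
      by (rule star_word_take_stationary[OF w1 _ _ away]) (use x2 len in auto)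
    have "take n as = as" using len by simp
    moreover have "walk s as n = s" using p_end p[of "Suc n"] by simp
    moreover have "walk s as (n - 1) = p n" by (simp add: p)
    ultimately have "star_word s as = Transposition.transpose s (p n) \<circ> star_word s (take (n - 1) as)"
      using star_word_take_Suc[of "n - 1" as s] len n_pos by simp
    then have fin': "final x = Transposition.transpose s (p n) ?u" using w2 fin by simp
    show ?thesis
    \<comment> \<open>If \<open>step x = 1\<close>, the point rests at s and the return of the walk
      sends it to p n, which is the value chosen for \<open>final 1\<close>. Otherwise the last
      transposition does not touch it.\<close>
    proof (cases "step x = 1")
      case True
      then have "?u = s" using pu by simp
      then have "final x = p n" using fin' by simp
      then show ?thesis using True by (simp add: final_def mins_def)
    next
      case ne: False
      then have "step x \<in> mins" using * sx by (auto simp: mem_mins_iff)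
      have "blk 1 \<noteq> blk (step x)" using Min_1 * sx ne by metis
      then have "p 1 \<noteq> p (step x)" using ker[of 1 "step x"] sx(1) n_pos by simp
      moreover have "x - 1 \<le> n - 1" using x2 by auto
      then have "p n \<noteq> ?u" using away[of "n - 1"] by (simp add: p)
      ultimately have "final x = p (step x)" using fin' pu by (simp add: Transposition.transpose_def)
      then show ?thesis using \<open>step x \<in> mins\<close> by simp
    qed
  qed
qed

text \<open>Time x is the first visit to p x, so no earlier transposition involves this place and
  the point found there is p x itself.\<close>

lemma final_mins:
  assumes "x \<in> mins"
  shows "final x = star_word s as (p x)"
proof -
  have x: "x \<in> {2..n}" "Min (blk x) = x" using assms by (auto simp: mem_mins_iff)
  then have x1: "x \<in> {1..n}" by auto
  have "star_word s (take (x - 2) as) (p x) = p x"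
  proof (rule star_word_take_stationary[of s 0])
    show "x - 2 \<le> length as" using x len by auto
    fix k assume k: "k \<le> x - 2"
    then have k1: "Suc k \<in> {1..n}" using x by auto
    have "Suc k \<notin> blk x" using Min_blk_le[OF x1, of "Suc k"] x k by auto
    then have "p (Suc k) \<noteq> p x" using ker[OF k1 x1] mem_blk_iff[OF x1 k1] by simp
    then show "walk s as k \<noteq> p x" by (simp add: p)
  qed auto
  then have "inv (star_word s (take (x - 2) as)) (p x) = p x"
    using bij_star_word by (metis bij_is_inj inv_f_f)
  then show ?thesis using x by (simp add: final_def)
qed

end

section \<open>Products of disjoint cycles\<close>

lemma distinct_concat_map:
  assumes "distinct xs" and "\<And>x. x \<in> set xs \<Longrightarrow> distinct (h x)"
    and "\<And>x y. x \<in> set xs \<Longrightarrow> y \<in> set xs \<Longrightarrow> x \<noteq> y \<Longrightarrow> set (h x) \<inter> set (h y) = {}"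
  shows "distinct (concat (map h xs))"
  using assms
proof (induction xs)
  case (Cons x xs)
  then have "distinct (concat (map h xs))" by simp
  moreover have "set (h x) \<inter> set (h y) = {}" if "y \<in> set xs" for y
    using Cons.prems that by auto
  ultimately show ?case using Cons.prems by auto
qed simp

lemma mk_pperm_plus:
  assumes "finite d" "w permutes d" "finite e" "u permutes e"
  shows "mk_pperm d w + mk_pperm e u = mk_pperm (d \<union> e) (w \<circ> u)"
proof -
  have "w \<circ> u permutes d \<union> e"
    using assms by (auto intro!: permutes_compose intro: permutes_subset)
  then have "pperm_pair (mk_pperm d w + mk_pperm e u) = pperm_pair (mk_pperm (d \<union> e) (w \<circ> u))"
    using assms by (simp add: plus_pperm.rep_eq mk_pperm_def Abs_pperm_inverse)
  then show ?thesis by (simp add: pperm_pair_inject)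
qed

text \<open>A point of one cycle is left alone by all the others, so the product can be compared
  with w cycle by cycle; off the support both are the identity.\<close>

lemma sum_list_pcycle:
  assumes "distinct (concat cs)" and "w permutes set (concat cs)"
    and "\<And>c x. c \<in> set cs \<Longrightarrow> x \<in> set c \<Longrightarrow> cycle_of_list c x = w x"
  shows "sum_list (map pcycle cs) = mk_pperm (set (concat cs)) w"
proof -
  define prod where "prod cs = foldr (\<lambda>c v. cycle_of_list c \<circ> v) cs id" for cs :: "nat list list"
  have prod_Nil: "prod [] = id" and prod_Cons: "prod (c # cs) = cycle_of_list c \<circ> prod cs" for c cs
    by (simp_all add: prod_def fun_eq_iff)
  have perm: "prod cs permutes set (concat cs)" for cs :: "nat list list"
  proof (induction cs)
    case Nil
    then show ?case by (simp add: prod_Nil permutes_def)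
  next
    case (Cons c cs)
    have "cycle_of_list c permutes set (concat (c # cs))"
      by (rule permutes_subset[OF cycle_permutes]) auto
    moreover have "prod cs permutes set (concat (c # cs))"
      by (rule permutes_subset[OF Cons]) auto
    ultimately have "cycle_of_list c \<circ> prod cs permutes set (concat (c # cs))"
      by (rule permutes_compose[rotated])
    then show ?case by (simp only: prod_Cons)
  qed
  have "sum_list (map pcycle cs) = mk_pperm (set (concat cs)) (prod cs)" for cs :: "nat list list"
  proof (induction cs)
    case Nil
    then show ?case by (simp add: prod_Nil mk_pperm_def zero_pperm_def id_def)
  next
    case (Cons c cs)
    then have "sum_list (map pcycle (c # cs)) =
        mk_pperm (set c) (cycle_of_list c) + mk_pperm (set (concat cs)) (prod cs)"
      by (simp only: list.map sum_list.Cons pcycle_def[of c])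
    also have "\<dots> = mk_pperm (set c \<union> set (concat cs)) (cycle_of_list c \<circ> prod cs)"
      by (rule mk_pperm_plus[OF _ cycle_permutes _ perm]) simp_all
    finally show ?case by (simp only: prod_Cons concat.simps set_append)
  qed
  moreover have "prod cs x = w x" if "x \<in> set (concat cs)" for x
    using assms(1,3) that
  proof (induction cs)
    case Nil
    then show ?case by simp
  next
    case (Cons c cs)
    show ?case
    proof (cases "x \<in> set (concat cs)")
      case True
      then have eq: "prod cs x = w x" using Cons by (intro Cons.IH) auto
      have "prod cs x \<in> set (concat cs)" using True perm permutes_in_image by metis
      then have "prod cs x \<notin> set c" using Cons.prems(1) by auto
      then show ?thesis using eq by (simp add: prod_Cons id_outside_supp)
    next
      case False
      then have "prod cs x = x" using perm by (meson permutes_not_in)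
      moreover have "cycle_of_list c x = w x" using Cons.prems False by auto
      ultimately show ?thesis by (simp only: prod_Cons o_apply)
    qed
  qed
  moreover have "prod cs x = w x" if "x \<notin> set (concat cs)" for x
    using that perm[of cs] assms(2) by (metis permutes_not_in)
  ultimately show ?thesis by (metis ext)
qed

section \<open>The kernel of a walk and the cycles of the first return map\<close>

definition walk_kernel :: "nat \<Rightarrow> nat list \<Rightarrow> nat set set"
  where "walk_kernel s as =
    (\<lambda>x. {y \<in> {1..length as}. walk s as (y - 1) = walk s as (x - 1)}) ` {1..length as}"

lemma partition_on_walk_kernel: "partition_on {1..length as} (walk_kernel s as)"
  unfolding walk_kernel_def by (rule partition_onI) (auto simp: disjnt_iff)

context interval_partition
begin

lemma walk_kernel_eq_iff:
  assumes "length as = n"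
  shows "walk_kernel s as = P \<longleftrightarrow>
    (\<forall>x\<in>{1..n}. \<forall>y\<in>{1..n}. walk s as (x - 1) = walk s as (y - 1) \<longleftrightarrow> blk x = blk y)"
    (is "_ \<longleftrightarrow> ?R")
proof
  assume eq: "walk_kernel s as = P"
  have "blk x = {y \<in> {1..n}. walk s as (y - 1) = walk s as (x - 1)}" if "x \<in> {1..n}" for x
    by (rule blk_eq) (use that in \<open>auto simp: eq[symmetric] walk_kernel_def assms\<close>)
  then show ?R by (auto simp del: atLeastAtMost_iff)
next
  assume R: ?R
  have *: "{y \<in> {1..n}. walk s as (y - 1) = walk s as (x - 1)} = blk x" if "x \<in> {1..n}" for x
    using R mem_blk_iff[OF that] mem_blk[OF that] that by blast
  have "walk_kernel s as = blk ` {1..n}"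
    unfolding walk_kernel_def assms using * by (rule image_cong[OF refl])
  also have "\<dots> = P"
    using blk(1) blk_MinB by (auto simp del: atLeastAtMost_iff)
  finally show "walk_kernel s as = P" .
qed

text \<open>\<open>step\<close> carries no meaning outside \<open>{1..n}\<close>. Extended by the
  identity it becomes a permutation of all naturals, to which the theory of orbits and
  \<open>support\<close> applies.\<close>

definition rstep :: "nat \<Rightarrow> nat"
  where "rstep = perm_restrict step {1..n}"

lemma rstep_eq: "x \<in> {1..n} \<Longrightarrow> rstep x = step x"
  by (simp only: rstep_def perm_restrict_simps)

lemma rstep_permutes: "rstep permutes {1..n}"
proof (rule bij_imp_permutes)
  have "step ` {1..n} = {1..n}"
    by (rule endo_inj_surj) (use step_in inj_on_step in auto)
  then have "bij_betw step {1..n} {1..n}" using inj_on_step by (simp add: bij_betw_def)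
  then show "bij_betw rstep {1..n} {1..n}" by (rule bij_betw_cong[THEN iffD1, rotated]) (simp add: rstep_eq)
qed (auto simp: rstep_def perm_restrict_def)

lemma permutation_rstep: "permutation rstep"
  using rstep_permutes permutation_permutes by blast

lemma orbit_step_eq: "x \<in> {1..n} \<Longrightarrow> orbit step x = orbit rstep x"
  by (rule orbit_cong0[of x "{1..n}"]) (use step_in rstep_eq in auto)

lemma orbit_subset: "x \<in> {1..n} \<Longrightarrow> orbit step x \<subseteq> {1..n}"
  using permutes_orbit_subset[OF rstep_permutes] orbit_step_eq by blast

lemma finite_orbit_step: "x \<in> {1..n} \<Longrightarrow> finite (orbit step x)"
  using orbit_subset finite_subset by blast

lemma self_in_orbit: "x \<in> {1..n} \<Longrightarrow> x \<in> orbit step x"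
  using permutation_self_in_orbit[OF permutation_rstep] orbit_step_eq by blast

lemma orbit_eq: "x \<in> {1..n} \<Longrightarrow> y \<in> orbit step x \<Longrightarrow> orbit step y = orbit step x"
  using orbit_cyclic_eq3[OF cyclic_on_orbit'[OF permutation_rstep]] orbit_step_eq orbit_subset
  by (metis subsetD)

lemma step_image_orbit:
  assumes "x \<in> {1..n}"
  shows "step ` orbit step x = orbit step x"
  by (rule endo_inj_surj)
    (use assms finite_orbit_step orbit_subset inj_on_step in \<open>auto intro: orbit.step inj_on_subset\<close>)

lemma ascent_defect_orbit: "x \<in> {1..n} \<Longrightarrow> ascent_defect step (orbit step x) = card (orbit step x \<inter> mins)"
  by (rule ascent_defect_step) (use orbit_subset step_image_orbit in auto)

text \<open>An orbit without elements of \<open>mins\<close> has no descent, so \<open>step\<close>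
  cannot decrease its maximum, which is therefore fixed. With \<open>no_fixed_point\<close> this
  links the entries 0 of \<open>cycle_type\<close> to fixed points of \<open>step\<close>.\<close>

lemma ex_fixed_point:
  assumes "x \<in> {1..n}" and "orbit step x \<inter> mins = {}"
  shows "\<exists>y\<in>{1..n}. step y = y"
proof -
  let ?O = "orbit step x"
  have fin: "finite ?O" and ne: "?O \<noteq> {}" using assms finite_orbit_step self_in_orbit by auto
  have "card ?O - card {y \<in> ?O. y \<le> step y} = 0"
    using ascent_defect_orbit[OF assms(1)] assms(2) by (simp add: ascent_defect_def)
  then have "{y \<in> ?O. y \<le> step y} = ?O"
    using fin by (intro card_seteq) auto
  then have "Max ?O \<le> step (Max ?O)" using Max_in[OF fin ne] by blast
  moreover have "step (Max ?O) \<in> ?O" using Max_in[OF fin ne] by (rule orbit.step)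
  then have "step (Max ?O) \<le> Max ?O" using fin by simp
  ultimately show ?thesis using Max_in[OF fin ne] orbit_subset[OF assms(1)] by force
qed

lemma no_fixed_point:
  assumes "x \<in> {1..n}" and "orbit step x \<inter> mins \<noteq> {}"
  shows "step x \<noteq> x"
proof
  assume "step x = x"
  then have O: "orbit step x = {x}" by (simp add: orbit_eq_singleton_iff)
  have "{y \<in> {x}. y \<le> step y} = {x}" using \<open>step x = x\<close> by auto
  then have "ascent_defect step (orbit step x) = 0"
    using \<open>step x = x\<close> by (simp add: O ascent_defect_def)
  then show False using ascent_defect_orbit[OF assms(1)] assms(2) O by auto
qed

text \<open>The same enumeration of the orbits as in \<open>cycle_type\<close>, so that lengths can
  be compared entry by entry.\<close>

definition reps :: "nat list"
  where "reps = filter (\<lambda>x. x = Min (orbit step x)) [1..<n + 1]"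

text \<open>An orbit is listed from an element of \<open>mins\<close>, if it has one, so that its
  first entry survives the filter in \<open>min_cycles\<close>.\<close>

definition start :: "nat \<Rightarrow> nat"
  where "start x = (SOME y. y \<in> orbit step x \<and> (orbit step x \<inter> mins \<noteq> {} \<longrightarrow> y \<in> mins))"

text \<open>The cycles of the first return map of \<open>step\<close> to \<open>mins\<close>, one
  list (possibly empty) for each entry of \<open>cycle_type\<close>.\<close>

definition min_cycles :: "nat list list"
  where "min_cycles = map (\<lambda>x. filter (\<lambda>y. y \<in> mins) (support rstep (start x))) reps"

lemma reps_in: "x \<in> set reps \<Longrightarrow> x \<in> {1..n}"
  by (auto simp: reps_def)

lemma ex_rep:
  assumes "x \<in> {1..n}"
  shows "\<exists>r\<in>set reps. orbit step r = orbit step x"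
proof -
  let ?r = "Min (orbit step x)"
  have r: "?r \<in> orbit step x" using finite_orbit_step[OF assms] self_in_orbit[OF assms] by (intro Min_in) auto
  then have "orbit step ?r = orbit step x" using orbit_eq[OF assms] by blast
  moreover from this have "?r \<in> set reps" using r orbit_subset[OF assms] by (auto simp: reps_def)
  ultimately show ?thesis by blast
qed

lemma reps_disjoint:
  assumes "x \<in> set reps" "y \<in> set reps" "x \<noteq> y"
  shows "orbit step x \<inter> orbit step y = {}"
proof (rule ccontr)
  assume "orbit step x \<inter> orbit step y \<noteq> {}"
  then obtain z where "z \<in> orbit step x" "z \<in> orbit step y" by blast
  then have "orbit step x = orbit step y" using orbit_eq reps_in assms by metis
  moreover have "Min (orbit step x) = x" "Min (orbit step y) = y"
    using assms(1,2) by (simp_all only: reps_def set_filter mem_Collect_eq)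
  ultimately show False using assms(3) by metis
qed

lemma start:
  assumes "x \<in> {1..n}"
  shows "start x \<in> orbit step x" and "orbit step x \<inter> mins \<noteq> {} \<Longrightarrow> start x \<in> mins"
proof -
  have "\<exists>y. y \<in> orbit step x \<and> (orbit step x \<inter> mins \<noteq> {} \<longrightarrow> y \<in> mins)"
    using self_in_orbit[OF assms] by blast
  from someI_ex[OF this]
  show "start x \<in> orbit step x" and "orbit step x \<inter> mins \<noteq> {} \<Longrightarrow> start x \<in> mins"
    unfolding start_def by auto
qed

lemma set_support_start:
  assumes "x \<in> {1..n}"
  shows "set (support rstep (start x)) = orbit step x"
proof -
  have "start x \<in> {1..n}" using start(1)[OF assms] orbit_subset[OF assms] by blast
  then have "orbit rstep (start x) = orbit step x"
    using orbit_step_eq orbit_eq[OF assms start(1)[OF assms]] by simp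
  then show ?thesis
    by (simp only: support_set[OF permutation_rstep] flip: orbit_altdef_permutation[OF permutation_rstep])
      (auto simp: orbit_altdef_permutation[OF permutation_rstep])
qed

lemma cycle_type_eq: "cycle_type n P = map (\<lambda>x. ascent_defect step (orbit step x)) reps"
  by (simp add: cycle_type_def reps_def Let_def flip: step_def)

lemma map_length_min_cycles: "map length min_cycles = cycle_type n P"
proof -
  have "length (filter (\<lambda>y. y \<in> mins) (support rstep (start x))) = ascent_defect step (orbit step x)"
    if "x \<in> set reps" for x
  proof -
    have x: "x \<in> {1..n}" using reps_in that by blast
    let ?l = "filter (\<lambda>y. y \<in> mins) (support rstep (start x))"
    have "length ?l = card (set ?l)"
      using cycle_of_permutation[OF permutation_rstep] by (intro distinct_card[symmetric] distinct_filter)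
    also have "set ?l = orbit step x \<inter> mins"
      using set_support_start[OF x] by (simp only: set_filter) auto
    finally show ?thesis using ascent_defect_orbit[OF x] by simp
  qed
  then show ?thesis
    by (simp add: min_cycles_def cycle_type_eq)
qed

lemma distinct_min_cycles: "distinct (concat min_cycles)"
  unfolding min_cycles_def
proof (rule distinct_concat_map)
  show "distinct reps" by (simp add: reps_def)
  show "distinct (filter (\<lambda>y. y \<in> mins) (support rstep (start x)))" for x
    using cycle_of_permutation[OF permutation_rstep] by (intro distinct_filter)
  show "set (filter (\<lambda>y. y \<in> mins) (support rstep (start x))) \<inter>
      set (filter (\<lambda>y. y \<in> mins) (support rstep (start y))) = {}"
    if "x \<in> set reps" "y \<in> set reps" "x \<noteq> y" for x y
    using reps_disjoint[OF that] set_support_start reps_in that by (simp only: set_filter) blast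
qed

lemma set_min_cycles: "set (concat min_cycles) = mins"
proof -
  have "set (concat min_cycles) = (\<Union>x\<in>set reps. {y \<in> set (support rstep (start x)). y \<in> mins})"
    by (simp add: min_cycles_def)
  also have "\<dots> = (\<Union>x\<in>set reps. {y \<in> orbit step x. y \<in> mins})"
    using set_support_start[OF reps_in] by (intro SUP_cong refl) (simp only:)
  also have "\<dots> = mins"
    using ex_rep self_in_orbit mins_subset by blast
  finally show ?thesis .
qed

end

section \<open>Walks that move in every step\<close>

context interval_partition
begin

text \<open>\<open>shift\<close> takes x + 1 back to x, whose successor in the block is x + 1 again.
  A walk that pauses thus yields a fixed point.\<close>

lemma step_fixed_if_adjacent: "x \<in> {1..<n} \<Longrightarrow> blk (Suc x) = blk x \<Longrightarrow> step (Suc x) = Suc x"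
proof -
  assume x: "x \<in> {1..<n}" and eq: "blk (Suc x) = blk x"
  then have "Suc x \<in> {2..n}" "Suc x \<in> {1..n}" by auto
  from blk(2)[OF this(2)] eq have mem: "Suc x \<in> blk (Suc x - 1)" by simp
  show "step (Suc x) = Suc x"
    by (rule step_cases[OF \<open>Suc x \<in> {2..n}\<close>]) (use mem in \<open>auto dest: antisym\<close>)
qed

lemma step_fixed_if_wrap: "blk n = blk 1 \<Longrightarrow> step 1 = 1"
  using step_1 Min_1 by simp

end

context kernel_word
begin

lemma step_neq:
  assumes "x \<in> {1..n}"
  shows "step x \<noteq> x"
proof
  assume fx: "step x = x"
  show False
  proof (cases "x = 1")
    case True
    have "n \<in> {1..n}" using n_pos by simp
    from blk_Min[OF this] show False using fx True step_1 blk_n_neq by metis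
  next
    case False
    then have x: "x \<in> {2..n}" "x - 1 \<in> {1..n}" "x - 1 \<in> {1..<n}" "Suc (x - 1) = x"
      using assms by auto
    have "x \<in> blk (x - 1)" using step_cases[OF x(1)] fx by metis
    then show False using mem_blk[OF x(2)] blk_Suc_neq[OF x(3)] x(4) by metis
  qed
qed

lemma orbit_meets_mins: "x \<in> {1..n} \<Longrightarrow> orbit step x \<inter> mins \<noteq> {}"
  using ex_fixed_point step_neq by blast

lemma inj_on_p_mins: "inj_on p mins"
proof (rule inj_onI)
  fix x y assume "x \<in> mins" "y \<in> mins" "p x = p y"
  moreover from this have "x \<in> {1..n}" "y \<in> {1..n}" using mins_subset by auto
  ultimately have "blk x = blk y" using ker by blast
  then show "x = y" using \<open>x \<in> mins\<close> \<open>y \<in> mins\<close> by (metis mem_mins_iff)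
qed

lemma p_Min: "x \<in> {1..n} \<Longrightarrow> p x = p (Min (blk x))"
  using ker blk_Min by blast

text \<open>By \<open>visited_walk\<close> the letters are the visited places other than s, and each
  of them has exactly one first visit, at the minimum of its block.\<close>

lemma p_image_mins: "p ` mins = set as"
proof -
  have "s \<notin> p ` mins"
  proof
    assume "s \<in> p ` mins"
    then obtain x where x: "x \<in> mins" "p x = s" by auto
    then have "blk x = blk 1" using ker[of x 1] n_pos mins_subset by auto
    then show False using x Min_1 by (auto simp: mem_mins_iff)
  qed
  moreover have "insert s (set as) = insert s (p ` mins)"
  proof -
    have "insert s (set as) = (\<lambda>i. p (Suc i)) ` {..n}"
      unfolding visited_walk len by (simp add: p)
    also have "\<dots> = insert s (p ` mins)"
    proof (intro equalityI subsetI)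
      fix y assume "y \<in> (\<lambda>i. p (Suc i)) ` {..n}"
      then obtain i where i: "i \<le> n" "y = p (Suc i)" by auto
      show "y \<in> insert s (p ` mins)"
      proof (cases "Suc i \<in> {1..n} \<and> Min (blk (Suc i)) \<noteq> 1")
        case True
        then have x: "Suc i \<in> {1..n}" by blast
        have "Min (blk (Suc i)) \<in> mins" using blk_Min[OF x] True by (auto simp: mem_mins_iff)
        then show ?thesis using p_Min[OF x] i(2) by blast
      next
        case False
        show ?thesis
        proof (cases "i = n")
          case neq: False
          then have x: "Suc i \<in> {1..n}" using i by auto
          then show ?thesis using p_Min[OF x] i False by simp
        qed (use i in simp)
      qed
    next
      fix y assume "y \<in> insert s (p ` mins)"
      then have "y \<in> p ` insert 1 mins" by simp
      then obtain x where "x \<in> insert 1 mins" "y = p x" by blast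
      then have "y = p (Suc (x - 1))" "x - 1 \<le> n" by (auto simp: mem_mins_iff)
      then show "y \<in> (\<lambda>i. p (Suc i)) ` {..n}" by blast
    qed
    finally show ?thesis .
  qed
  ultimately show ?thesis using star by (metis insert_ident)
qed

lemma cycle_of_list_min_cycle:
  assumes "l \<in> set min_cycles" and "x \<in> set l"
  shows "cycle_of_list (map p l) (p x) = star_word s as (p x)"
proof -
  obtain r where r: "r \<in> set reps" and l: "l = filter (\<lambda>y. y \<in> mins) (support rstep (start r))"
    using assms(1) by (auto simp: min_cycles_def)
  have r_in: "r \<in> {1..n}" by (rule reps_in[OF r])
  define c where "c = start r"
  have c: "c \<in> mins" unfolding c_def by (rule start(2)[OF r_in orbit_meets_mins[OF r_in]])
  then have c_in: "c \<in> {1..n}" using mins_subset by blast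
  define k where "k = least_power rstep c"
  define h where "h = (\<lambda>i. (rstep ^^ i) c)"
  have k: "0 < k" and h: "h 0 = c" "h k = c"
    using least_power_of_permutation[OF permutation_rstep, of c] by (simp_all add: k_def h_def)
  have h_in: "h i \<in> {1..n}" for i
    by (induction i) (use c_in permutes_in_image[OF rstep_permutes] in \<open>auto simp: h_def\<close>)
  have h_Suc: "h (Suc i) = step (h i)" for i
    using rstep_eq[OF h_in[of i]] by (simp add: h_def)
  have supp: "support rstep c = c # map h [1..<k]"
    using k h(1) by (simp add: k_def[symmetric] h_def[symmetric] upt_conv_Cons)
  let ?cs = "filter (\<lambda>y. y \<in> mins) (map h [1..<k])"
  have l_eq: "l = c # ?cs" using c unfolding l supp c_def[symmetric] by simp
  \<comment> \<open>One full turn of the orbit, with c at both ends: \<open>final_step\<close> links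
    consecutive entries, and filtering leaves the link between consecutive minima.\<close>
  have "successively (\<lambda>x y. final x = (if y \<in> mins then p y else final y)) (map h [0..<Suc k])"
    using final_step[OF h_in] by (simp add: successively_conv_nth h_Suc del: upt_Suc)
  moreover have "map h [0..<Suc k] = c # (map h [1..<k] @ [c])"
    using k h by (simp add: upt_conv_Cons)
  ultimately have "successively (\<lambda>x y. final x = p y) (c # filter (\<lambda>y. y \<in> mins) (map h [1..<k] @ [c]))"
    by (intro successively_filter) simp
  then have succ: "successively (\<lambda>x y. final x = p y) (c # ?cs @ [c])"
    using c by simp
  have "distinct l"
    unfolding l by (rule distinct_filter[OF cycle_of_permutation[OF permutation_rstep]])
  moreover have "set l \<subseteq> mins" unfolding l by auto
  ultimately have "distinct (map p (c # ?cs))"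
    unfolding l_eq[symmetric] using inj_on_p_mins by (auto simp: distinct_map intro: inj_on_subset)
  then have "cycle_of_list (map p l) (p x) = final x"
    unfolding l_eq by (rule cycle_of_list_successively[OF succ]) (use assms(2) l_eq in simp)
  then show ?thesis using final_mins \<open>set l \<subseteq> mins\<close> assms(2) by auto
qed

lemma concat_cycles:
  shows "distinct (concat (map (map p) min_cycles))" and "set (concat (map (map p) min_cycles)) = set as"
proof -
  have eq: "concat (map (map p) min_cycles) = map p (concat min_cycles)" by (simp only: map_concat)
  show "distinct (concat (map (map p) min_cycles))"
    unfolding eq distinct_map set_min_cycles using distinct_min_cycles inj_on_p_mins by blast
  show "set (concat (map (map p) min_cycles)) = set as"
    unfolding eq set_map set_min_cycles p_image_mins ..
qed

lemma sum_list_pcycle_min_cycles: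
  "sum_list (map pcycle (map (map p) min_cycles)) = mk_pperm (set as) (star_word s as)"
proof -
  have "star_word s as permutes set as" by (rule star_word_permutes'[OF closed star])
  moreover have "cycle_of_list c x = star_word s as x"
    if "c \<in> set (map (map p) min_cycles)" "x \<in> set c" for c x
    using that cycle_of_list_min_cycle by auto
  ultimately show ?thesis
    using sum_list_pcycle[of "map (map p) min_cycles" "star_word s as"] by (simp only: concat_cycles)
qed

end

section \<open>Class indicators as sums of words with a given kernel\<close>

lemma ex_map_concat:
  assumes "map length xss = map length yss" and "distinct (concat xss)"
  shows "\<exists>g. map (map g) xss = yss"
proof -
  have len: "length (concat xss) = length (concat yss)" using assms(1) by (simp add: length_concat)
  obtain g where g: "map g (concat xss) = concat yss"
  proof
    let ?g = "\<lambda>x. the (map_of (zip (concat xss) (concat yss)) x)"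
    show "map ?g (concat xss) = concat yss"
      by (rule nth_equalityI) (use len assms(2) in \<open>auto simp: map_of_zip_nth\<close>)
  qed
  have "map (map g) xss = yss"
  proof (rule concat_injective)
    show "concat (map (map g) xss) = concat yss" using g by (simp only: map_concat)
    show "length (map (map g) xss) = length yss" using assms(1) by (metis length_map)
    show "\<forall>(x, y)\<in>set (zip (map (map g) xss) yss). length x = length y"
      using assms(1) by (auto simp: set_zip list_eq_iff_nth_eq)
  qed
  then show ?thesis by blast
qed

definition closed_words :: "nat \<Rightarrow> nat set \<Rightarrow> nat \<Rightarrow> nat list set"
  where "closed_words s A n = {as. length as = n \<and> star_word s as s = s \<and> set as \<subseteq> A}"

definition word_elem :: "nat \<Rightarrow> nat list \<Rightarrow> palg"
  where "word_elem s as = Poly_Mapping.single (mk_pperm (set as) (star_word s as)) 1"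

context interval_partition
begin

lemma kernel_wordI:
  assumes "as \<in> closed_words s A n" and "walk_kernel s as = P" and "s \<notin> A"
  shows "kernel_word n P s as (\<lambda>x. walk s as (x - 1))"
proof -
  have "length as = n" using assms(1) by (simp add: closed_words_def)
  then have "\<forall>x\<in>{1..n}. \<forall>y\<in>{1..n}. walk s as (x - 1) = walk s as (y - 1) \<longleftrightarrow> blk x = blk y"
    using walk_kernel_eq_iff assms(2) by blast
  then show ?thesis
    using assms by unfold_locales (auto simp: closed_words_def)
qed

text \<open>A word with kernel P is determined by its places at the times in \<open>mins\<close>,
  and these can be any distinct elements of A. Arranged along \<open>min_cycles\<close> they form an
  injective family of shape \<open>cycle_type n P\<close>, whose product of cycles is the word. If
  an entry is 0, both sides vanish, as every orbit of \<open>step\<close> meets \<open>mins\<close>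
  when P is the kernel of a word without the letter s.\<close>

theorem class_ind_on_cycle_type:
  assumes "s \<notin> A"
  shows "class_ind_on A (cycle_type n P) =
    (\<Sum>as | as \<in> closed_words s A n \<and> walk_kernel s as = P. word_elem s as)"
proof (cases "0 \<in> set (cycle_type n P)")
  case True
  then obtain r where r: "r \<in> set reps" and z: "ascent_defect step (orbit step r) = 0"
    by (auto simp: cycle_type_eq)
  have "orbit step r \<inter> mins = {}"
    using z ascent_defect_orbit[OF reps_in[OF r]] finite_orbit_step[OF reps_in[OF r]] by auto
  then have False if "as \<in> closed_words s A n" "walk_kernel s as = P" for as
    using kernel_word.orbit_meets_mins[OF kernel_wordI[OF that assms] reps_in[OF r]] by blast
  then have "{as. as \<in> closed_words s A n \<and> walk_kernel s as = P} = {}" by blast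
  then show ?thesis using True by (simp only: class_ind_on_def if_True sum.empty)
next
  case False
  have meets: "orbit step x \<inter> mins \<noteq> {}" if x: "x \<in> {1..n}" for x
  proof -
    obtain r where r: "r \<in> set reps" "orbit step r = orbit step x" using ex_rep[OF x] by blast
    have "ascent_defect step (orbit step r) \<in> set (cycle_type n P)"
      using r(1) by (auto simp: cycle_type_eq)
    then show ?thesis using False ascent_defect_orbit[OF x] r(2) by force
  qed
  let ?W = "{as. as \<in> closed_words s A n \<and> walk_kernel s as = P}"
  let ?F = "{cs. map length cs = cycle_type n P \<and> distinct (concat cs) \<and> set (concat cs) \<subseteq> A}"
  let ?p = "\<lambda>as x. walk s as (x - 1)"
  let ?h = "\<lambda>as. map (map (?p as)) min_cycles"
  have kw: "kernel_word n P s as (?p as)" if "as \<in> ?W" for as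
    using that kernel_wordI assms by blast
  have "bij_betw ?h ?W ?F"
  proof (rule bij_betw_imageI)
    show "inj_on ?h ?W"
    proof (rule inj_onI)
      fix as bs assume as: "as \<in> ?W" and bs: "bs \<in> ?W" and eq: "?h as = ?h bs"
      interpret a: kernel_word n P s as "?p as" by (rule kw[OF as])
      interpret b: kernel_word n P s bs "?p bs" by (rule kw[OF bs])
      have "map (?p as) (concat min_cycles) = map (?p bs) (concat min_cycles)"
        using eq by (simp only: map_concat)
      then have mins_eq: "?p as x = ?p bs x" if "x \<in> mins" for x
        using that set_min_cycles by (simp only: map_eq_conv)
      have "?p as x = ?p bs x" if x: "x \<in> {1..n}" for x
      proof -
        have "?p as (Min (blk x)) = ?p bs (Min (blk x))"
        proof (cases "Min (blk x) = 1")
          case False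
          then have "Min (blk x) \<in> mins" using blk_Min[OF x] by (auto simp: mem_mins_iff)
          then show ?thesis by (rule mins_eq)
        qed simp
        then show ?thesis using a.p_Min[OF x] b.p_Min[OF x] by simp
      qed
      then have "walk s as i = walk s bs i" if "i < n" for i
        using that by (force dest: spec[of _ "Suc i"])
      moreover have "walk s as n = walk s bs n"
        using a.closed b.closed a.len b.len walk_length by metis
      ultimately show "as = bs"
        using a.len b.len by (intro walk_inj) (auto simp: le_less)
    qed
    show "?h ` ?W = ?F"
    proof (intro equalityI subsetI)
      fix cs assume "cs \<in> ?h ` ?W"
      then obtain as where as: "as \<in> ?W" "cs = ?h as" by blast
      interpret a: kernel_word n P s as "?p as" by (rule kw[OF as(1)])
      have "map length (?h as) = cycle_type n P"
        using map_length_min_cycles by (simp add: comp_def)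
      moreover have "set as \<subseteq> A" using as(1) by (simp add: closed_words_def)
      ultimately show "cs \<in> ?F" using as(2) a.concat_cycles by blast
    next
      fix cs assume "cs \<in> ?F"
      then have cs: "map length cs = cycle_type n P" "distinct (concat cs)" "set (concat cs) \<subseteq> A"
        by blast+
      \<comment> \<open>The family prescribes g x as the place first visited at time x, for x in
        \<open>mins\<close>.\<close>
      obtain g where g: "map (map g) min_cycles = cs"
        using ex_map_concat[of min_cycles cs] cs(1) map_length_min_cycles distinct_min_cycles by auto
      have gc: "map g (concat min_cycles) = concat cs" using g by (simp only: map_concat)
      then have inj: "inj_on g mins" and gA: "g ` mins \<subseteq> A"
        using cs(2,3) set_min_cycles by (metis distinct_map, metis set_map)
      \<comment> \<open>The prescribed walk, indexed from 0. Index n stands for time n + 1, which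
        lies in no block, so the return to s is required separately.\<close>
      define q where "q i = (if i = n \<or> blk (Suc i) = blk 1 then s else g (Min (blk (Suc i))))" for i
      have "q 0 = s" by (simp add: q_def)
      then obtain as where len: "length as = n" and walk: "\<And>i. i \<le> n \<Longrightarrow> walk s as i = q i"
        using ex_walk by metis
      have min: "Min (blk x) \<in> mins" if "x \<in> {1..n}" "blk x \<noteq> blk 1" for x
      proof -
        have "Min (blk x) \<noteq> 1" using blk_Min[OF that(1)] that(2) by metis
        then show ?thesis using blk_Min[OF that(1)] by (auto simp: mem_mins_iff)
      qed
      have qA: "q i \<in> A" if "i < n" "blk (Suc i) \<noteq> blk 1" for i
        using that gA min[of "Suc i"] by (auto simp: q_def)
      have q_eq: "q i = q j \<longleftrightarrow> blk (Suc i) = blk (Suc j)" if ij: "i < n" "j < n" for i j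
      proof (cases "blk (Suc i) = blk 1 \<or> blk (Suc j) = blk 1")
        case True
        then show ?thesis using qA ij assms by (metis q_def less_irrefl)
      next
        case False
        then have "q i = q j \<longleftrightarrow> Min (blk (Suc i)) = Min (blk (Suc j))"
          using min[of "Suc i"] min[of "Suc j"] ij inj by (auto simp: q_def inj_on_eq_iff)
        also have "\<dots> \<longleftrightarrow> blk (Suc i) = blk (Suc j)"
          using blk_Min[of "Suc i"] blk_Min[of "Suc j"] ij by (metis Suc_le_eq atLeastAtMost_iff le0 One_nat_def Suc_le_mono)
        finally show ?thesis .
      qed
      have closed: "star_word s as s = s"
        using walk[of n] walk_length[of s as] len by (simp add: q_def)
      have ker: "walk_kernel s as = P"
        unfolding walk_kernel_eq_iff[OF len]
      proof (intro ballI)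
        fix x y assume "x \<in> {1..n}" "y \<in> {1..n}"
        then have "x - 1 < n" "y - 1 < n" "Suc (x - 1) = x" "Suc (y - 1) = y" by auto
        then show "walk s as (x - 1) = walk s as (y - 1) \<longleftrightarrow> blk x = blk y"
          using q_eq walk by (metis less_imp_le)
      qed
      \<comment> \<open>A letter s would be a pause of the walk and hence a fixed point of
        \<open>step\<close>; this is excluded because every orbit meets \<open>mins\<close>.\<close>
      have "s \<notin> set as"
      proof
        assume "s \<in> set as"
        then obtain i where i: "i < n" "as ! i = s" using len by (metis in_set_conv_nth)
        then have "q (Suc i) = q i" using walk_Suc_neq_iff[of i as s] walk[of i] walk[of "Suc i"] len by auto
        show False
        proof (cases "Suc i = n")
          case True
          then have "q i = s" using \<open>q (Suc i) = q i\<close> by (simp add: q_def)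
          then have "blk n = blk 1" using qA[OF i(1)] True assms by metis
          moreover have "1 \<in> {1..n}" using n_pos by simp
          ultimately show False using step_fixed_if_wrap no_fixed_point meets by metis
        next
          case False
          then have "Suc i \<in> {1..<n}" "Suc (Suc i) \<in> {1..n}" using i by auto
          moreover have "blk (Suc (Suc i)) = blk (Suc i)"
            using q_eq[of "Suc i" i] \<open>q (Suc i) = q i\<close> i False by simp
          ultimately show False using step_fixed_if_adjacent no_fixed_point meets by metis
        qed
      qed
      moreover have "insert s (set as) \<subseteq> insert s A"
      proof -
        have "q i \<in> insert s A" if "i \<le> n" for i
          using that qA[of i] by (cases "i < n \<and> blk (Suc i) \<noteq> blk 1") (auto simp: q_def)
        then show ?thesis unfolding visited_walk len using walk by auto
      qed
      ultimately have "set as \<subseteq> A" by blast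
      then have as: "as \<in> ?W" using len closed ker by (simp add: closed_words_def)
      have "?p as x = g x" if "x \<in> mins" for x
      proof -
        have x: "x \<in> {2..n}" "Min (blk x) = x" using that by (auto simp: mem_mins_iff)
        then have "blk x \<noteq> blk 1" using Min_1 by auto
        moreover have "x - 1 \<noteq> n" "x - 1 \<le> n" "Suc (x - 1) = x" using x by auto
        ultimately show ?thesis using walk[of "x - 1"] x(2) by (simp add: q_def)
      qed
      then have "?h as = map (map g) min_cycles"
        using set_min_cycles by (intro map_cong refl) auto
      then have "cs = ?h as" using g by simp
      then show "cs \<in> ?h ` ?W" using as by (rule image_eqI)
    qed
  qed
  then have "(\<Sum>as\<in>?W. Poly_Mapping.single (sum_list (map pcycle (?h as))) (1::complex)) =
      (\<Sum>cs\<in>?F. Poly_Mapping.single (sum_list (map pcycle cs)) 1)"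
    by (rule sum.reindex_bij_betw)
  moreover have "sum_list (map pcycle (?h as)) = mk_pperm (set as) (star_word s as)" if "as \<in> ?W" for as
    using kernel_word.sum_list_pcycle_min_cycles[OF kw[OF that]] .
  ultimately show ?thesis
    using False by (simp add: class_ind_on_def word_elem_def)
qed

end

subsection \<open>Partitions and saturated sets\<close>

lemma connected_by_block:
  assumes "partition_on A P" and "B \<in> P" and "x \<in> B"
  shows "connected_by P x y \<longleftrightarrow> y \<in> B"
  unfolding connected_by_def using assms disjointD[OF partition_onD2[OF assms(1)]] by blast

lemma connected_by_equiv:
  assumes "partition_on A P"
  shows "x \<in> A \<Longrightarrow> connected_by P x x" and "connected_by P x y \<Longrightarrow> connected_by P y x"
    and "connected_by P x y \<Longrightarrow> connected_by P y z \<Longrightarrow> connected_by P x z"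
    and "connected_by P x y \<Longrightarrow> x \<in> A \<and> y \<in> A"
proof -
  show "x \<in> A \<Longrightarrow> connected_by P x x"
    using partition_onD1[OF assms] by (auto simp: connected_by_def)
  show "connected_by P x y \<Longrightarrow> connected_by P y x"
    by (auto simp: connected_by_def)
  show "connected_by P x y \<Longrightarrow> x \<in> A \<and> y \<in> A"
    using partition_onD1[OF assms] by (auto simp: connected_by_def)
  show "connected_by P x y \<Longrightarrow> connected_by P y z \<Longrightarrow> connected_by P x z"
    using connected_by_block[OF assms] by (metis connected_by_def)
qed

lemma refines_iff_connected:
  assumes P: "partition_on A P" and Q: "partition_on A Q"
  shows "refines A P Q \<longleftrightarrow> (\<forall>x y. connected_by P x y \<longrightarrow> connected_by Q x y)"
proof
  show "\<forall>x y. connected_by P x y \<longrightarrow> connected_by Q x y" if "refines A P Q"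
    using that unfolding refines_def connected_by_def by blast
  assume *: "\<forall>x y. connected_by P x y \<longrightarrow> connected_by Q x y"
  show "refines A P Q"
    unfolding refines_def
  proof (intro conjI ballI P Q)
    fix B assume B: "B \<in> P"
    then obtain x where x: "x \<in> B" using partition_onD3[OF P] by (metis ex_in_conv)
    then have "x \<in> A" using B partition_onD1[OF P] by blast
    then obtain C where C: "C \<in> Q" "x \<in> C" using partition_onD1[OF Q] by blast
    have "B \<subseteq> C"
      using * connected_by_block[OF P B x] connected_by_block[OF Q C] by blast
    then show "\<exists>C\<in>Q. B \<subseteq> C" using C by blast
  qed
qed

lemma partition_eq_iff_connected:
  assumes "partition_on A P" and "partition_on A Q"
  shows "P = Q \<longleftrightarrow> (\<forall>x y. connected_by P x y \<longleftrightarrow> connected_by Q x y)"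
  using refines_asym refines_iff_connected[OF assms] refines_iff_connected[OF assms(2,1)] by metis

lemma noncrossingD:
  assumes "noncrossing P" and "A \<in> P" "B \<in> P" and "a < b" "b < c" "c < d"
    and "a \<in> A" "c \<in> A" "b \<in> B" "d \<in> B"
  shows "A = B"
  using assms unfolding noncrossing_def by blast

lemma noncrossing_iff_connected:
  assumes "partition_on A P"
  shows "noncrossing P \<longleftrightarrow> (\<forall>a b c d. a < b \<and> b < c \<and> c < d \<and> connected_by P a c \<and> connected_by P b d
    \<longrightarrow> connected_by P a b)"
proof
  assume nc: "noncrossing P"
  show "\<forall>a b c d. a < b \<and> b < c \<and> c < d \<and> connected_by P a c \<and> connected_by P b d
    \<longrightarrow> connected_by P a b"
  proof (intro allI impI, elim conjE)
    fix a b c d assume o: "a < b" "b < c" "c < d" and "connected_by P a c" "connected_by P b d"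
    then obtain B C where BC: "B \<in> P" "a \<in> B" "c \<in> B" "C \<in> P" "b \<in> C" "d \<in> C"
      by (auto simp: connected_by_def)
    then have "B = C" using noncrossingD[OF nc _ _ o] by blast
    then show "connected_by P a b" using BC by (auto simp: connected_by_def)
  qed
next
  assume *: "\<forall>a b c d. a < b \<and> b < c \<and> c < d \<and> connected_by P a c \<and> connected_by P b d
    \<longrightarrow> connected_by P a b"
  show "noncrossing P"
    unfolding noncrossing_def
  proof (intro ballI allI impI, elim conjE)
    fix B C a b c d
    assume BC: "B \<in> P" "C \<in> P" and "a < b" "b < c" "c < d" "a \<in> B" "c \<in> B" "b \<in> C" "d \<in> C"
    then have "connected_by P a c" "connected_by P b d" by (auto simp: connected_by_def)
    then have "connected_by P a b" using * \<open>a < b\<close> \<open>b < c\<close> \<open>c < d\<close> by blast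
    then have "b \<in> B" using connected_by_block[OF assms] BC \<open>a \<in> B\<close> by blast
    then show "B = C" using disjointD[OF partition_onD2[OF assms]] BC \<open>b \<in> C\<close> by blast
  qed
qed

text \<open>For I inside the ground set this says that I is a union of blocks.\<close>

definition saturated :: "'a set set \<Rightarrow> 'a set \<Rightarrow> bool"
  where "saturated P I \<longleftrightarrow> (\<forall>B\<in>P. B \<subseteq> I \<or> B \<inter> I = {})"

lemma saturated_Int: "saturated P I \<Longrightarrow> saturated P J \<Longrightarrow> saturated P (I \<inter> J)"
  unfolding saturated_def by blast

lemma saturated_sym_diff: "saturated P I \<Longrightarrow> saturated P J \<Longrightarrow> saturated P ((I - J) \<union> (J - I))"
  unfolding saturated_def by blast

lemma saturatedD: "saturated P I \<Longrightarrow> connected_by P x y \<Longrightarrow> x \<in> I \<longleftrightarrow> y \<in> I"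
  unfolding saturated_def connected_by_def by blast

lemma saturatedI: "(\<And>x y. connected_by P x y \<Longrightarrow> x \<in> I \<Longrightarrow> y \<in> I) \<Longrightarrow> saturated P I"
  unfolding saturated_def connected_by_def by blast

subsection \<open>The Kreweras complement and its inverse\<close>

text \<open>Primed points \<open>i'\<close>, \<open>j'\<close> can be joined iff the unprimed points between them form a union of
  blocks. In the inverse direction the primed points between \<open>x\<close> and \<open>y\<close> are \<open>x', \<dots>, (y - 1)'\<close>.\<close>

definition cut_rel :: "nat \<Rightarrow> (nat \<Rightarrow> nat \<Rightarrow> nat set) \<Rightarrow> nat set set \<Rightarrow> (nat \<times> nat) set"
  where "cut_rel n f P = {(i, j). i \<in> {1..n} \<and> j \<in> {1..n} \<and> saturated P (f (min i j) (max i j))}"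

definition compl :: "nat \<Rightarrow> nat set set \<Rightarrow> nat set set"
  where "compl n P = {1..n} // cut_rel n (\<lambda>i j. {i<..j}) P"

definition compl_inv :: "nat \<Rightarrow> nat set set \<Rightarrow> nat set set"
  where "compl_inv n P = {1..n} // cut_rel n (\<lambda>i j. {i..<j}) P"

text \<open>The stretch between i and k is the symmetric difference of those between i, j and
  between j, k. Saturated sets are closed under symmetric difference, which gives
  transitivity.\<close>

lemma equiv_cut_rel:
  assumes "\<And>i. f i i = {}"
    and "\<And>i j k. f (min i k) (max i k) = (f (min i j) (max i j) - f (min j k) (max j k)) \<union>
      (f (min j k) (max j k) - f (min i j) (max i j))"
  shows "equiv {1..n} (cut_rel n f P)"
proof (rule equivI)
  show "cut_rel n f P \<subseteq> {1..n} \<times> {1..n}" by (auto simp: cut_rel_def)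
  show "refl_on {1..n} (cut_rel n f P)"
    by (auto simp: refl_on_def cut_rel_def assms(1) saturated_def)
  show "sym (cut_rel n f P)"
    by (auto simp: sym_def cut_rel_def min.commute max.commute)
  show "trans (cut_rel n f P)"
  proof (rule transI)
    fix i j k assume ij: "(i, j) \<in> cut_rel n f P" and jk: "(j, k) \<in> cut_rel n f P"
    have "saturated P (f (min i k) (max i k))"
      unfolding assms(2)[of i k j] by (rule saturated_sym_diff) (use ij jk in \<open>auto simp: cut_rel_def\<close>)
    then show "(i, k) \<in> cut_rel n f P" using ij jk by (auto simp: cut_rel_def)
  qed
qed

lemma connected_by_quotient:
  assumes "equiv A r"
  shows "connected_by (A // r) x y \<longleftrightarrow> (x, y) \<in> r"
proof
  assume "connected_by (A // r) x y"
  then show "(x, y) \<in> r"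
    unfolding connected_by_def using assms in_quotient_imp_in_rel by fastforce
next
  assume xy: "(x, y) \<in> r"
  then have "x \<in> A" using equiv_class_eq_iff[OF assms] by blast
  then have "r `` {x} \<in> A // r" "x \<in> r `` {x}" "y \<in> r `` {x}"
    using quotientI equiv_class_self[OF assms] xy by auto
  then show "connected_by (A // r) x y" unfolding connected_by_def by blast
qed

lemma equiv_compl_rel: "equiv {1..n} (cut_rel n (\<lambda>i j. {i<..j}) P)"
  by (rule equiv_cut_rel) (auto simp: min_def max_def)

lemma equiv_compl_inv_rel: "equiv {1..n} (cut_rel n (\<lambda>i j. {i..<j}) P)"
  by (rule equiv_cut_rel) (auto simp: min_def max_def)

lemma partition_on_compl: "partition_on {1..n} (compl n P)"
  unfolding compl_def by (rule partition_on_quotient[OF equiv_compl_rel])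

lemma partition_on_compl_inv: "partition_on {1..n} (compl_inv n P)"
  unfolding compl_inv_def by (rule partition_on_quotient[OF equiv_compl_inv_rel])

lemma connected_by_compl:
  "connected_by (compl n P) i j \<longleftrightarrow> i \<in> {1..n} \<and> j \<in> {1..n} \<and> saturated P {min i j<..max i j}"
  unfolding compl_def connected_by_quotient[OF equiv_compl_rel] by (simp add: cut_rel_def)

lemma connected_by_compl_inv:
  "connected_by (compl_inv n P) i j \<longleftrightarrow> i \<in> {1..n} \<and> j \<in> {1..n} \<and> saturated P {min i j..<max i j}"
  unfolding compl_inv_def connected_by_quotient[OF equiv_compl_inv_rel] by (simp add: cut_rel_def)

text \<open>If \<open>{a<..c}\<close> and \<open>{b<..d}\<close> are saturated with a < b < c < d,
  so is their intersection \<open>{b<..c}\<close>; hence b is joined to c, and so to a.\<close>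

lemma compl_NC: "compl n P \<in> NC {1..n}"
proof -
  have "noncrossing (compl n P)"
    unfolding noncrossing_iff_connected[OF partition_on_compl]
  proof (intro allI impI, elim conjE)
    fix a b c d assume o: "a < b" "b < c" "c < d"
      and ac: "connected_by (compl n P) a c" and bd: "connected_by (compl n P) b d"
    have "saturated P {a<..c}" "saturated P {b<..d}"
      using ac bd o unfolding connected_by_compl by (simp_all add: min_def max_def)
    then have "saturated P ({a<..c} \<inter> {b<..d})" by (rule saturated_Int)
    moreover have "{a<..c} \<inter> {b<..d} = {min b c<..max b c}" using o by auto
    ultimately have "connected_by (compl n P) b c"
      using ac bd unfolding connected_by_compl by simp
    then show "connected_by (compl n P) a b"
      using ac connected_by_equiv[OF partition_on_compl] by metis
  qed
  then show ?thesis using partition_on_compl by (simp add: NC_def)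
qed

text \<open>A block of P with points both inside and outside \<open>{i<..j}\<close> would cross the
  block of i' and j' in the interleaved order, and by parity these two blocks are distinct.\<close>

lemma noncrossing_interleaveD:
  assumes "noncrossing (interleave P Q)" and "B \<in> Q" "i \<in> B" "j \<in> B" "i < j"
  shows "saturated P {i<..j}"
proof -
  have False if C: "C \<in> P" "x \<in> C" "x \<in> {i<..j}" "y \<in> C" "y \<notin> {i<..j}" for C x y
  proof -
    let ?C = "(\<lambda>i. 2 * i) ` C" and ?B = "(\<lambda>i. 2 * i + 1) ` B"
    have mem: "?C \<in> interleave P Q" "?B \<in> interleave P Q"
      using C assms(2) by (auto simp: interleave_def)
    have "?C = ?B"
    proof (cases "y \<le> i")
      case True
      then have "2 * y < 2 * i + 1" "2 * i + 1 < 2 * x" "2 * x < 2 * j + 1" using C by auto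
      then show ?thesis
        by (rule noncrossingD[OF assms(1) mem]) (use C assms(3,4) in auto)
    next
      case False
      then have "2 * i + 1 < 2 * x" "2 * x < 2 * j + 1" "2 * j + 1 < 2 * y" using C by auto
      then have "?B = ?C"
        by (rule noncrossingD[OF assms(1) mem(2,1)]) (use C assms(3,4) in auto)
      then show ?thesis ..
    qed
    moreover have "2 * x \<in> ?C" using C by auto
    moreover have "2 * x \<notin> ?B" by (auto, presburger)
    ultimately show False by simp
  qed
  then show ?thesis unfolding saturated_def by blast
qed

lemma noncrossing_interleave_compl:
  assumes "P \<in> NC {1..n}"
  shows "noncrossing (interleave P (compl n P))"
proof -
  let ?K = "compl n P"
  let ?e = "\<lambda>i::nat. 2 * i" and ?o = "\<lambda>i::nat. 2 * i + 1"
  have sat: "saturated P {i<..j}" if "B \<in> ?K" "i \<in> B" "j \<in> B" "i < j" for B i j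
  proof -
    have "connected_by ?K i j" using that unfolding connected_by_def by blast
    then show ?thesis using that unfolding connected_by_compl by (simp add: min_def max_def)
  qed
  show ?thesis
    unfolding noncrossing_def
  proof (intro ballI allI impI, elim conjE)
    fix A B a b c d
    assume A: "A \<in> interleave P ?K" and B: "B \<in> interleave P ?K"
      and o: "a < b" "b < c" "c < d" and m: "a \<in> A" "c \<in> A" "b \<in> B" "d \<in> B"
    have cases: "(\<exists>C'\<in>P. C = ?e ` C') \<or> (\<exists>C'\<in>?K. C = ?o ` C')" if "C \<in> interleave P ?K" for C
      using that by (auto simp: interleave_def)
    consider A' B' where "A' \<in> P" "B' \<in> P" "A = ?e ` A'" "B = ?e ` B'"
      | A' B' where "A' \<in> ?K" "B' \<in> ?K" "A = ?o ` A'" "B = ?o ` B'"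
      | A' B' where "A' \<in> P" "B' \<in> ?K" "A = ?e ` A'" "B = ?o ` B'"
      | A' B' where "A' \<in> ?K" "B' \<in> P" "A = ?o ` A'" "B = ?e ` B'"
      using cases[OF A] cases[OF B] by metis
    then show "A = B"
    proof cases
      case 1
      then obtain a' b' c' d' where *: "a = 2 * a'" "b = 2 * b'" "c = 2 * c'" "d = 2 * d'"
        "a' \<in> A'" "c' \<in> A'" "b' \<in> B'" "d' \<in> B'" using m by auto
      then have "a' < b'" "b' < c'" "c' < d'" using o by auto
      then have "A' = B'" using assms noncrossingD[OF _ 1(1,2)] * by (auto simp: NC_def)
      then show ?thesis using 1 by simp
    next
      case 2
      then obtain a' b' c' d' where *: "a = 2 * a' + 1" "b = 2 * b' + 1" "c = 2 * c' + 1" "d = 2 * d' + 1"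
        "a' \<in> A'" "c' \<in> A'" "b' \<in> B'" "d' \<in> B'" using m by auto
      then have "a' < b'" "b' < c'" "c' < d'" using o by auto
      then have "A' = B'" using compl_NC[of n P] noncrossingD[OF _ 2(1,2)] * by (auto simp: NC_def)
      then show ?thesis using 2 by simp
    next
      \<comment> \<open>In the mixed cases a crossing would give a block of P with one point inside
        and one point outside a saturated interval.\<close>
      case 3
      then obtain a' b' c' d' where *: "a = 2 * a'" "b = 2 * b' + 1" "c = 2 * c'" "d = 2 * d' + 1"
        "a' \<in> A'" "c' \<in> A'" "b' \<in> B'" "d' \<in> B'" using m by auto
      then have l: "a' \<le> b'" "b' < c'" "c' \<le> d'" using o by auto
      then have "saturated P {b'<..d'}" using sat 3 * by auto
      then have "a' \<in> {b'<..d'} \<longleftrightarrow> c' \<in> {b'<..d'}"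
        by (rule saturatedD) (use 3 * in \<open>auto simp: connected_by_def\<close>)
      then show ?thesis using l by auto
    next
      case 4
      then obtain a' b' c' d' where *: "a = 2 * a' + 1" "b = 2 * b'" "c = 2 * c' + 1" "d = 2 * d'"
        "a' \<in> A'" "c' \<in> A'" "b' \<in> B'" "d' \<in> B'" using m by auto
      then have l: "a' < b'" "b' \<le> c'" "c' < d'" using o by auto
      then have "saturated P {a'<..c'}" using sat 4 * by auto
      then have "b' \<in> {a'<..c'} \<longleftrightarrow> d' \<in> {a'<..c'}"
        by (rule saturatedD) (use 4 * in \<open>auto simp: connected_by_def\<close>)
      then show ?thesis using l by auto
    qed
  qed
qed

text \<open>By \<open>noncrossing_interleaveD\<close> every admissible partition joins only points
  that \<open>compl\<close> joins too, so \<open>compl\<close> is the largest one.\<close>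

lemma kreweras_eq_compl:
  assumes "P \<in> NC {1..n}"
  shows "kreweras n P = compl n P"
  unfolding kreweras_def
proof (rule the_equality)
  have ref: "refines {1..n} Q (compl n P)" if Q: "Q \<in> NC {1..n}" "noncrossing (interleave P Q)" for Q
  proof -
    have part: "partition_on {1..n} Q" using Q by (simp add: NC_def)
    have lt: "connected_by (compl n P) x y" if xy: "connected_by Q x y" "x < y" for x y
    proof -
      obtain B where "B \<in> Q" "x \<in> B" "y \<in> B" using xy by (auto simp: connected_by_def)
      then have "saturated P {x<..y}" using noncrossing_interleaveD[OF Q(2)] xy by blast
      then show ?thesis
        using connected_by_equiv(4)[OF part xy(1)] xy(2) unfolding connected_by_compl
        by (simp add: min_def max_def)
    qed
    show ?thesis
      unfolding refines_iff_connected[OF part partition_on_compl]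
    proof (intro allI impI)
      fix x y assume xy: "connected_by Q x y"
      show "connected_by (compl n P) x y"
      proof (cases x y rule: linorder_cases)
        case equal
        then show ?thesis
          using connected_by_equiv(4)[OF part xy] connected_by_equiv(1)[OF partition_on_compl] by blast
      next
        case greater
        then show ?thesis
          using lt connected_by_equiv(2)[OF part xy] connected_by_equiv(2)[OF partition_on_compl] by blast
      qed (use lt xy in blast)
    qed
  qed
  show "compl n P \<in> NC {1..n} \<and> noncrossing (interleave P (compl n P)) \<and>
      (\<forall>Q'\<in>NC {1..n}. noncrossing (interleave P Q') \<longrightarrow> refines {1..n} Q' (compl n P))"
    using compl_NC noncrossing_interleave_compl[OF assms] ref by blast
  then show "Q = compl n P" if "Q \<in> NC {1..n} \<and> noncrossing (interleave P Q) \<and>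
      (\<forall>Q'\<in>NC {1..n}. noncrossing (interleave P Q') \<longrightarrow> refines {1..n} Q' Q)" for Q
    using that by (intro refines_asym[of "{1..n}"]) auto
qed

text \<open>If x and y are connected, a primed point in \<open>{x..<y}\<close> joined to one outside
  would give a saturated interval containing exactly one of x and y. If they are not, let z be the
  last element before y in the block of x; then z' lies in \<open>{x..<y}\<close> and is joined to a
  primed point outside it.\<close>

lemma compl_inv_compl:
  assumes "P \<in> NC {1..n}"
  shows "compl_inv n (compl n P) = P"
proof -
  have part: "partition_on {1..n} P" and nc: "noncrossing P" using assms by (auto simp: NC_def)
  note equiv = connected_by_equiv[OF part]
  have eq: "connected_by P x y \<longleftrightarrow> saturated (compl n P) {x..<y}"
    if xy: "x \<in> {1..n}" "y \<in> {1..n}" "x < y" for x y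
  proof
    assume con: "connected_by P x y"
    have no: False if "connected_by (compl n P) i j" "i \<in> {x..<y}" "j \<notin> {x..<y}" for i j
    proof -
      have "saturated P {min i j<..max i j}" using that unfolding connected_by_compl by blast
      from saturatedD[OF this con] show False using that xy by (auto simp: min_def max_def split: if_splits)
    qed
    then show "saturated (compl n P) {x..<y}" by (intro saturatedI) blast
  next
    assume sat: "saturated (compl n P) {x..<y}"
    show "connected_by P x y"
    proof (rule ccontr)
      assume nxy: "\<not> connected_by P x y"
      obtain B where B: "B \<in> P" "x \<in> B" using xy partition_onD1[OF part] by blast
      have B_iff: "connected_by P z w \<longleftrightarrow> w \<in> B" if "z \<in> B" for z w
        by (rule connected_by_block[OF part B(1) that])
      have Bsub: "B \<subseteq> {1..n}" using B partition_onD1[OF part] by blast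
      then have fin: "finite B" by (rule finite_subset) simp
      have yB: "y \<notin> B" using nxy B_iff[OF B(2)] by blast
      \<comment> \<open>By noncrossing, a block with a point strictly between two points of B and
        another point beyond them is B itself.\<close>
      have cross: "v \<in> B" if "connected_by P u v" "a \<in> B" "b \<in> B" "a < u" "u < b" "v < a \<or> b < v" for u v a b
      proof -
        have *: "connected_by P a b" using B_iff that by blast
        from that(6) show ?thesis
        proof
          assume "v < a"
          then have "connected_by P v a"
            using nc[unfolded noncrossing_iff_connected[OF part], rule_format, of v a u b] that * equiv by blast
          then show ?thesis using B_iff[OF that(2)] equiv by blast
        next
          assume "b < v"
          then have "connected_by P a u"
            using nc[unfolded noncrossing_iff_connected[OF part], rule_format, of a u b v] that * by blast
          then show ?thesis using B_iff that(1,2) equiv by blast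
        qed
      qed
      define z where "z = Max {b \<in> B. b < y}"
      have zin: "z \<in> {b \<in> B. b < y}" unfolding z_def using fin B xy by (intro Max_in) auto
      then have z: "z \<in> B" "z < y" "z \<in> {1..n}" using Bsub by auto
      have zmax: "b \<le> z" if "b \<in> B" "b < y" for b
        unfolding z_def using fin that by (intro Max_ge) auto
      have xz: "x \<le> z" using zmax B xy by blast
      have contra: False if "saturated P {min i j<..max i j}" "i \<in> {1..n}" "j \<in> {1..n}"
        "i \<in> {x..<y}" "j \<notin> {x..<y}" for i j
      proof -
        have "connected_by (compl n P) i j" using that unfolding connected_by_compl by blast
        from saturatedD[OF sat this] that show False by blast
      qed
      show False
      proof (cases "\<exists>b\<in>B. y < b")
        case True
        \<comment> \<open>The gap of B around y, between z and w, is saturated, so z' is joined to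
          (w - 1)'.\<close>
        define w where "w = Min {b \<in> B. y < b}"
        have "w \<in> {b \<in> B. y < b}" unfolding w_def using fin True by (intro Min_in) auto
        then have w: "w \<in> B" "y < w" "w \<in> {1..n}" using Bsub by auto
        have wmin: "w \<le> b" if "b \<in> B" "y < b" for b
          unfolding w_def using fin that by (intro Min_le) auto
        have notB: "u \<notin> B" if "z < u" "u < w" for u
          using zmax[of u] wmin[of u] yB that by (cases u y rule: linorder_cases) auto
        have "saturated P {z<..w - 1}"
        proof (rule saturatedI)
          fix u v assume uv: "connected_by P u v" "u \<in> {z<..w - 1}"
          then have u: "z < u" "u < w" by auto
          have "v \<notin> B" using notB[OF u] uv(1) B_iff equiv by blast
          then have "z \<le> v \<and> v \<le> w" using cross[OF uv(1) z(1) w(1) u] by (meson leI)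
          moreover have "v \<noteq> z" "v \<noteq> w" using \<open>v \<notin> B\<close> z w by auto
          ultimately show "v \<in> {z<..w - 1}" by auto
        qed
        moreover have "min z (w - 1) = z" "max z (w - 1) = w - 1" "w - 1 \<in> {1..n}" "w - 1 \<notin> {x..<y}"
          using z w by auto
        ultimately show False using contra[of z "w - 1"] z xz by simp
      next
        case False
        then have zM: "b \<le> z" if "b \<in> B" for b
          using that zmax yB by (metis linorder_neqE_nat)
        define m where "m = Min B"
        have mB: "m \<in> B" unfolding m_def using fin B by (intro Min_in) auto
        have mmin: "m \<le> b" if "b \<in> B" for b unfolding m_def using fin that by (intro Min_le) auto
        \<comment> \<open>Here B ends at z before y. Its convex hull is saturated, so z' is joined
          to (m - 1)', or to n' through the complement of the hull if m = 1.\<close>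
        have hull: "saturated P {m..z}"
        proof (rule saturatedI)
          fix u v assume uv: "connected_by P u v" "u \<in> {m..z}"
          show "v \<in> {m..z}"
          proof (cases "u \<in> B")
            case True
            then show ?thesis using uv B_iff mmin zM by auto
          next
            case u: False
            then have "v \<notin> B" using uv B_iff equiv by blast
            moreover have "m < u" "u < z" using u uv(2) mB z(1) by (auto simp: le_less)
            ultimately have "m \<le> v \<and> v \<le> z" using cross[OF uv(1) mB z(1)] by (meson leI)
            then show ?thesis by simp
          qed
        qed
        show False
        proof (cases "m = 1")
          case True
          have "saturated P {z<..n}"
          proof (rule saturatedI)
            fix u v assume uv: "connected_by P u v" "u \<in> {z<..n}"
            have "v \<in> {1..n}" using equiv(4)[OF uv(1)] by blast
            moreover have "v \<notin> {m..z}" using saturatedD[OF hull uv(1)] uv(2) by auto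
            ultimately show "v \<in> {z<..n}" using True by auto
          qed
          moreover have "min z n = z" "max z n = n" using z by auto
          ultimately show False using contra[of z n] z xy xz by auto
        next
          case False
          have m1: "m \<in> {1..n}" using mB Bsub by blast
          then have "{m - 1<..z} = {m..z}" "m - 1 \<in> {1..n}" using False by auto
          moreover have "min z (m - 1) = m - 1" "max z (m - 1) = z"
            using mmin[OF z(1)] by auto
          moreover have "m - 1 \<notin> {x..<y}" using mmin[OF B(2)] m1 by auto
          ultimately show False using contra[of z "m - 1"] hull z xz by simp
        qed
      qed
    qed
  qed
  show ?thesis
    unfolding partition_eq_iff_connected[OF partition_on_compl_inv part]
  proof (intro allI)
    fix x y
    show "connected_by (compl_inv n (compl n P)) x y \<longleftrightarrow> connected_by P x y"
    proof (cases "x \<in> {1..n} \<and> y \<in> {1..n}")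
      case True
      then show ?thesis
        unfolding connected_by_compl_inv
        using eq[of x y] eq[of y x] equiv(1)[of x] equiv(2)[of x y] equiv(2)[of y x]
        by (cases x y rule: linorder_cases) (auto simp: saturated_def min_def max_def)
    next
      case False
      then show ?thesis unfolding connected_by_compl_inv using equiv(4) by blast
    qed
  qed
qed

text \<open>\<open>compl\<close> is an injective self-map of the finite set
  \<open>NC {1..n}\<close>, hence onto, so its left inverse \<open>compl_inv\<close> is
  two-sided.\<close>

lemma kreweras_compl_inv:
  assumes "R \<in> NC {1..n}"
  shows "compl_inv n R \<in> NC {1..n}" and "kreweras n (compl_inv n R) = R"
    and "P \<in> NC {1..n} \<Longrightarrow> kreweras n P = R \<Longrightarrow> P = compl_inv n R"
proof -
  have "finite (NC {1..n})"
    by (rule finite_subset[OF _ finitely_many_partition_on[of "{1..n}"]]) (auto simp: NC_def)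
  moreover have "inj_on (compl n) (NC {1..n})"
    by (rule inj_on_inverseI[of _ "compl_inv n"]) (rule compl_inv_compl)
  moreover have "compl n ` NC {1..n} \<subseteq> NC {1..n}" using compl_NC by blast
  ultimately have "compl n ` NC {1..n} = NC {1..n}" by (metis endo_inj_surj)
  then obtain P where "P \<in> NC {1..n}" "R = compl n P" using assms by blast
  then show "compl_inv n R \<in> NC {1..n}" and "kreweras n (compl_inv n R) = R"
    using compl_inv_compl kreweras_eq_compl by auto
  show "P \<in> NC {1..n} \<Longrightarrow> kreweras n P = R \<Longrightarrow> P = compl_inv n R" for P
    using compl_inv_compl kreweras_eq_compl by metis
qed

subsection \<open>The product formula\<close>

text \<open>Letters are indexed by a set of positions, so that a block can be removed without
  renumbering the others.\<close>

definition set_word :: "nat \<Rightarrow> (nat \<Rightarrow> nat) \<Rightarrow> nat set \<Rightarrow> nat \<Rightarrow> nat"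
  where "set_word s a I = star_word s (map a (sorted_list_of_set I))"

definition set_elem :: "nat \<Rightarrow> (nat \<Rightarrow> nat) \<Rightarrow> nat set \<Rightarrow> palg"
  where "set_elem s a I = Poly_Mapping.single (mk_pperm (a ` I) (set_word s a I)) 1"

text \<open>The refinement condition on the kernel, rephrased by
  \<open>closed_on_iff_refines\<close> in terms of subwords; in this form it survives the removal of
  a block.\<close>

definition closed_on :: "nat \<Rightarrow> nat set set \<Rightarrow> nat set \<Rightarrow> (nat \<Rightarrow> nat) \<Rightarrow> bool"
  where "closed_on s R X a \<longleftrightarrow>
    (\<forall>x y. saturated R (X \<inter> {x..<y}) \<longrightarrow> set_word s a (X \<inter> {x..<y}) s = s)"

lemma set_word_empty [simp]: "set_word s a {} = id"
  by (simp add: set_word_def)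

lemma bij_set_word: "bij (set_word s a I)"
  unfolding set_word_def by (rule bij_star_word)

lemma set_word_cong: "(\<And>x. x \<in> I \<Longrightarrow> a x = b x) \<Longrightarrow> set_word s a I = set_word s b I"
  unfolding set_word_def by (cases "finite I") (auto intro!: arg_cong[of _ _ "star_word s"])

lemma set_word_Un:
  assumes "finite I" "finite J" and "\<And>i j. i \<in> I \<Longrightarrow> j \<in> J \<Longrightarrow> i < j"
  shows "set_word s a (I \<union> J) = set_word s a I \<circ> set_word s a J"
proof -
  have "I \<inter> J = {}" using assms(3) by fastforce
  then have "sorted_list_of_set (I \<union> J) = sorted_list_of_set I @ sorted_list_of_set J"
    using assms by (intro sorted_distinct_set_unique) (auto simp: sorted_append less_imp_le)
  then show ?thesis by (simp add: set_word_def star_word_append)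
qed

lemma set_word_conj:
  assumes "bij w" "w s = s" and "\<And>x. x \<in> I \<Longrightarrow> b x = w (a x)"
  shows "set_word s b I = w \<circ> set_word s a I \<circ> inv w"
proof -
  have "set_word s b I = set_word s (w \<circ> a) I" by (rule set_word_cong) (simp add: assms(3))
  then show ?thesis
    using star_word_conj[OF assms(1,2), of "map a (sorted_list_of_set I)"] by (simp add: set_word_def)
qed

lemma set_word_permutes:
  assumes "finite I" and "set_word s a I s = s" and "s \<notin> a ` I"
  shows "set_word s a I permutes a ` I"
  using star_word_permutes'[of s "map a (sorted_list_of_set I)"] assms by (simp add: set_word_def)

lemma closed_on_total:
  assumes "finite X" "partition_on X R" and "closed_on s R X a"
  shows "set_word s a X s = s"
proof -
  have X: "X \<inter> {0..<Suc (Max X)} = X" using assms(1) by (auto simp: less_Suc_eq_le)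
  have "saturated R X" using partition_onD1[OF assms(2)] by (auto simp: saturated_def)
  then show ?thesis using assms(3) X unfolding closed_on_def by metis
qed

lemma bij_betw_map_PiE:
  assumes "distinct xs"
  shows "bij_betw (\<lambda>a. map a xs) (set xs \<rightarrow>\<^sub>E A) {as. length as = length xs \<and> set as \<subseteq> A}"
proof (rule bij_betw_imageI)
  show "inj_on (\<lambda>a. map a xs) (set xs \<rightarrow>\<^sub>E A)"
    by (intro inj_onI PiE_ext) auto
  show "(\<lambda>a. map a xs) ` (set xs \<rightarrow>\<^sub>E A) = {as. length as = length xs \<and> set as \<subseteq> A}"
  proof (intro equalityI subsetI)
    fix as assume as: "as \<in> {as. length as = length xs \<and> set as \<subseteq> A}"
    let ?a = "restrict (\<lambda>x. the (map_of (zip xs as) x)) (set xs)"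
    have eq: "map ?a xs = as"
      by (rule nth_equalityI) (use as assms in \<open>auto simp: map_of_zip_nth\<close>)
    then have "?a ` set xs = set as" by (metis set_map)
    then have "?a \<in> set xs \<rightarrow>\<^sub>E A" using as by auto
    then show "as \<in> (\<lambda>a. map a xs) ` (set xs \<rightarrow>\<^sub>E A)" using eq by (metis (no_types, lifting) image_eqI)
  qed auto
qed

lemma sum_set_elem_eq_sum_words:
  assumes "finite X"
  shows "(\<Sum>a | a \<in> X \<rightarrow>\<^sub>E A \<and> Q (map a (sorted_list_of_set X)). set_elem s a X) =
    (\<Sum>as | length as = card X \<and> set as \<subseteq> A \<and> Q as. word_elem s as)"
proof -
  let ?h = "\<lambda>a. map a (sorted_list_of_set X)"
  have "bij_betw ?h (X \<rightarrow>\<^sub>E A) {as. length as = card X \<and> set as \<subseteq> A}"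
    using bij_betw_map_PiE[of "sorted_list_of_set X" A] assms by simp
  then have "bij_betw ?h {a \<in> X \<rightarrow>\<^sub>E A. Q (?h a)} {as \<in> {as. length as = card X \<and> set as \<subseteq> A}. Q as}"
    by (rule bij_betw_Collect) simp
  then have "(\<Sum>a\<in>{a \<in> X \<rightarrow>\<^sub>E A. Q (?h a)}. word_elem s (?h a)) =
      (\<Sum>as\<in>{as \<in> {as. length as = card X \<and> set as \<subseteq> A}. Q as}. word_elem s as)"
    by (rule sum.reindex_bij_betw)
  moreover have "word_elem s (?h a) = set_elem s a X" for a
    using assms by (simp add: word_elem_def set_elem_def set_word_def)
  ultimately show ?thesis by (simp add: conj_assoc)
qed

lemma M_JM_on_eq: "M_JM_on s A k = (\<Sum>as\<in>closed_words s A k. word_elem s as)"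
  by (simp add: M_JM_on_def closed_words_def word_elem_def)

lemma sum_set_elem_eq_M_JM_on:
  assumes "finite B"
  shows "(\<Sum>b | b \<in> B \<rightarrow>\<^sub>E A \<and> set_word s b B s = s. set_elem s b B) = M_JM_on s A (card B)"
  using sum_set_elem_eq_sum_words[OF assms, where Q = "\<lambda>as. star_word s as s = s"]
  by (simp add: M_JM_on_eq closed_words_def set_word_def conj_commute)

text \<open>Removing an interval block \<open>B\<close>: letters to its right are conjugated by the word \<open>w\<close> of \<open>B\<close>, so
  that \<open>w\<close> can be moved to the right end.\<close>

locale block_removal =
  fixes s :: nat and X B :: "nat set" and R :: "nat set set"
    and a a' b :: "nat \<Rightarrow> nat" and w :: "nat \<Rightarrow> nat"
  assumes fin: "finite X" and part: "partition_on X R" and B: "B \<in> R"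
    and interval: "\<And>x. x \<in> X \<Longrightarrow> Min B \<le> x \<Longrightarrow> x \<le> Max B \<Longrightarrow> x \<in> B"
    and w: "w = set_word s b B" and w_star: "w s = s"
    and on_B: "\<And>x. x \<in> B \<Longrightarrow> a x = b x"
    and below: "\<And>x. x \<in> X - B \<Longrightarrow> x < Min B \<Longrightarrow> a' x = a x"
    and above: "\<And>x. x \<in> X - B \<Longrightarrow> Min B < x \<Longrightarrow> a' x = w (a x)"
begin

lemma B_facts: "B \<subseteq> X" "finite B" "B \<noteq> {}"
proof -
  show "B \<subseteq> X" using B partition_onD1[OF part] by blast
  then show "finite B" using fin finite_subset by blast
  show "B \<noteq> {}" using B partition_onD3[OF part] by blast
qed

lemma Min_Max: "x \<in> B \<Longrightarrow> Min B \<le> x" "x \<in> B \<Longrightarrow> x \<le> Max B" "Min B \<in> B" "Max B \<in> B"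
  using B_facts by auto

lemma outside: "x \<in> X - B \<Longrightarrow> x < Min B \<or> Max B < x"
  using interval by (meson DiffE not_le)

lemma bij_w: "bij w"
  unfolding w by (rule bij_set_word)

text \<open>With L and U the words of I to the left and right of B, this is the identity L w U = L
  (w U w^-1) w.\<close>

lemma word_around_B:
  assumes "B \<subseteq> I" "I \<subseteq> X"
  shows "set_word s a I = set_word s a' (I - B) \<circ> w"
proof -
  let ?L = "{x \<in> I. x < Min B}" and ?U = "{x \<in> I. Max B < x}"
  have finI: "finite I" using assms(2) fin finite_subset by blast
  have I: "I = ?L \<union> (B \<union> ?U)" using assms outside by blast
  have Max: "Min B \<le> Max B" using Min_Max(2,3) by blast
  have ord: "i < j" if "i \<in> ?L" "j \<in> B" for i j using that Min_Max(1)[of j] by auto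
  have ord': "i < j" if "i \<in> B" "j \<in> ?U" for i j using that Min_Max(2)[of i] by auto
  have ord'': "i < j" if "i \<in> ?L" "j \<in> ?U" for i j using that Max by auto
  have fins: "finite ?L" "finite ?U" using finI by simp_all
  have IB: "I - B = ?L \<union> ?U" using I ord ord' by blast
  have L: "set_word s a ?L = set_word s a' ?L"
  proof (rule set_word_cong)
    fix x assume x: "x \<in> ?L"
    then have "x \<in> X - B" using assms(2) ord by blast
    then show "a x = a' x" using below x by simp
  qed
  have Bw: "set_word s a B = w" unfolding w by (rule set_word_cong) (rule on_B)
  have U: "set_word s a' ?U = w \<circ> set_word s a ?U \<circ> inv w"
  proof (rule set_word_conj[OF bij_w w_star])
    fix x assume x: "x \<in> ?U"
    then have "x \<in> X - B" using assms Min_Max(2)[of x] by auto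
    moreover have "Min B < x" using x Min_Max(2)[OF Min_Max(3)] by simp
    ultimately show "a' x = w (a x)" by (rule above)
  qed
  have "set_word s a (?L \<union> (B \<union> ?U)) = set_word s a ?L \<circ> set_word s a (B \<union> ?U)"
    using ord ord'' by (intro set_word_Un fins finite_UnI B_facts(2)) blast
  also have "set_word s a (B \<union> ?U) = set_word s a B \<circ> set_word s a ?U"
    by (rule set_word_Un[OF B_facts(2) fins(2) ord'])
  finally have wI: "set_word s a I = set_word s a ?L \<circ> (w \<circ> set_word s a ?U)"
    by (simp only: Bw I[symmetric])
  have wIB: "set_word s a' (I - B) = set_word s a' ?L \<circ> set_word s a' ?U"
    unfolding IB by (rule set_word_Un[OF fins ord''])
  have inv: "inv w (w v) = v" for v using bij_w by (simp add: bij_is_inj)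
  show ?thesis
  proof
    show "set_word s a I v = (set_word s a' (I - B) \<circ> w) v" for v
      by (simp only: wI wIB L U o_apply inv)
  qed
qed

text \<open>If I contains B, the two words differ by w, which fixes s. If I misses B, it lies on one
  side of it: below, the letters are unchanged; above, the word is conjugated by w.\<close>

lemma word_fixes_iff:
  assumes I: "I = X \<inter> {x..<y}" and "B \<subseteq> I \<or> B \<inter> I = {}"
  shows "set_word s a I s = s \<longleftrightarrow> set_word s a' (I - B) s = s"
proof (cases "B \<subseteq> I")
  case True
  then show ?thesis using word_around_B[of I] I w_star by simp
next
  case False
  then have disj: "B \<inter> I = {}" and IB: "I - B = I" using assms(2) by auto
  show ?thesis
  proof (cases "\<exists>i\<in>I. i < Min B")
    case True
    then obtain i where i: "i \<in> I" "i < Min B" by blast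
    have "a' j = a j" if j: "j \<in> I" for j
    proof (rule below)
      show "j \<in> X - B" using j I disj by auto
      show "j < Min B"
      proof (rule ccontr)
        assume "\<not> j < Min B"
        then have "Min B \<in> I" using i j I Min_Max(3) B_facts(1) by auto
        then show False using disj Min_Max(3) by blast
      qed
    qed
    then have "set_word s a' I = set_word s a I" by (rule set_word_cong)
    then show ?thesis by (simp only: IB)
  next
    case False
    have "set_word s a' I = w \<circ> set_word s a I \<circ> inv w"
    proof (rule set_word_conj[OF bij_w w_star])
      fix x assume x: "x \<in> I"
      show "a' x = w (a x)"
      proof (rule above)
        show "x \<in> X - B" using x I disj by auto
        then have "x \<noteq> Min B" using Min_Max(3) by auto
        then show "Min B < x" using False x by auto
      qed
    qed
    moreover have "inv w s = s" using bij_w w_star by (metis bij_is_inj inv_f_f)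
    moreover have "w v = s \<longleftrightarrow> v = s" for v using bij_w w_star by (metis bij_is_inj injD)
    ultimately show ?thesis by (simp add: IB)
  qed
qed

lemma partition_on_minus: "partition_on (X - B) (R - {B})"
  using part B unfolding partition_on_def disjoint_def by blast

lemma closed_on_iff: "closed_on s R X a \<longleftrightarrow> closed_on s (R - {B}) (X - B) a'"
proof
  have disj: "C \<inter> B = {}" if "C \<in> R - {B}" for C
    using that B disjointD[OF partition_onD2[OF part]] by blast
  have XB: "X \<inter> {x..<y} - B = (X - B) \<inter> {x..<y}" for x y by auto
  show "closed_on s (R - {B}) (X - B) a'" if cl: "closed_on s R X a"
    unfolding closed_on_def
  proof (intro allI impI)
    fix x y assume sat: "saturated (R - {B}) ((X - B) \<inter> {x..<y})"
    \<comment> \<open>An interval may cut B. Enlarging it to cover B adds no point of X outside B,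
      because B is an interval of X.\<close>
    obtain x' y' where B': "B \<subseteq> X \<inter> {x'..<y'} \<or> B \<inter> (X \<inter> {x'..<y'}) = {}"
      and eq: "(X - B) \<inter> {x'..<y'} = (X - B) \<inter> {x..<y}"
    proof (cases "B \<inter> {x..<y} = {}")
      case True
      then show ?thesis using that[of x y] by blast
    next
      case False
      then obtain c where c: "c \<in> B" "x \<le> c" "c < y" by auto
      show ?thesis
      proof (rule that[of "min x (Min B)" "max y (Suc (Max B))"])
        show "B \<subseteq> X \<inter> {min x (Min B)..<max y (Suc (Max B))} \<or>
            B \<inter> (X \<inter> {min x (Min B)..<max y (Suc (Max B))}) = {}"
          using B_facts(1) Min_Max(1,2) by (auto simp: less_Suc_eq_le le_max_iff_disj min_le_iff_disj less_max_iff_disj)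
        have "x \<le> z \<and> z < y" if "z \<in> X - B" "min x (Min B) \<le> z" "z < max y (Suc (Max B))" for z
          using outside[OF that(1)] that(2,3) c Min_Max(1,2)[OF c(1)] by (auto simp: min_def max_def split: if_splits)
        then show "(X - B) \<inter> {min x (Min B)..<max y (Suc (Max B))} = (X - B) \<inter> {x..<y}"
          by auto
      qed
    qed
    let ?I = "X \<inter> {x'..<y'}"
    have IB: "?I - B = (X - B) \<inter> {x..<y}" using XB eq by blast
    have "saturated R ?I"
      unfolding saturated_def
    proof
      fix C assume C: "C \<in> R"
      show "C \<subseteq> ?I \<or> C \<inter> ?I = {}"
      proof (cases "C = B")
        case False
        then have "C \<subseteq> ?I - B \<or> C \<inter> (?I - B) = {}" "C \<inter> B = {}"
          using sat C disj unfolding IB saturated_def by blast+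
        then show ?thesis by blast
      qed (use B' in simp)
    qed
    then have "set_word s a ?I s = s" using cl unfolding closed_on_def by blast
    then show "set_word s a' ((X - B) \<inter> {x..<y}) s = s"
      using word_fixes_iff[OF refl B'] IB by simp
  qed
  show "closed_on s R X a" if cl: "closed_on s (R - {B}) (X - B) a'"
    unfolding closed_on_def
  proof (intro allI impI)
    fix x y assume sat: "saturated R (X \<inter> {x..<y})"
    then have B': "B \<subseteq> X \<inter> {x..<y} \<or> B \<inter> (X \<inter> {x..<y}) = {}" using B unfolding saturated_def by blast
    have "saturated (R - {B}) (X \<inter> {x..<y} - B)"
      using sat disj unfolding saturated_def by blast
    then have "set_word s a' (X \<inter> {x..<y} - B) s = s" using cl unfolding closed_on_def XB by blast
    then show "set_word s a (X \<inter> {x..<y}) s = s" using word_fixes_iff[OF refl B'] by simp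
  qed
qed

lemma set_elem_mult:
  assumes "closed_on s (R - {B}) (X - B) a'" and "s \<notin> a' ` (X - B)" "s \<notin> b ` B"
  shows "set_elem s a X = set_elem s a' (X - B) * set_elem s b B"
proof -
  have fin': "finite (X - B)" using fin by simp
  have "set_word s a' (X - B) s = s"
    by (rule closed_on_total[OF fin' partition_on_minus assms(1)])
  then have p1: "set_word s a' (X - B) permutes a' ` (X - B)"
    using set_word_permutes fin' assms(2) by blast
  have p2: "w permutes b ` B"
    unfolding w by (rule set_word_permutes) (use B_facts w w_star assms(3) in auto)
  have sub: "w v \<in> b ` B \<longleftrightarrow> v \<in> b ` B" for v using p2 by (rule permutes_in_image)
  have fix_w: "w v = v" if "v \<notin> b ` B" for v using p2 that by (rule permutes_not_in)
  \<comment> \<open>The support is unchanged by the conjugation: w moves only letters of B, so a' x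
    and a x can differ only within the set of these letters.\<close>
  have img: "a ` X = a' ` (X - B) \<union> b ` B"
  proof -
    have 1: "a' x \<in> b ` B \<longleftrightarrow> a x \<in> b ` B" "a x \<notin> b ` B \<longrightarrow> a' x = a x" if "x \<in> X - B" for x
    proof -
      have "a' x = a x \<or> a' x = w (a x)" using outside[OF that] below above that
        by (meson Min_Max(2,3) le_less_trans)
      then show "a' x \<in> b ` B \<longleftrightarrow> a x \<in> b ` B" "a x \<notin> b ` B \<longrightarrow> a' x = a x"
        by (metis sub fix_w)+
    qed
    have "a ` X = a ` (X - B) \<union> a ` B" using B_facts(1) by blast
    also have "a ` B = b ` B" by (rule image_cong[OF refl on_B])
    also have "a ` (X - B) \<union> b ` B = a' ` (X - B) \<union> b ` B"
    proof -
      have "a x \<in> a' ` (X - B) \<union> b ` B" "a' x \<in> a ` (X - B) \<union> b ` B" if "x \<in> X - B" for x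
        using 1[OF that] that by (metis UnI1 UnI2 imageI)+
      then show ?thesis by blast
    qed
    finally show ?thesis .
  qed
  have "set_word s a X = set_word s a' (X - B) \<circ> w"
    by (rule word_around_B) (use B_facts in auto)
  then have "mk_pperm (a ` X) (set_word s a X) =
      mk_pperm (a' ` (X - B)) (set_word s a' (X - B)) + mk_pperm (b ` B) w"
    using mk_pperm_plus[OF _ p1 _ p2] fin' B_facts(2) img by simp
  then show ?thesis by (simp add: set_elem_def mult_single w)
qed

end

section \<open>Splitting off a block and induction on the number of blocks\<close>

lemma sum_closed_on_remove_block:
  assumes fin: "finite X" and part: "partition_on X R" and B: "B \<in> R" and star: "s \<notin> A"
    and interval: "\<And>x. x \<in> X \<Longrightarrow> Min B \<le> x \<Longrightarrow> x \<le> Max B \<Longrightarrow> x \<in> B"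
  shows "(\<Sum>a | a \<in> X \<rightarrow>\<^sub>E A \<and> closed_on s R X a. set_elem s a X) =
    (\<Sum>a | a \<in> (X - B) \<rightarrow>\<^sub>E A \<and> closed_on s (R - {B}) (X - B) a. set_elem s a (X - B)) *
    (\<Sum>b | b \<in> B \<rightarrow>\<^sub>E A \<and> set_word s b B s = s. set_elem s b B)"
    (is "sum _ ?S = sum _ ?S1 * sum _ ?S2")
proof -
  have BX: "B \<subseteq> X" using B partition_onD1[OF part] by blast
  have finB: "finite B" using BX fin finite_subset by blast
  have neB: "B \<noteq> {}" using B partition_onD3[OF part] by blast
  \<comment> \<open>T separates the letters in B from the others and conjugates those above B; i
    undoes the conjugation with the inverse of the same word.\<close>
  define T where "T a = (restrict (\<lambda>x. if x < Min B then a x else set_word s a B (a x)) (X - B), restrict a B)"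
    for a :: "nat \<Rightarrow> nat"
  define i where "i = (\<lambda>(a', b). restrict (\<lambda>x. if x \<in> B then b x else if x < Min B then a' x
    else inv (set_word s b B) (a' x)) X)" for a' b :: "nat \<Rightarrow> nat"
  \<comment> \<open>Conjugated letters stay in A, in both directions.\<close>
  have perm: "set_word s b B permutes A" if "set_word s b B s = s" "b ` B \<subseteq> A" for b
  proof -
    have "s \<notin> b ` B" using that(2) star by blast
    from set_word_permutes[OF finB that(1) this] show ?thesis using that(2) by (rule permutes_subset)
  qed
  have removal_T: "block_removal s X B R a (fst (T a)) (snd (T a)) (set_word s a B)" if a: "a \<in> ?S" for a
  proof (rule block_removal.intro[OF fin part B interval])
    show "set_word s a B s = s"
    proof -
      have "X \<inter> {Min B..<Suc (Max B)} = B" using interval finB BX by (auto simp: less_Suc_eq_le)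
      moreover have "saturated R B"
        using B disjointD[OF partition_onD2[OF part]] by (auto simp: saturated_def)
      moreover have "closed_on s R X a" using a by blast
      ultimately show ?thesis unfolding closed_on_def by metis
    qed
    show "set_word s a B = set_word s (snd (T a)) B"
      by (rule set_word_cong) (simp add: T_def)
    show "a x = snd (T a) x" if "x \<in> B" for x using that by (simp add: T_def)
    show "fst (T a) x = a x" if "x \<in> X - B" "x < Min B" for x using that by (simp add: T_def)
    show "fst (T a) x = set_word s a B (a x)" if "x \<in> X - B" "Min B < x" for x
      using that by (simp add: T_def)
  qed simp_all
  have removal_i: "block_removal s X B R (i (a', b)) a' b (set_word s b B)"
    if "a' \<in> ?S1" "b \<in> ?S2" for a' b
  proof (rule block_removal.intro[OF fin part B interval])
    have "bij (set_word s b B)" by (rule bij_set_word)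
    then show "a' x = set_word s b B (i (a', b) x)" if "x \<in> X - B" "Min B < x" for x
      using that by (simp add: i_def bij_is_surj surj_f_inv_f)
    show "i (a', b) x = b x" if "x \<in> B" for x
      using that BX by (auto simp: i_def)
    show "a' x = i (a', b) x" if "x \<in> X - B" "x < Min B" for x using that by (simp add: i_def)
    show "set_word s b B s = s" using that by blast
  qed simp_all
  have "sum (\<lambda>a. set_elem s a X) ?S = sum (\<lambda>(a', b). set_elem s a' (X - B) * set_elem s b B) (?S1 \<times> ?S2)"
  proof (rule sum.reindex_bij_witness[of _ i T])
    fix a assume a: "a \<in> ?S"
    interpret block_removal s X B R a "fst (T a)" "snd (T a)" "set_word s a B" by (rule removal_T[OF a])
    have aA: "a x \<in> A" if "x \<in> X" for x using a that by auto
    have permA: "set_word s a B permutes A" by (rule perm) (use w_star aA BX in auto)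
    have wA: "set_word s a B (a x) \<in> A" if "x \<in> X" for x
      using aA[OF that] permA by (simp only: permutes_in_image)
    have wb: "set_word s (restrict a B) B = set_word s a B"
      by (rule set_word_cong) simp
    have inv: "inv (set_word s a B) (set_word s a B v) = v" for v
      using bij_set_word by (metis bij_is_inj inv_f_f)
    show "i (T a) = a"
    proof
      fix x
      consider "x \<notin> X" | "x \<in> B" | "x \<in> X - B" by blast
      then show "i (T a) x = a x"
      proof cases
        case 1
        have "a \<in> X \<rightarrow>\<^sub>E A" using a by blast
        then show ?thesis using 1 PiE_arb[of a X _ x] by (simp add: i_def T_def)
      next
        case 2
        then show ?thesis using BX by (auto simp: i_def T_def)
      next
        case 3
        then show ?thesis by (simp add: i_def T_def wb inv)
      qed
    qed
    have "closed_on s (R - {B}) (X - B) (fst (T a))" using closed_on_iff a by blast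
    moreover have "set_word s (snd (T a)) B s = s" using w w_star by simp
    moreover have "fst (T a) \<in> (X - B) \<rightarrow>\<^sub>E A" using aA wA by (auto simp: T_def)
    moreover have "snd (T a) \<in> B \<rightarrow>\<^sub>E A" using aA BX by (auto simp: T_def)
    ultimately show T: "T a \<in> ?S1 \<times> ?S2" by (auto simp: mem_Times_iff)
    have "set_elem s a X = set_elem s (fst (T a)) (X - B) * set_elem s (snd (T a)) B"
      by (rule set_elem_mult) (use T star in \<open>auto simp: mem_Times_iff\<close>)
    then show "(case T a of (a', b) \<Rightarrow> set_elem s a' (X - B) * set_elem s b B) = set_elem s a X"
      by (simp add: case_prod_unfold)
  next
    fix ab assume ab: "ab \<in> ?S1 \<times> ?S2"
    obtain a' b where eq: "ab = (a', b)" by (cases ab)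
    have a': "a' \<in> ?S1" and b: "b \<in> ?S2" using ab eq by auto
    interpret block_removal s X B R "i (a', b)" a' b "set_word s b B" by (rule removal_i[OF a' b])
    have permA: "inv (set_word s b B) permutes A"
      by (rule permutes_inv[OF perm]) (use w_star b in auto)
    have "i (a', b) x \<in> A" if x: "x \<in> X" for x
    proof -
      have aA: "a' x \<in> A" if "x \<notin> B" using a' x that by auto
      have iA: "inv (set_word s b B) (a' x) \<in> A" if "x \<notin> B"
        using aA[OF that] permutes_in_image[OF permA] by blast
      have "b x \<in> A" if "x \<in> B" using b that by auto
      then show ?thesis using x aA iA by (simp add: i_def)
    qed
    moreover have "i (a', b) x = undefined" if "x \<notin> X" for x using that by (simp add: i_def)
    ultimately have "i (a', b) \<in> X \<rightarrow>\<^sub>E A" by (auto simp: PiE_iff extensional_def)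
    moreover have "closed_on s R X (i (a', b))" using closed_on_iff a' by blast
    ultimately show "i ab \<in> ?S" using eq by blast
    have wb: "set_word s (i (a', b)) B = set_word s b B" by (rule set_word_cong) (rule on_B)
    have "fst (T (i (a', b))) x = a' x" for x
    proof (cases "x \<in> X - B")
      case True
      then show ?thesis using outside[OF True] below[OF True] above[OF True] Min_Max(2)[OF Min_Max(3)]
        by (auto simp: T_def wb)
    next
      case False
      then have "fst (T (i (a', b))) x = undefined" by (simp only: T_def fst_conv restrict_apply if_False)
      moreover have "a' \<in> (X - B) \<rightarrow>\<^sub>E A" using a' by blast
      ultimately show ?thesis using PiE_arb[OF _ False] by metis
    qed
    moreover have "snd (T (i (a', b))) x = b x" for x
    proof (cases "x \<in> B")
      case False
      have "b \<in> B \<rightarrow>\<^sub>E A" using b by blast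
      then show ?thesis using False PiE_arb[of b B _ x] by (simp add: T_def)
    qed (simp add: T_def on_B)
    ultimately show "T (i ab) = ab" using eq by (intro prod_eqI ext) auto
  qed
  also have "\<dots> = sum (\<lambda>a. set_elem s a (X - B)) ?S1 * sum (\<lambda>b. set_elem s b B) ?S2"
    by (simp add: sum_product sum.cartesian_product)
  finally show ?thesis .
qed

text \<open>The block B with the largest minimum is removed. A point of another block C between
  \<open>Min B\<close> and \<open>Max B\<close> would make a crossing, since
  \<open>Min C < Min B\<close>; so B is an interval. Its factor comes out on the right, which fits
  the listing by increasing minima in the noncommutative product.\<close>

theorem sum_closed_on_eq_prod:
  assumes "finite X" and "partition_on X R" and "noncrossing R" and "s \<notin> A"
  shows "(\<Sum>a | a \<in> X \<rightarrow>\<^sub>E A \<and> closed_on s R X a. set_elem s a X) =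
    prod_list (map (\<lambda>x. M_JM_on s A (card (THE b. b \<in> R \<and> x \<in> b))) (sorted_list_of_set (Min ` R)))"
  using assms(1-3)
proof (induction "card R" arbitrary: X R)
  case 0
  have finR: "finite R" using 0 by (intro finite_elements)
  then have "R = {}" "X = {}" using 0 partition_onD1[of X R] by auto
  moreover have "mk_pperm {} id = 0" by (simp add: mk_pperm_def zero_pperm_def id_def)
  ultimately show ?case
    by (simp add: closed_on_def set_elem_def)
next
  case (Suc k)
  have finR: "finite R" using Suc.prems by (intro finite_elements)
  have neR: "R \<noteq> {}" using Suc.hyps by auto
  have part: "partition_on X R" by (rule Suc.prems)
  have block: "finite C" "C \<noteq> {}" "C \<subseteq> X" "Min C \<in> C" if "C \<in> R" for C
  proof -
    show "C \<subseteq> X" using that partition_onD1[OF part] by blast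
    then show "finite C" using Suc.prems(1) finite_subset by blast
    show "C \<noteq> {}" using that partition_onD3[OF part] by blast
    then show "Min C \<in> C" using \<open>finite C\<close> by simp
  qed
  have "Max (Min ` R) \<in> Min ` R" using finR neR by (intro Max_in) auto
  then obtain B where B: "B \<in> R" and maxB: "Max (Min ` R) = Min B" by auto
  have same: "C = D" if "C \<in> R" "D \<in> R" "x \<in> C" "x \<in> D" for C D x
    using that disjointD[OF partition_onD2[OF part]] by blast
  have less: "Min C < Min B" if C: "C \<in> R" "C \<noteq> B" for C
  proof -
    have "Min C \<le> Min B" using C finR maxB by (metis Max_ge finite_imageI imageI)
    moreover have "Min C \<noteq> Min B" using same[OF C(1) B] block(4) C B by metis
    ultimately show ?thesis by simp
  qed
  have interval: "x \<in> B" if x: "x \<in> X" "Min B \<le> x" "x \<le> Max B" for x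
  proof (rule ccontr)
    assume nB: "x \<notin> B"
    obtain C where C: "C \<in> R" "x \<in> C" using x(1) partition_onD1[OF part] by blast
    then have ne: "C \<noteq> B" using nB by blast
    have MB: "Max B \<in> B" using block[OF B] by simp
    have "x \<noteq> Min B" "x \<noteq> Max B" using nB block(4)[OF B] MB by auto
    then have "Min B < x" "x < Max B" using x by auto
    then have "C = B"
      using noncrossingD[OF Suc.prems(3) C(1) B less[OF C(1) ne]] block(4)[OF C(1)] C(2) block(4)[OF B] MB
      by blast
    then show False using ne by blast
  qed
  let ?R = "R - {B}"
  let ?f = "\<lambda>R x. M_JM_on s A (card (THE b. b \<in> R \<and> x \<in> b))"
  have the: "(THE b. b \<in> Q \<and> Min C \<in> b) = C" if "Q \<subseteq> R" "C \<in> Q" for Q C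
    by (rule the_equality) (use that same block(4) in blast)+
  have sorted: "sorted_list_of_set (Min ` R) = sorted_list_of_set (Min ` ?R) @ [Min B]"
  proof (rule sorted_distinct_set_unique)
    have lt: "x < Min B" if "x \<in> Min ` ?R" for x using that less by blast
    then have "Min B \<notin> Min ` ?R" by blast
    then show "distinct (sorted_list_of_set (Min ` ?R) @ [Min B])"
      using finR by (simp del: image_iff)
    show "sorted (sorted_list_of_set (Min ` ?R) @ [Min B])"
      using finR lt by (simp add: sorted_append less_imp_le)
    have "Min ` R = insert (Min B) (Min ` ?R)" using B by blast
    then show "set (sorted_list_of_set (Min ` R)) = set (sorted_list_of_set (Min ` ?R) @ [Min B])"
      using finR set_sorted_list_of_set[of "Min ` R"] set_sorted_list_of_set[of "Min ` ?R"]
      by (simp only: set_append finite_imageI finite_Diff list.set) blast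
  qed simp_all
  have "partition_on (X - B) ?R"
    using part B unfolding partition_on_def disjoint_def by blast
  moreover have "noncrossing ?R" using Suc.prems(3) unfolding noncrossing_def by blast
  moreover have "k = card ?R" using Suc.hyps(2) B finR by simp
  ultimately have IH: "(\<Sum>a | a \<in> (X - B) \<rightarrow>\<^sub>E A \<and> closed_on s ?R (X - B) a. set_elem s a (X - B)) =
      prod_list (map (?f ?R) (sorted_list_of_set (Min ` ?R)))"
    using Suc.prems(1) by (intro Suc.hyps(1)) auto
  have factors: "map (?f ?R) (sorted_list_of_set (Min ` ?R)) = map (?f R) (sorted_list_of_set (Min ` ?R))"
  proof (rule map_cong[OF refl])
    fix x assume "x \<in> set (sorted_list_of_set (Min ` ?R))"
    then obtain C where C: "C \<in> ?R" "x = Min C" using finR by auto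
    then show "?f ?R x = ?f R x" using the[of ?R C] the[of R C] by simp
  qed
  have last: "?f R (Min B) = M_JM_on s A (card B)" using the[OF order_refl B] by simp
  have removal: "(\<Sum>a | a \<in> X \<rightarrow>\<^sub>E A \<and> closed_on s R X a. set_elem s a X) =
      (\<Sum>a | a \<in> (X - B) \<rightarrow>\<^sub>E A \<and> closed_on s ?R (X - B) a. set_elem s a (X - B)) *
      M_JM_on s A (card B)"
    unfolding sum_set_elem_eq_M_JM_on[OF block(1)[OF B], symmetric]
    by (rule sum_closed_on_remove_block[OF Suc.prems(1) part B assms(4)]) (rule interval)
  show ?case
    unfolding removal IH factors sorted by (simp add: last)
qed

section \<open>Kernels above the inverse Kreweras complement\<close>

lemma connected_by_walk_kernel:
  "connected_by (walk_kernel s as) x y \<longleftrightarrow>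
    x \<in> {1..length as} \<and> y \<in> {1..length as} \<and> walk s as (x - 1) = walk s as (y - 1)"
  by (auto simp: connected_by_def walk_kernel_def)

text \<open>Times x < y are joined in \<open>compl_inv n R\<close> iff \<open>{x..<y}\<close> is
  saturated, and the walk is at the same place at both iff the subword on \<open>{x..<y}\<close>
  fixes s.\<close>

lemma closed_on_iff_refines:
  assumes part: "partition_on {1..n} R"
  shows "closed_on s R {1..n} a \<longleftrightarrow> star_word s (map a [1..<n + 1]) s = s \<and>
    refines {1..n} (compl_inv n R) (walk_kernel s (map a [1..<n + 1]))"
proof -
  define as where "as = map a [1..<n + 1]"
  have len: "length as = n" by (simp add: as_def)
  have walk_iff: "walk s as (x - 1) = walk s as (y - 1) \<longleftrightarrow> set_word s a {x..<y} s = s"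
    if "1 \<le> x" "x \<le> y" "y \<le> n + 1" for x y
  proof -
    have "take ((y - 1) - (x - 1)) (drop (x - 1) as) = map a [x..<y]"
      using that by (simp add: as_def take_map drop_map drop_upt take_upt del: upt_Suc)
    moreover have "sorted_list_of_set {x..<y} = [x..<y]" by simp
    ultimately show ?thesis
      using walk_eq_iff[of "x - 1" "y - 1" s as] that by (simp add: set_word_def)
  qed
  have total: "set_word s a {1..<n + 1} = star_word s as"
    by (simp add: set_word_def as_def del: upt_Suc)
  have refines: "refines {1..n} (compl_inv n R) (walk_kernel s as) \<longleftrightarrow>
      (\<forall>x y. connected_by (compl_inv n R) x y \<longrightarrow> walk s as (x - 1) = walk s as (y - 1))"
    using refines_iff_connected[OF partition_on_compl_inv, of n "walk_kernel s as" R]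
      partition_on_walk_kernel[of as s] unfolding len connected_by_walk_kernel
    using connected_by_equiv(4)[OF partition_on_compl_inv] by blast
  have "closed_on s R {1..n} a \<longleftrightarrow> star_word s as s = s \<and>
      refines {1..n} (compl_inv n R) (walk_kernel s as)"
  proof (intro iffI conjI)
    assume cl: "closed_on s R {1..n} a"
    have "{1..n} = {1..<n + 1}" by auto
    then show "star_word s as s = s"
      using closed_on_total[OF _ part cl] total by simp
    show "refines {1..n} (compl_inv n R) (walk_kernel s as)"
      unfolding refines
    proof (intro allI impI)
      fix x y assume con: "connected_by (compl_inv n R) x y"
      let ?x = "min x y" and ?y = "max x y"
      have xy: "x \<in> {1..n}" "y \<in> {1..n}" "saturated R {?x..<?y}"
        using con unfolding connected_by_compl_inv by auto
      then have "{1..n} \<inter> {?x..<?y} = {?x..<?y}" by auto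
      then have "set_word s a {?x..<?y} s = s" using cl xy(3) unfolding closed_on_def by metis
      then have "walk s as (?x - 1) = walk s as (?y - 1)"
        using walk_iff[of ?x ?y] xy by auto
      then show "walk s as (x - 1) = walk s as (y - 1)" by (auto simp: min_def max_def split: if_splits)
    qed
  next
    assume asm: "star_word s as s = s \<and> refines {1..n} (compl_inv n R) (walk_kernel s as)"
    show "closed_on s R {1..n} a"
      unfolding closed_on_def
    proof (intro allI impI)
      fix x' y' assume sat': "saturated R ({1..n} \<inter> {x'..<y'})"
      define x where "x = max 1 x'"
      define y where "y = min (n + 1) y'"
      have eq: "{1..n} \<inter> {x'..<y'} = {x..<y}" by (auto simp: x_def y_def)
      have sat: "saturated R {x..<y}" using sat' eq by simp
      have "set_word s a {x..<y} s = s"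
      proof (cases "x < y")
        case lt: True
        have bounds: "1 \<le> x" "x \<le> n" "y \<le> n + 1" using lt by (auto simp: x_def y_def)
        have con: "walk s as (u - 1) = walk s as (v - 1)" if "saturated R {u..<v}" "1 \<le> u" "u \<le> v" "v \<le> n" for u v
          using asm that unfolding refines connected_by_compl_inv by (auto simp: min_def max_def)
        have "walk s as (x - 1) = walk s as (y - 1)"
        proof (cases "y \<le> n")
          case True
          then show ?thesis using con[OF sat] bounds lt by simp
        next
          case False
          then have y: "y = n + 1" using bounds by simp
          \<comment> \<open>Time n + 1 is not in the ground set, so an interval reaching up to n is
            replaced by its complement; the walk starts and ends at s.\<close>
          have "saturated R {1..<x}"
            unfolding saturated_def
          proof
            fix C assume C: "C \<in> R"
            then have "C \<subseteq> {1..n}" using partition_onD1[OF part] by blast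
            moreover have "C \<subseteq> {x..<y} \<or> C \<inter> {x..<y} = {}" using sat C unfolding saturated_def by blast
            ultimately show "C \<subseteq> {1..<x} \<or> C \<inter> {1..<x} = {}" unfolding y by fastforce
          qed
          then have "walk s as 0 = walk s as (x - 1)" using con[of 1 x] bounds by simp
          moreover have "walk s as n = s" using asm walk_length[of s as] len by simp
          ultimately show ?thesis using y by simp
        qed
        then show ?thesis using walk_iff bounds lt by simp
      qed simp
      then show "set_word s a ({1..n} \<inter> {x'..<y'}) s = s" using eq by simp
    qed
  qed
  then show ?thesis by (simp add: as_def)
qed

theorem sum_refining_words:
  assumes "R \<in> NC {1..n}" and "s \<notin> A"
  shows "(\<Sum>as | as \<in> closed_words s A n \<and> refines {1..n} (compl_inv n R) (walk_kernel s as). word_elem s as) =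
    prod_list (map (\<lambda>x. M_JM_on s A (card (THE b. b \<in> R \<and> x \<in> b))) (sorted_list_of_set (Min ` R)))"
proof -
  have part: "partition_on {1..n} R" and nc: "noncrossing R" using assms(1) by (auto simp: NC_def)
  let ?Q = "\<lambda>as. star_word s as s = s \<and> refines {1..n} (compl_inv n R) (walk_kernel s as)"
  have srt: "sorted_list_of_set {1..n} = [1..<n + 1]"
    by (metis Suc_eq_plus1 atLeastLessThanSuc_atLeastAtMost sorted_list_of_set_range)
  have "(\<Sum>a | a \<in> {1..n} \<rightarrow>\<^sub>E A \<and> closed_on s R {1..n} a. set_elem s a {1..n}) =
      (\<Sum>a | a \<in> {1..n} \<rightarrow>\<^sub>E A \<and> ?Q (map a (sorted_list_of_set {1..n})). set_elem s a {1..n})"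
    unfolding srt closed_on_iff_refines[OF part] ..
  also have "\<dots> = (\<Sum>as | length as = card {1..n} \<and> set as \<subseteq> A \<and> ?Q as. word_elem s as)"
    by (rule sum_set_elem_eq_sum_words) simp
  also have "{as. length as = card {1..n} \<and> set as \<subseteq> A \<and> ?Q as} =
      {as. as \<in> closed_words s A n \<and> refines {1..n} (compl_inv n R) (walk_kernel s as)}"
    by (auto simp: closed_words_def)
  finally show ?thesis using sum_closed_on_eq_prod[OF _ part nc assms(2)] by simp
qed

subsection \<open>Linear extension and components\<close>

lemma lookup_map_times [simp]:
  "Poly_Mapping.lookup (Poly_Mapping.map ((*) (c::complex)) f) k = c * Poly_Mapping.lookup f k"
  by (simp add: Poly_Mapping.map.rep_eq when_def)

lemma map_times_one [simp]: "Poly_Mapping.map ((*) (1::complex)) f = f"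
  by (rule poly_mapping_eqI) simp

lemma scale_inf_simps [simp]:
  "scale_inf 0 x = 0" "scale_inf 1 x = x" "scale_inf c 0 = 0"
  by (transfer; auto intro!: poly_mapping_eqI ext)+

lemma scale_inf_add: "scale_inf (c + d) x = scale_inf c x + scale_inf d x"
  by (transfer, auto intro!: poly_mapping_eqI ext simp: lookup_add distrib_right)

lemma scale_inf_distrib: "scale_inf c (x + y) = scale_inf c x + scale_inf c y"
  by (transfer, auto intro!: poly_mapping_eqI ext simp: lookup_add distrib_left)

lemma scale_inf_scale_inf: "scale_inf c (scale_inf d x) = scale_inf (c * d) x"
  by (transfer, auto intro!: poly_mapping_eqI ext simp: mult.assoc)

lemma scale_inf_sum: "scale_inf c (sum f I) = (\<Sum>i\<in>I. scale_inf c (f i))"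
  by (induction I rule: infinite_finite_induct) (auto simp: scale_inf_distrib)

text \<open>Coefficients may cancel or be scaled to 0; a fixed finite index set allows termwise
  comparison nevertheless.\<close>

lemma Sigma_lin_superset:
  assumes "finite K" "Poly_Mapping.keys f \<subseteq> K"
  shows "Sigma_lin f = (\<Sum>P\<in>K. scale_inf (Poly_Mapping.lookup f P) (Sigma_partition P))"
  unfolding Sigma_lin_def using assms
  by (intro sum.mono_neutral_left) (auto simp: in_keys_iff)

lemma Sigma_lin_zero [simp]: "Sigma_lin 0 = 0"
  by (simp add: Sigma_lin_def)

lemma Sigma_lin_add: "Sigma_lin (f + g) = Sigma_lin f + Sigma_lin g"
proof -
  let ?K = "Poly_Mapping.keys f \<union> Poly_Mapping.keys g"
  have "Sigma_lin (f + g) = (\<Sum>P\<in>?K. scale_inf (Poly_Mapping.lookup (f + g) P) (Sigma_partition P))"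
    by (rule Sigma_lin_superset) (auto simp: keys_add)
  also have "\<dots> = Sigma_lin f + Sigma_lin g"
    using Sigma_lin_superset[of ?K f] Sigma_lin_superset[of ?K g]
    by (simp add: lookup_add scale_inf_add sum.distrib)
  finally show ?thesis .
qed

lemma Sigma_lin_scale: "Sigma_lin (Poly_Mapping.map ((*) c) f) = scale_inf c (Sigma_lin f)"
proof -
  have "Sigma_lin (Poly_Mapping.map ((*) c) f) =
      (\<Sum>P\<in>Poly_Mapping.keys f. scale_inf (c * Poly_Mapping.lookup f P) (Sigma_partition P))"
  proof -
    have "Poly_Mapping.keys (Poly_Mapping.map ((*) c) f) \<subseteq> Poly_Mapping.keys f"
      by (auto simp: in_keys_iff)
    from Sigma_lin_superset[OF finite_keys this] show ?thesis by simp
  qed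
  then show ?thesis by (simp add: Sigma_lin_def scale_inf_sum scale_inf_scale_inf)
qed

lemma Sigma_lin_sum: "Sigma_lin (sum f I) = (\<Sum>i\<in>I. Sigma_lin (f i))"
  by (induction I rule: infinite_finite_induct) (auto simp: Sigma_lin_add)

lemma Sigma_lin_single [simp]: "Sigma_lin (Poly_Mapping.single P 1) = Sigma_partition P"
  by (simp add: Sigma_lin_def)

lemma component_sum: "component (sum f I) q = (\<Sum>i\<in>I. component (f i) q)"
  by (induction I rule: infinite_finite_induct) (auto simp: zero_palg_inf.rep_eq plus_palg_inf.rep_eq)

lemma component_prod_list: "component (prod_list xs) q = prod_list (map (\<lambda>x. component x q) xs)"
  by (induction xs) (auto simp: one_palg_inf.rep_eq times_palg_inf.rep_eq)

lemma palg_inf_eqI: "(\<And>q. component x q = component y q) \<Longrightarrow> x = y"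
  using component_inject by blast

subsection \<open>Relabelling\<close>

lemma mono_rank_in: "finite X \<Longrightarrow> mono (rank_in X)"
  unfolding rank_in_def by (intro monoI card_mono) auto

lemma rank_in_less:
  assumes "finite X" "x \<in> X" "y \<in> X" "x < y"
  shows "rank_in X x < rank_in X y"
  unfolding rank_in_def
proof (rule psubset_card_mono)
  show "{z \<in> X. z \<le> x} \<subset> {z \<in> X. z \<le> y}"
    using assms by (auto simp: psubset_eq) (metis (mono_tags, lifting) leD mem_Collect_eq order_refl)
qed (use assms in simp)

lemma rank_in_less_iff:
  "finite X \<Longrightarrow> x \<in> X \<Longrightarrow> y \<in> X \<Longrightarrow> rank_in X x < rank_in X y \<longleftrightarrow> x < y"
  using rank_in_less by (metis less_asym linorder_neqE)

lemma inj_on_rank_in: "finite X \<Longrightarrow> inj_on (rank_in X) X"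
  by (intro inj_onI) (metis rank_in_less less_irrefl linorder_neqE)

lemma rank_in_image:
  assumes "finite X"
  shows "rank_in X ` X = {1..card X}"
proof (rule card_subset_eq)
  show "rank_in X ` X \<subseteq> {1..card X}"
  proof
    fix i assume "i \<in> rank_in X ` X"
    then obtain x where x: "x \<in> X" "i = card {z \<in> X. z \<le> x}" by (auto simp: rank_in_def)
    then have "{z \<in> X. z \<le> x} \<noteq> {}" "{z \<in> X. z \<le> x} \<subseteq> X" by auto
    then have "card {z \<in> X. z \<le> x} > 0" "card {z \<in> X. z \<le> x} \<le> card X"
      using assms by (auto simp: card_gt_0_iff intro: card_mono)
    then show "i \<in> {1..card X}" using x(2) by auto
  qed
  show "card (rank_in X ` X) = card {1..card X}"
    using inj_on_rank_in[OF assms] by (simp add: card_image)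
qed simp

lemma bij_betw_image_partitions:
  assumes "bij_betw f A B"
  shows "bij_betw (\<lambda>P. (\<lambda>C. f ` C) ` P) {P. partition_on A P} {P. partition_on B P}"
proof -
  have im: "partition_on (g ` C) ((\<lambda>D. g ` D) ` P)" if "partition_on C P" "inj_on g C"
    for g :: "'c \<Rightarrow> 'd" and C P
    using partition_on_inj_image[OF that] partition_onD3[OF that(1)] by (metis (no_types, lifting) Diff_empty Diff_insert0 image_iff image_is_empty)
  have inv: "(\<lambda>C. g ` C) ` (\<lambda>C. h ` C) ` P = P" if "partition_on C P" "\<And>x. x \<in> C \<Longrightarrow> g (h x) = x"
    for g :: "'d \<Rightarrow> 'c" and h and C P
  proof -
    have "g ` h ` D = D" if "D \<in> P" for D
    proof -
      have "D \<subseteq> C" using partition_onD1[OF \<open>partition_on C P\<close>] that by blast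
      then show ?thesis using \<open>\<And>x. x \<in> C \<Longrightarrow> g (h x) = x\<close> by (force simp: image_iff)
    qed
    then show ?thesis by (simp add: image_image)
  qed
  have f: "inj_on f A" "f ` A = B" using assms by (auto simp: bij_betw_def)
  let ?g = "inv_into A f"
  have g: "inj_on ?g B" "?g ` B = A" using bij_betw_inv_into[OF assms] by (auto simp: bij_betw_def)
  show ?thesis
    by (rule bij_betwI[of _ _ _ "\<lambda>P. (\<lambda>C. ?g ` C) ` P"])
      (use f g im[of A _ f] im[of B _ ?g] inv[of A _ ?g f] inv[of B _ f ?g] in
        \<open>auto simp: inv_into_f_f f_inv_into_f\<close>)
qed

lemma bij_betw_relabel:
  assumes "finite X"
  shows "bij_betw (relabel X) {P. partition_on X P} {P. partition_on {1..card X} P}"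
proof -
  have "bij_betw (rank_in X) X {1..card X}"
    using assms by (simp add: bij_betw_def inj_on_rank_in rank_in_image)
  from bij_betw_image_partitions[OF this] show ?thesis
    unfolding relabel_def[abs_def] .
qed

lemma partition_on_relabel: "finite X \<Longrightarrow> partition_on X P \<Longrightarrow> partition_on {1..card X} (relabel X P)"
  using bij_betw_relabel bij_betwE by blast

lemma connected_by_relabel:
  assumes "finite X" "partition_on X P" "x \<in> X" "y \<in> X"
  shows "connected_by (relabel X P) (rank_in X x) (rank_in X y) \<longleftrightarrow> connected_by P x y"
proof -
  have "rank_in X z \<in> rank_in X ` B \<longleftrightarrow> z \<in> B" if "B \<in> P" "z \<in> X" for B z
    using inj_on_image_mem_iff[OF inj_on_rank_in[OF assms(1)] that(2)] that(1) partition_onD1[OF assms(2)] by blast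
  then show ?thesis using assms(3,4) by (auto simp: connected_by_def relabel_def)
qed

lemma all_rank_in: "finite X \<Longrightarrow> (\<forall>i\<in>{1..card X}. Q i) \<longleftrightarrow> (\<forall>x\<in>X. Q (rank_in X x))"
  unfolding rank_in_image[symmetric] by blast

lemma refines_relabel:
  assumes "finite X" "partition_on X P" "partition_on X Q"
  shows "refines {1..card X} (relabel X P) (relabel X Q) \<longleftrightarrow> refines X P Q"
proof -
  have *: "(\<forall>x y. connected_by S x y \<longrightarrow> connected_by T x y) \<longleftrightarrow>
      (\<forall>x\<in>A. \<forall>y\<in>A. connected_by S x y \<longrightarrow> connected_by T x y)" if "partition_on A S"
    for S T :: "'c set set" and A
    using connected_by_equiv(4)[OF that] by blast
  show ?thesis
    unfolding refines_iff_connected[OF assms(2,3)] *[OF assms(2)]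
      refines_iff_connected[OF partition_on_relabel[OF assms(1,2)] partition_on_relabel[OF assms(1,3)]]
      *[OF partition_on_relabel[OF assms(1,2)]]
    unfolding all_rank_in[OF assms(1)]
    using connected_by_relabel[OF assms(1,2)] connected_by_relabel[OF assms(1,3)] by blast
qed

lemma noncrossing_relabel:
  assumes "finite X" "partition_on X P"
  shows "noncrossing (relabel X P) \<longleftrightarrow> noncrossing P"
proof -
  have *: "noncrossing S \<longleftrightarrow> (\<forall>a\<in>A. \<forall>b\<in>A. \<forall>c\<in>A. \<forall>d\<in>A.
      a < b \<longrightarrow> b < c \<longrightarrow> c < d \<longrightarrow> connected_by S a c \<longrightarrow> connected_by S b d \<longrightarrow> connected_by S a b)"
    if S: "partition_on A S" for S :: "'c::linorder set set" and A
    unfolding noncrossing_iff_connected[OF S] using connected_by_equiv(4)[OF S] by meson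
  show ?thesis
    unfolding *[OF assms(2)] *[OF partition_on_relabel[OF assms]] all_rank_in[OF assms(1)]
    by (simp add: rank_in_less_iff connected_by_relabel assms cong: ball_cong)
qed

lemma relabel_NC: "finite X \<Longrightarrow> P \<in> NC X \<Longrightarrow> relabel X P \<in> NC {1..card X}"
  using partition_on_relabel noncrossing_relabel by (auto simp: NC_def)

lemma kreweras_inv:
  assumes "finite X" "R \<in> NC X"
  shows "kreweras_inv X R \<in> NC X" and "relabel X (kreweras_inv X R) = compl_inv (card X) (relabel X R)"
proof -
  let ?n = "card X" and ?C = "compl_inv (card X) (relabel X R)"
  note R = relabel_NC[OF assms]
  have C: "?C \<in> NC {1..?n}" by (rule kreweras_compl_inv(1)[OF R])
  then have "?C \<in> relabel X ` {P. partition_on X P}"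
    using bij_betw_imp_surj_on[OF bij_betw_relabel[OF assms(1)]] by (auto simp: NC_def)
  then obtain P where P: "partition_on X P" "relabel X P = ?C" by auto
  then have NC: "P \<in> NC X" using C noncrossing_relabel[OF assms(1) P(1)] by (simp add: NC_def)
  have "kreweras_inv X R = P"
    unfolding kreweras_inv_def
  proof (rule the_equality)
    show "P \<in> NC X \<and> kreweras ?n (relabel X P) = relabel X R"
      using NC P(2) kreweras_compl_inv(2)[OF R] by simp
    fix Q assume Q: "Q \<in> NC X \<and> kreweras ?n (relabel X Q) = relabel X R"
    then have "relabel X Q = ?C" using kreweras_compl_inv(3)[OF R] relabel_NC[OF assms(1)] by blast
    moreover have "partition_on X Q" using Q by (simp add: NC_def)
    ultimately show "Q = P"
      using P inj_onD[OF bij_betw_imp_inj_on[OF bij_betw_relabel[OF assms(1)]]] by simp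
  qed
  then show "kreweras_inv X R \<in> NC X" "relabel X (kreweras_inv X R) = ?C" using NC P(2) by auto
qed

text \<open>\<open>rank_in X\<close> is increasing on X, so it commutes with minima of blocks and
  keeps their order, and it preserves the sizes of blocks.\<close>

lemma prod_list_relabel:
  assumes "finite X" "partition_on X R"
  shows "map (\<lambda>x. F (card (THE b. b \<in> relabel X R \<and> x \<in> b))) (sorted_list_of_set (Min ` relabel X R)) =
    map (\<lambda>x. F (card (THE b. b \<in> R \<and> x \<in> b))) (sorted_list_of_set (Min ` R))"
proof -
  have block: "finite b" "b \<noteq> {}" "b \<subseteq> X" "Min b \<in> b" if "b \<in> R" for b
  proof -
    show "b \<subseteq> X" using that partition_onD1[OF assms(2)] by blast
    then show "finite b" using assms(1) finite_subset by blast
    show "b \<noteq> {}" using that partition_onD3[OF assms(2)] by blast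
    then show "Min b \<in> b" using \<open>finite b\<close> by simp
  qed
  have finR: "finite R" using assms by (rule finite_elements)
  have MinX: "Min ` R \<subseteq> X" using block by blast
  have the: "(THE b. b \<in> Q \<and> x \<in> b) = b" if "partition_on A Q" "b \<in> Q" "x \<in> b"
    for A :: "'c set" and Q b x
    using that disjointD[OF partition_onD2[OF that(1)]] by (intro the_equality) auto
  have "Min ` relabel X R = rank_in X ` Min ` R"
    unfolding relabel_def image_image
    by (rule image_cong[OF refl]) (use mono_Min_commute[OF mono_rank_in[OF assms(1)]] block in auto)
  moreover have "sorted_list_of_set (rank_in X ` Min ` R) = map (rank_in X) (sorted_list_of_set (Min ` R))"
  proof (rule sorted_distinct_set_unique)
    show "sorted (map (rank_in X) (sorted_list_of_set (Min ` R)))"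
      unfolding sorted_map by (rule sorted_wrt_mono_rel[OF _ sorted_sorted_list_of_set])
        (rule monoD[OF mono_rank_in[OF assms(1)]])
    show "distinct (map (rank_in X) (sorted_list_of_set (Min ` R)))"
      using inj_on_rank_in[OF assms(1)] MinX finR by (auto simp: distinct_map intro: inj_on_subset)
  qed (use finR in auto)
  moreover have "card (THE b. b \<in> relabel X R \<and> rank_in X x \<in> b) = card (THE b. b \<in> R \<and> x \<in> b)"
    if x: "x \<in> Min ` R" for x
  proof -
    obtain b where b: "b \<in> R" "x \<in> b" using x block(4) by blast
    then have "rank_in X ` b \<in> relabel X R" "rank_in X x \<in> rank_in X ` b" by (auto simp: relabel_def)
    then have "(THE b. b \<in> relabel X R \<and> rank_in X x \<in> b) = rank_in X ` b"
      by (rule the[OF partition_on_relabel[OF assms]])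
    moreover have "card (rank_in X ` b) = card b"
      using inj_on_rank_in[OF assms(1)] block(3)[OF b(1)] by (intro card_image) (rule inj_on_subset)
    ultimately show ?thesis using the[OF assms(2) b] by simp
  qed
  ultimately show ?thesis using finR by simp
qed

subsection \<open>Moments\<close>

text \<open>Each word has exactly one kernel, so grouping words by kernel turns a sum of indicators
  into a sum of words. G selects the kernels: all of them for \<open>M_P\<close>, those above the
  inverse Kreweras complement for \<open>M_P_NC\<close>.\<close>

lemma component_sum_Sigma_partition:
  assumes X: "finite X" "X \<noteq> {}"
  shows "component (\<Sum>S | partition_on X S \<and> G (relabel X S). Sigma_partition S) q =
    (\<Sum>as | as \<in> closed_words 0 {1..q} (card X) \<and> G (walk_kernel 0 as). word_elem 0 as)"
proof -
  let ?n = "card X"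
  let ?W = "closed_words 0 {1..q} ?n"
  let ?T = "{P. partition_on {1..?n} P \<and> G P}"
  let ?S = "{as. as \<in> ?W \<and> G (walk_kernel 0 as)}"
  have n: "1 \<le> ?n" using X by (simp add: Suc_le_eq card_gt_0_iff)
  have "component (\<Sum>S | partition_on X S \<and> G (relabel X S). Sigma_partition S) q =
      (\<Sum>S | partition_on X S \<and> G (relabel X S). class_ind_on {1..q} (cycle_type ?n (relabel X S)))"
    unfolding component_sum
  proof (rule sum.cong[OF refl])
    fix S assume "S \<in> {S. partition_on X S \<and> G (relabel X S)}"
    then have "\<Union>S = X" using partition_onD1 by blast
    then show "component (Sigma_partition S) q = class_ind_on {1..q} (cycle_type ?n (relabel X S))"
      by (simp add: Sigma_partition_def class_ind.rep_eq)
  qed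
  also have "\<dots> = (\<Sum>P\<in>?T. class_ind_on {1..q} (cycle_type ?n P))"
  proof (rule sum.reindex_bij_betw)
    have "bij_betw (relabel X) {S \<in> {S. partition_on X S}. G (relabel X S)} {P \<in> {P. partition_on {1..?n} P}. G P}"
      by (rule bij_betw_Collect[OF bij_betw_relabel[OF X(1)]]) simp
    then show "bij_betw (relabel X) {S. partition_on X S \<and> G (relabel X S)} ?T" by simp
  qed
  also have "\<dots> = (\<Sum>P\<in>?T. \<Sum>as | as \<in> ?S \<and> walk_kernel 0 as = P. word_elem 0 as)"
  proof (rule sum.cong[OF refl])
    fix P assume P: "P \<in> ?T"
    then interpret interval_partition ?n P using n by unfold_locales auto
    have "{as. as \<in> ?W \<and> walk_kernel 0 as = P} = {as. as \<in> ?S \<and> walk_kernel 0 as = P}"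
      using P by auto
    then show "class_ind_on {1..q} (cycle_type ?n P) = (\<Sum>as | as \<in> ?S \<and> walk_kernel 0 as = P. word_elem 0 as)"
      using class_ind_on_cycle_type[of 0 "{1..q}"] by simp
  qed
  also have "\<dots> = sum (word_elem 0) ?S"
  proof (rule sum.group)
    show "finite ?S"
      by (rule finite_subset[OF _ finite_lists_length_eq[of "{1..q}" ?n]]) (auto simp: closed_words_def)
    show "finite ?T"
      by (rule finite_subset[OF _ finitely_many_partition_on[of "{1..?n}"]]) auto
    show "walk_kernel 0 ` ?S \<subseteq> ?T"
    proof
      fix P assume "P \<in> walk_kernel 0 ` ?S"
      then obtain as where "length as = ?n" "G P" "P = walk_kernel 0 as"
        by (auto simp: closed_words_def)
      then show "P \<in> ?T" using partition_on_walk_kernel[of as 0] by simp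
    qed
  qed
  finally show ?thesis .
qed

section \<open>Partition moments as plain sums of partitions\<close>

lemma finite_partitions: "finite X \<Longrightarrow> finite {S. partition_on X S}"
  by (rule finitely_many_partition_on)

lemma lookup_M_P:
  assumes "finite X"
  shows "Poly_Mapping.lookup (M_P X) S = (if partition_on X S then 1 else 0)"
  using finite_partitions[OF assms] by (simp add: M_P_def Poly_Mapping.lookup_sum lookup_single when_def sum.delta)

lemma keys_M_P: "finite X \<Longrightarrow> Poly_Mapping.keys (M_P X) = {S. partition_on X S}"
  by (auto simp: in_keys_iff lookup_M_P split: if_splits)

text \<open>A partition S of X agrees with exactly one family of partitions of the blocks of R, that
  of its restrictions. Summing over all families therefore counts each S above
  \<open>kreweras_inv X R\<close> once.\<close>

lemma M_P_NC_eq: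
  assumes fin: "finite X" and part: "partition_on X R"
  shows "M_P_NC R = (\<Sum>S | partition_on X S \<and> refines X (kreweras_inv X R) S. Poly_Mapping.single S 1)"
proof -
  have UR: "\<Union>R = X" using partition_onD1[OF part] by simp
  have sub: "b \<subseteq> X" if "b \<in> R" for b using UR that by blast
  then have finb: "finite b" if "b \<in> R" for b using that fin finite_subset by blast
  have finR: "finite R" using fin part by (rule finite_elements)
  let ?Pi = "PiE R (\<lambda>b. {S. partition_on b S})"
  let ?F = "{S. partition_on X S \<and> refines X (kreweras_inv X R) S}"
  define restr where "restr S = restrict (\<lambda>b. (\<inter>) b ` S - {{}}) R" for S :: "'a set set"
  have restr_part: "partition_on b (restr S b)" if "partition_on X S" "b \<in> R" for S b
    using partition_on_restrict[OF that(1), of b] sub[OF that(2)] that(2)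
    by (simp add: restr_def Int_absorb2)
  have restr_con: "connected_by (restr S b) x y \<longleftrightarrow> connected_by S x y" if "b \<in> R" "x \<in> b" "y \<in> b" for S b x y
    using that by (auto simp: restr_def connected_by_def)
  have restr_iff: "(\<forall>b\<in>R. \<forall>x\<in>b. \<forall>y\<in>b. connected_by S x y \<longleftrightarrow> connected_by (p b) x y) \<longleftrightarrow> restr S = p"
    if S: "partition_on X S" and p: "p \<in> ?Pi" for S p
  proof
    assume con: "\<forall>b\<in>R. \<forall>x\<in>b. \<forall>y\<in>b. connected_by S x y \<longleftrightarrow> connected_by (p b) x y"
    show "restr S = p"
    proof
      fix b
      show "restr S b = p b"
      proof (cases "b \<in> R")
        case True
        then have pb: "partition_on b (p b)" using p by auto
        show ?thesis
          unfolding partition_eq_iff_connected[OF restr_part[OF S True] pb]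
          using connected_by_equiv(4)[OF restr_part[OF S True]] connected_by_equiv(4)[OF pb]
            restr_con[OF True] con True by blast
      next
        case False
        then have "restr S b = undefined" by (simp add: restr_def)
        then show ?thesis using PiE_arb[OF p False] by simp
      qed
    qed
  next
    assume "restr S = p"
    then show "\<forall>b\<in>R. \<forall>x\<in>b. \<forall>y\<in>b. connected_by S x y \<longleftrightarrow> connected_by (p b) x y"
      using restr_con by auto
  qed
  have "M_P_NC R = (\<Sum>p\<in>?Pi. ordered_prod_partitions R p)"
    unfolding M_P_NC_def ordered_prod_def
  proof (rule sum.cong)
    show "PiE R (\<lambda>b. Poly_Mapping.keys (M_P b)) = ?Pi"
      by (rule PiE_cong) (simp add: keys_M_P finb)
    fix p assume p: "p \<in> ?Pi"
    have "(\<Prod>b\<in>R. Poly_Mapping.lookup (M_P b) (p b)) = 1"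
      by (rule prod.neutral) (use p in \<open>auto simp: lookup_M_P finb\<close>)
    then show "Poly_Mapping.map ((*) (\<Prod>b\<in>R. Poly_Mapping.lookup (M_P b) (p b))) (ordered_prod_partitions R p) =
        ordered_prod_partitions R p" by simp
  qed
  also have "\<dots> = (\<Sum>p\<in>?Pi. \<Sum>S | S \<in> ?F \<and> restr S = p. Poly_Mapping.single S 1)"
  proof (rule sum.cong[OF refl])
    fix p assume p: "p \<in> ?Pi"
    show "ordered_prod_partitions R p = (\<Sum>S | S \<in> ?F \<and> restr S = p. Poly_Mapping.single S 1)"
      unfolding ordered_prod_partitions_def UR
      by (rule sum.cong) (use restr_iff[OF _ p] in auto)
  qed
  also have "\<dots> = (\<Sum>S\<in>?F. Poly_Mapping.single S 1)"
  proof (rule sum.group)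
    show "finite ?F" by (rule finite_subset[OF _ finite_partitions[OF fin]]) auto
    show "finite ?Pi" using finR finb finite_partitions by (intro finite_PiE) auto
    show "restr ` ?F \<subseteq> ?Pi"
    proof
      fix p assume "p \<in> restr ` ?F"
      then obtain S where S: "partition_on X S" "p = restr S" by blast
      have "p b \<in> {S. partition_on b S}" if "b \<in> R" for b using restr_part[OF S(1) that] S(2) by simp
      moreover have "p b = undefined" if "b \<notin> R" for b using S(2) that by (simp add: restr_def)
      ultimately show "p \<in> ?Pi" by (intro PiE_I)
    qed
  qed
  finally show ?thesis .
qed

lemma Sigma_lin_M_P:
  assumes "finite X" "X \<noteq> {}"
  shows "Sigma_lin (M_P X) = M_JM (card X)"
proof (rule palg_inf_eqI)
  fix q
  have "component (Sigma_lin (M_P X)) q = (\<Sum>as\<in>closed_words 0 {1..q} (card X). word_elem 0 as)"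
    using component_sum_Sigma_partition[OF assms, of "\<lambda>_. True" q]
    by (simp add: M_P_def Sigma_lin_sum)
  then show "component (Sigma_lin (M_P X)) q = component (M_JM (card X)) q"
    by (simp add: M_JM.rep_eq M_JM_on_eq)
qed

lemma Sigma_lin_M_P_NC:
  assumes "finite X" "X \<noteq> {}" "R \<in> NC X"
  shows "Sigma_lin (M_P_NC R) = M_JM_NC R"
proof (rule palg_inf_eqI)
  fix q
  let ?C = "compl_inv (card X) (relabel X R)"
  have part: "partition_on X R" using assms(3) by (simp add: NC_def)
  have "partition_on X (kreweras_inv X R)" using kreweras_inv(1)[OF assms(1,3)] by (simp add: NC_def)
  then have "refines X (kreweras_inv X R) S \<longleftrightarrow> refines {1..card X} ?C (relabel X S)" if "partition_on X S" for S
    using refines_relabel[OF assms(1) _ that] kreweras_inv(2)[OF assms(1,3)] by metis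
  then have "{S. partition_on X S \<and> refines X (kreweras_inv X R) S} =
      {S. partition_on X S \<and> refines {1..card X} ?C (relabel X S)}" by blast
  then have "component (Sigma_lin (M_P_NC R)) q =
      (\<Sum>as | as \<in> closed_words 0 {1..q} (card X) \<and> refines {1..card X} ?C (walk_kernel 0 as). word_elem 0 as)"
    using component_sum_Sigma_partition[OF assms(1,2), of "refines {1..card X} ?C" q]
    by (simp add: M_P_NC_eq[OF assms(1) part] Sigma_lin_sum)
  also have "\<dots> = prod_list (map (\<lambda>x. M_JM_on 0 {1..q} (card (THE b. b \<in> relabel X R \<and> x \<in> b)))
      (sorted_list_of_set (Min ` relabel X R)))"
    by (rule sum_refining_words[OF relabel_NC[OF assms(1,3)]]) simp
  also have "\<dots> = component (M_JM_NC R) q"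
    unfolding prod_list_relabel[OF assms(1) part] M_JM_NC_def component_prod_list map_map comp_def M_JM.rep_eq ..
  finally show "component (Sigma_lin (M_P_NC R)) q = component (M_JM_NC R) q" .
qed

theorem theorem5p12:
  fixes X :: "'a::linorder set" and Y :: "'b::linorder set" and \<rho> :: "'b set set" and n :: nat
  assumes "finite X" and "X \<noteq> {}"
    and "finite Y" and "Y \<noteq> {}" and "\<rho> \<in> NC Y"
    and "n \<ge> 1"
  shows "Sigma_lin (M_P X) = M_JM (card X) \<and>
    Sigma_lin (M_P_NC \<rho>) = M_JM_NC \<rho> \<and>
    Sigma_lin (R_P n) = R_JM n"
proof (intro conjI)
  show "Sigma_lin (M_P X) = M_JM (card X)" by (rule Sigma_lin_M_P[OF assms(1,2)])
  show "Sigma_lin (M_P_NC \<rho>) = M_JM_NC \<rho>" by (rule Sigma_lin_M_P_NC[OF assms(3-5)])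
  have "Sigma_lin (M_P_NC R) = M_JM_NC R" if "R \<in> NC {1..n}" for R
    using Sigma_lin_M_P_NC[of "{1..n}" R] that assms(6) by simp
  then show "Sigma_lin (R_P n) = R_JM n"
    by (simp add: R_P_def R_JM_def Sigma_lin_sum Sigma_lin_scale)
qed

end
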